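(* Let $T>0$, $h>0$, $n\in\mathbb N$, $\alpha\in(0,1)$, $p>\frac1\alpha$, let $(U,\rho)$ be a separable metric space and $u_0\in U$. Let $f:[0,T]\times\mathbb R^n\times\mathbb R^n\times U\to\mathbb R^n$, $(t,y,y_h,u)\mapsto f(t,y,y_h,u)$, be such that $t\mapsto f(t,y,y_h,u)$ is measurable, $(y,y_h)\mapsto f(t,y,y_h,u)$ is continuously differentiable, and $(y,y_h,u)\mapsto f(t,y,y_h,u)$, $(y,y_h,u)\mapsto f_y(t,y,y_h,u)$, $(y,y_h,u)\mapsto f_{y_h}(t,y,y_h,u)$ are continuous. Assume there are nonnegative functions $L_0(\cdot)\in L^{\frac1\alpha+}(0,T)$ and $L(\cdot)\in L^{\frac{p}{p\alpha-1}+}(0,T)$, a constant $K>0$ and a modulus of continuity $\omega$ such that for all $t,t'\in[0,T]$, $y,y',y_h,y_h'\in\mathbb R^n$, $u,u'\in U$: $$|f(t,0,0,u_0)|\le L_0(t),$$ $$|f(t,y,y_h,u)-f(t,y',y_h',u')|\le L(t)\big[|y-y'|+|y_h-y_h'|+\rho(u,u')\big],$$ $$|f(t,y,y_h,u)-f(t',y,y_h,u)|\le K\,\omega(|t-t'|)\,(1+|y|+|y_h|).$$ Let $g:[0,T]\times\mathbb R^n\times\mathbb R^n\times U\to\mathbb R$ be such that $t\mapsto g(t,y,y_h,u)$ is measurable, $(y,y_h)\mapsto g(t,y,y_h,u)$ is continuously differentiable, $(y,y_h,u)\mapsto\big(g,g_y,g_{y_h}\big)(t,y,y_h,u)$ is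 continuous, and there is a constant $\bar L>0$ with $$|g(t,0,0,u)|+|g_y(t,y,y_h,u)|+|g_{y_h}(t,y,y_h,u)|\le\bar L,\qquad (t,y,y_h,u)\in[0,T]\times\mathbb R^n\times\mathbb R^n\times U.$$ Consider the problem of minimizing $$J(u(\cdot))=\int_0^T g(t,y(t),y(t-h),u(t))\,dt$$ over $u(\cdot)\in U^p[0,T]$, where $y$ is the state corresponding to $u$, i.e. the solution of $${}^{C}D^{\alpha}_{t}y(t)=f(t,y(t),y(t-h),u(t))\ \text{ a.e. } t\in[0,T],\qquad y(t)=0\ \text{ for } -h\le t\le 0.$$ Assume that $(y^*(\cdot),u^*(\cdot))$ is an optimal pair for this problem. Then there is a solution $\psi\in L^{\frac{p}{p-1}}(0,T;\mathbb R^n)$ of the adjoint equation $$\begin{aligned}{}^{C}D^{\alpha}_{T}\psi(t)=&-g_y(t,y^*(t),y^*(t-h),u^*(t))^\top-\chi_{(0,T-h)}(t)\,g_{y_h}(t+h,y^*(t+h),y^*(t),u^*(t+h))^\top\\&+f_y(t,y^*(t),y^*(t-h),u^*(t))^\top\psi(t)+\chi_{(0,T-h)}(t)\,f_{y_h}(t+h,y^*(t+h),y^*(t),u^*(t+h))^\top\psi(t+h),\end{aligned}$$ for a.e. $t\in[0,T]$, with $\psi(t)=0$ for $T\le t\le T+h$, such that for a.e. $t\in[0,T]$ $$\psi(t)^\top f(t,y^*(t),y^*(t-h),u^*(t))-g(t,y^*(t),y^*(t-h),u^*(t))=\max_{u\in U}\big[\psi(t)^\top f(t,y^*(t),y^*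(t-h),u)-g(t,y^*(t),y^*(t-h),u)\big].$$
   Context: For $1\le q<\infty$, $L^{q+}(0,T)=\bigcup_{r>q}L^r(0,T)$. A modulus of continuity is a continuous strictly increasing function $\omega:[0,\infty)\to[0,\infty)$ with $\omega(0)=0$. $U^p[0,T]=\{u:[0,T]\to U \mid u \text{ is measurable (for the Borel } \sigma\text{-field of } U),\ \rho(u(\cdot),u_0)\in L^p(0,T)\}$. $f_y,f_{y_h}$ are the Jacobian matrices of $f$ in the variables $y$ and $y_h$ (the latter is the argument in which the delayed state $y(t-h)$ is inserted); $g_y,g_{y_h}$ are the gradients of $g$, regarded as row vectors. $\chi_{(0,T-h)}$ is the characteristic function of the interval $(0,T-h)$ (the empty set if $h\ge T$), and terms multiplied by $\chi_{(0,T-h)}(t)=0$ are understood to be zero. ${}^{C}D^\alpha_t$ is the left Caputo derivative of order $\alpha$ based at $0$, $({}^{C}D^\alpha\phi)(t)=\frac1{\Gamma(1-\alpha)}\int_0^t(t-\tau)^{-\alpha}\phi'(\tau)d\tau$, equal to the Riemann–Liouville derivative of $\phi-\phi(0)$. The state equation with zero initial history is understood in its integral form $y(t)=\frac1{\Gamma(\alpha)}\int_0^t (t-s)^{\alpha-1}f(s,y(s),y(s-h),u(s))\,ds$, $t\in[0,T]$, with $y=0$ on $[-h,0]$. ${}^{C}D^\alpha_T$ is the right Caputo derivative of order $\alpha$ based at $T$, $({}^{C}D^\alpha_T\psi)(t)=-\frac1{\Gamma(1-\alpha)}\int_t^T(\tau-t)^{-\alpha}\psi'(\tau)d\tau$;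 the equation ${}^{C}D^\alpha_T\psi=F$ with $\psi(T)=0$ is likewise understood as $\psi(t)=\frac1{\Gamma(\alpha)}\int_t^T(s-t)^{\alpha-1}F(s)\,ds$. A control $u^*\in U^p[0,T]$ is optimal if $J(u^*(\cdot))=\inf_{u(\cdot)\in U^p[0,T]}J(u(\cdot))$; with $y^*$ the state corresponding to $u^*$, $(y^*,u^* )$ is called an optimal pair. *)

theory Defs
  imports "HOL-Analysis.Analysis"
begin

text \<open>
  Functions on a time interval are total functions on \<^typ>\<open>real\<close> that are only
  constrained on that interval; measurability is Lebesgue measurability. The metric
  space $(U,\rho)$ is a type of class \<^class>\<open>metric_space\<close> with $\rho$ = \<^const>\<open>dist\<close>.
  In \<open>f t y z u\<close> and \<open>g t y z u\<close> the third argument \<open>z\<close> is the slot $y_h$ of the delayed state.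
\<close>

definition Lp :: "real \<Rightarrow> real \<Rightarrow> (real \<Rightarrow> 'a::real_normed_vector) \<Rightarrow> bool" where
  "Lp q T \<phi> \<longleftrightarrow> \<phi> \<in> borel_measurable (lebesgue_on {0<..<T}) \<and>
     integrable (lebesgue_on {0<..<T}) (\<lambda>t. norm (\<phi> t) powr q)"

definition Lp_plus :: "real \<Rightarrow> real \<Rightarrow> (real \<Rightarrow> 'a::real_normed_vector) \<Rightarrow> bool" where
  "Lp_plus q T \<phi> \<longleftrightarrow> (\<exists>r>q. Lp r T \<phi>)"

definition modulus_of_continuity :: "(real \<Rightarrow> real) \<Rightarrow> bool" where
  "modulus_of_continuity \<omega> \<longleftrightarrow>
     \<omega> \<in> {0..} \<rightarrow> {0..} \<and> continuous_on {0..} \<omega> \<and> strict_mono_on {0..} \<omega> \<and> \<omega> 0 = 0"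

definition continuously_differentiable ::
    "('a::real_normed_vector \<Rightarrow> 'b::real_normed_vector) \<Rightarrow> bool" where
  "continuously_differentiable F \<longleftrightarrow>
     (\<exists>F'. (\<forall>x. (F has_derivative blinfun_apply (F' x)) (at x)) \<and> continuous_on UNIV F')"

text \<open>
  The gradient has type \<^typ>\<open>real^'n\<close>, which does not distinguish rows from columns, so
  the transposes on gradients disappear.
\<close>

definition grad :: "(real^'n \<Rightarrow> real) \<Rightarrow> real^'n \<Rightarrow> real^'n" where
  "grad F x = (\<chi> i. frechet_derivative F (at x) (axis i 1))"

definition Jac_y :: "(real \<Rightarrow> real^'n \<Rightarrow> real^'n \<Rightarrow> 'u \<Rightarrow> real^'n) \<Rightarrow>
    real \<Rightarrow> real^'n \<Rightarrow> real^'n \<Rightarrow> 'u \<Rightarrow> real^'n^'n" where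
  "Jac_y f t y z u = jacobian (\<lambda>x. f t x z u) (at y)"

definition Jac_yh :: "(real \<Rightarrow> real^'n \<Rightarrow> real^'n \<Rightarrow> 'u \<Rightarrow> real^'n) \<Rightarrow>
    real \<Rightarrow> real^'n \<Rightarrow> real^'n \<Rightarrow> 'u \<Rightarrow> real^'n^'n" where
  "Jac_yh f t y z u = jacobian (\<lambda>x. f t y x u) (at z)"

definition grad_y :: "(real \<Rightarrow> real^'n \<Rightarrow> real^'n \<Rightarrow> 'u \<Rightarrow> real) \<Rightarrow>
    real \<Rightarrow> real^'n \<Rightarrow> real^'n \<Rightarrow> 'u \<Rightarrow> real^'n" where
  "grad_y g t y z u = grad (\<lambda>x. g t x z u) y"

definition grad_yh :: "(real \<Rightarrow> real^'n \<Rightarrow> real^'n \<Rightarrow> 'u \<Rightarrow> real) \<Rightarrow>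
    real \<Rightarrow> real^'n \<Rightarrow> real^'n \<Rightarrow> 'u \<Rightarrow> real^'n" where
  "grad_yh g t y z u = grad (\<lambda>x. g t y x u) z"

definition controls :: "real \<Rightarrow> real \<Rightarrow> 'u::metric_space \<Rightarrow> (real \<Rightarrow> 'u) set" where
  "controls p T u0 = {u. u \<in> borel_measurable (lebesgue_on {0..T}) \<and> Lp p T (\<lambda>t. dist (u t) u0)}"

text \<open>
  Caputo equations with zero initial (terminal) value are read in their integral form, at
  every point of $[0,T]$. Since Isabelle's integral of a non-integrable function is \<open>0\<close>,
  existence of the integral is part of the equation.
\<close>

definition left_Caputo_solution ::
    "real \<Rightarrow> real \<Rightarrow> (real \<Rightarrow> real^'n) \<Rightarrow> (real \<Rightarrow> real^'n) \<Rightarrow> bool" where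
  "left_Caputo_solution \<alpha> T F y \<longleftrightarrow> (\<forall>t\<in>{0..T}.
     set_integrable lebesgue {0..t} (\<lambda>s. (t - s) powr (\<alpha> - 1) *\<^sub>R F s) \<and>
     y t = (1 / Gamma \<alpha>) *\<^sub>R (LINT s:{0..t}|lebesgue. (t - s) powr (\<alpha> - 1) *\<^sub>R F s))"

definition right_Caputo_solution ::
    "real \<Rightarrow> real \<Rightarrow> (real \<Rightarrow> real^'n) \<Rightarrow> (real \<Rightarrow> real^'n) \<Rightarrow> bool" where
  "right_Caputo_solution \<alpha> T F \<psi> \<longleftrightarrow> (\<forall>t\<in>{0..T}.
     set_integrable lebesgue {t..T} (\<lambda>s. (s - t) powr (\<alpha> - 1) *\<^sub>R F s) \<and>
     \<psi> t = (1 / Gamma \<alpha>) *\<^sub>R (LINT s:{t..T}|lebesgue. (s - t) powr (\<alpha> - 1) *\<^sub>R F s))"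

definition is_state :: "real \<Rightarrow> real \<Rightarrow> real \<Rightarrow>
    (real \<Rightarrow> real^'n \<Rightarrow> real^'n \<Rightarrow> 'u \<Rightarrow> real^'n) \<Rightarrow> (real \<Rightarrow> 'u) \<Rightarrow> (real \<Rightarrow> real^'n) \<Rightarrow> bool" where
  "is_state \<alpha> T h f u y \<longleftrightarrow>
     left_Caputo_solution \<alpha> T (\<lambda>s. f s (y s) (y (s - h)) (u s)) y \<and> (\<forall>t\<in>{-h..0}. y t = 0)"

definition cost :: "real \<Rightarrow> real \<Rightarrow> (real \<Rightarrow> real^'n \<Rightarrow> real^'n \<Rightarrow> 'u \<Rightarrow> real) \<Rightarrow>
    (real \<Rightarrow> 'u) \<Rightarrow> (real \<Rightarrow> real^'n) \<Rightarrow> real" where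
  "cost T h g u y = (LINT t:{0..T}|lebesgue. g t (y t) (y (t - h)) (u t))"

text \<open>
  Under the standing assumptions every control has exactly one state on $[-h,T]$, so the
  infimum over control-state pairs is the infimum of $J(u)$ over controls. It is taken in
  \<^typ>\<open>ereal\<close>, where it exists without a boundedness proviso.
\<close>

definition optimal_pair :: "real \<Rightarrow> real \<Rightarrow> real \<Rightarrow> real \<Rightarrow> 'u::metric_space \<Rightarrow>
    (real \<Rightarrow> real^'n \<Rightarrow> real^'n \<Rightarrow> 'u \<Rightarrow> real^'n) \<Rightarrow>
    (real \<Rightarrow> real^'n \<Rightarrow> real^'n \<Rightarrow> 'u \<Rightarrow> real) \<Rightarrow>
    (real \<Rightarrow> real^'n) \<Rightarrow> (real \<Rightarrow> 'u) \<Rightarrow> bool" where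
  "optimal_pair \<alpha> p T h u0 f g y u \<longleftrightarrow>
     u \<in> controls p T u0 \<and> is_state \<alpha> T h f u y \<and>
     ereal (cost T h g u y) =
       Inf {ereal (cost T h g v x) | v x. v \<in> controls p T u0 \<and> is_state \<alpha> T h f v x}"

definition adjoint_rhs :: "real \<Rightarrow> real \<Rightarrow>
    (real \<Rightarrow> real^'n \<Rightarrow> real^'n \<Rightarrow> 'u \<Rightarrow> real^'n) \<Rightarrow>
    (real \<Rightarrow> real^'n \<Rightarrow> real^'n \<Rightarrow> 'u \<Rightarrow> real) \<Rightarrow>
    (real \<Rightarrow> real^'n) \<Rightarrow> (real \<Rightarrow> 'u) \<Rightarrow> (real \<Rightarrow> real^'n) \<Rightarrow> real \<Rightarrow> real^'n" where
  "adjoint_rhs T h f g y u \<psi> t =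
     - grad_y g t (y t) (y (t - h)) (u t)
     - indicator {0<..<T - h} t *\<^sub>R grad_yh g (t + h) (y (t + h)) (y t) (u (t + h))
     + transpose (Jac_y f t (y t) (y (t - h)) (u t)) *v \<psi> t
     + indicator {0<..<T - h} t *\<^sub>R
         (transpose (Jac_yh f (t + h) (y (t + h)) (y t) (u (t + h))) *v \<psi> (t + h))"

definition is_maximum :: "real \<Rightarrow> real set \<Rightarrow> bool" where
  "is_maximum m S \<longleftrightarrow> m \<in> S \<and> (\<forall>x\<in>S. x \<le> m)"

end

theory Submission
  imports Defs
begin

text \<open>
  A spike variation replaces \<open>u*\<close> by a constant \<open>v\<close> on a small measurable set \<open>E\<close>. The right-hand
  side increment \<open>D\<close> and the state increment \<open>d = k * D\<close>, where $k(\sigma)=\sigma^{\alpha-1}/\Gamma(\alpha)$,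
  satisfy $|D| \le L(|d| + |d(\cdot-h)|) + |\delta f|1_E$. As $L\in L^r$ with $r>1/\alpha$, the numbers
  $\int k(s-\tau)L(s)e^{-\mu(s-\tau)}\,ds$ are small uniformly in $\tau$ for large $\mu$. Hence the Volterra
  equations for \<open>d\<close> and for the adjoint \<open>\<psi>\<close> have bounded solutions, and $\|D\|_1 \le C\|\delta f\|_{L^1(E)}$. By
  Fubini, the cost changes by $\int_E(\delta g-\psi\cdot\delta f)$ plus a remainder $\int\rho_E(|d|+|d(\cdot-h)|)$ with
  $\rho_E\to 0$ in $L^r$, which is therefore $o(\|\delta f\|_{L^1(E)})$. Letting \<open>E\<close> shrink inside the set where
  $\delta g-\psi\cdot\delta f<-c$ contradicts optimality if this set is not null. A countable dense set of
  values \<open>v\<close> yields the maximum condition.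
\<close>

subsection \<open>Lebesgue measure and measurable composition\<close>

text \<open>The weight \<open>L\<close> is unbounded, so the increment \<open>d\<close> is compared
  with the measure of \<open>E\<close> in L1, and continuous derivatives give no rate for the
  remainder. The remainder is therefore divided by |d| + |d(.-h)|: the quotient has a fixed majorant
  in L^r and tends to zero almost everywhere along a subsequence, and the kernel converts its L^r
  smallness into a small factor in front of the L1 norm of \<open>D\<close>. The duality identity is
  exact, so this is the only error, and arbitrary sets of small positive measure serve as spikes,
  without any density property. All functions are extended by zero to the line: delay and advance
  become translations, and the left and right Caputo integrals become two convolutions with one
  kernel, adjoint to each other by Fubini. The condition r > 1/\<alpha> says that the kernel lies in
  L^q with q = r/(r-1); it follows from r > p/(p\<alpha>-1) > 1/\<alpha>. Measurability of the state
  and of the Jacobians in time is derived from the equation and from \<open>f\<close> and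
  \<open>g\<close>.\<close>

lemma sigma_finite_lebesgue: "sigma_finite_measure (lebesgue :: real measure)"
proof
  let ?A = "range (\<lambda>n::nat. {- real n..real n})"
  have "x \<in> \<Union>?A" for x :: real
  proof -
    obtain n :: nat where "\<bar>x\<bar> \<le> real n" using real_arch_simple by blast
    then show ?thesis by (auto simp: abs_le_iff intro!: exI[of _ n])
  qed
  then show "\<exists>A::real set set. countable A \<and> A \<subseteq> sets lebesgue \<and> \<Union>A = space lebesgue \<and>
      (\<forall>a\<in>A. emeasure lebesgue a \<noteq> \<infinity>)"
    by (intro exI[of _ ?A]) auto
qed

interpretation lebesgue: sigma_finite_measure "lebesgue :: real measure"
  by (rule sigma_finite_lebesgue)

interpretation lebesgue_pair: pair_sigma_finite "lebesgue :: real measure" "lebesgue :: real measure"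
  ..

lemma borel_measurable_lebesgue:
  "f \<in> borel_measurable borel \<Longrightarrow> f \<in> borel_measurable lebesgue"
  by (simp add: measurable_completion)

lemma id_lebesgue_borel [measurable]: "(\<lambda>x::real. x) \<in> borel_measurable lebesgue"
  by (rule borel_measurable_lebesgue) simp

text \<open>Tonelli and Fubini run over the product of two completed measures. The coordinate
  projections are Borel there, so a Borel kernel evaluated at a difference of the coordinates is
  jointly measurable.\<close>

lemma fst_borel [measurable]: "fst \<in> borel_measurable ((lebesgue :: real measure) \<Otimes>\<^sub>M M)"
  using measurable_compose[OF measurable_fst id_lebesgue_borel] by simp

lemma snd_borel [measurable]: "snd \<in> borel_measurable (M \<Otimes>\<^sub>M (lebesgue :: real measure))"
  using measurable_compose[OF measurable_snd id_lebesgue_borel] by simp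

lemma affine_measurable_lebesgue:
  fixes c t :: real
  shows "c \<noteq> 0 \<Longrightarrow> (\<lambda>x. t + c * x) \<in> lebesgue \<rightarrow>\<^sub>M lebesgue"
  using lebesgue_affine_measurable[where c = "\<lambda>x::real. c"] by simp

lemma shift_measurable_lebesgue:
  fixes f :: "real \<Rightarrow> 'b::topological_space"
  assumes "f \<in> borel_measurable lebesgue"
  shows "(\<lambda>x. f (x + c)) \<in> borel_measurable lebesgue" "(\<lambda>x. f (x - c)) \<in> borel_measurable lebesgue"
  using measurable_compose[OF affine_measurable_lebesgue[of 1 c] assms]
    measurable_compose[OF affine_measurable_lebesgue[of 1 "-c"] assms]
  by (simp_all add: algebra_simps)

lemma nn_integral_lebesgue_shift:
  fixes f :: "real \<Rightarrow> ennreal"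
  assumes "f \<in> borel_measurable lebesgue"
  shows "(\<integral>\<^sup>+x. f (x + c) \<partial>lebesgue) = (\<integral>\<^sup>+x. f x \<partial>lebesgue)"
    and "(\<integral>\<^sup>+x. f (x - c) \<partial>lebesgue) = (\<integral>\<^sup>+x. f x \<partial>lebesgue)"
    and "(\<integral>\<^sup>+x. f (c - x) \<partial>lebesgue) = (\<integral>\<^sup>+x. f x \<partial>lebesgue)"
  using nn_integral_real_affine_lebesgue[OF assms, of 1 c]
    nn_integral_real_affine_lebesgue[OF assms, of 1 "-c"]
    nn_integral_real_affine_lebesgue[OF assms, of "-1" c]
  by (simp_all add: algebra_simps)

text \<open>The values of \<open>v\<close> are rounded to a countable dense set. Each rounded
  composition has countably many branches \<open>F t (c n)\<close> and is measurable; continuity of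
  \<open>F t\<close> carries this to the limit.\<close>

lemma borel_measurable_Caratheodory:
  fixes F :: "'a \<Rightarrow> 'x::metric_space \<Rightarrow> 'b::metric_space"
  assumes sep: "separable_space (euclidean :: 'x topology)"
    and F: "\<And>x. (\<lambda>t. F t x) \<in> borel_measurable M"
    and cont: "\<And>t. t \<in> space M \<Longrightarrow> continuous_on UNIV (F t)"
    and v: "v \<in> borel_measurable M"
  shows "(\<lambda>t. F t (v t)) \<in> borel_measurable M"
proof -
  obtain C :: "'x set" where C: "countable C" "closure C = UNIV"
    using sep unfolding separable_space_def by auto
  then have "C \<noteq> {}" by auto
  define c where "c = from_nat_into C"
  have rc: "range c = C"
    unfolding c_def by (rule range_from_nat_into) fact+
  have ex: "\<exists>n. dist (c n) x < e" if e: "e > 0" for x e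
  proof -
    have "x \<in> closure C" using C by simp
    then obtain y where "y \<in> C" "dist y x < e"
      using closure_approachable[of x C] e by blast
    moreover from this obtain n where "y = c n" using rc by blast
    ultimately show ?thesis by blast
  qed
  \<comment> \<open>Taking the least admissible index makes the rounding a measurable
    choice.\<close>
  define N where "N k t = (LEAST n. dist (c n) (v t) < 1 / real (Suc k))" for k t
  have N: "dist (c (N k t)) (v t) < 1 / real (Suc k)" for k t
    unfolding N_def by (rule LeastI_ex, rule ex) simp
  note v[measurable]
  have [measurable]: "(\<lambda>t. dist (c n) (v t)) \<in> borel_measurable M" for n
    by (rule measurable_compose[OF v]) (intro borel_measurable_continuous_onI continuous_intros)
  have [measurable]: "N k \<in> measurable M (count_space UNIV)" for k
    unfolding N_def by (intro measurable_Least) simp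
  have meas: "(\<lambda>t. F t (c (N k t))) \<in> borel_measurable M" for k
    by (rule measurable_compose_countable[where f="\<lambda>n t. F t (c n)"]) (use F in auto)
  show ?thesis
  proof (rule borel_measurable_LIMSEQ_metric[OF meas])
    fix t assume t: "t \<in> space M"
    have "(\<lambda>k. c (N k t)) \<longlonglongrightarrow> v t"
    proof (rule metric_tendsto_imp_tendsto[where f="\<lambda>k. 1 / real (Suc k)" and a=0])
      show "(\<lambda>k. 1 / real (Suc k)) \<longlonglongrightarrow> 0" by (rule LIMSEQ_Suc[OF lim_1_over_n])
      show "\<forall>\<^sub>F k in sequentially. dist (c (N k t)) (v t) \<le> dist (1 / real (Suc k)) 0"
        using N by (intro always_eventually allI) (simp add: less_imp_le)
    qed
    then show "(\<lambda>k. F t (c (N k t))) \<longlonglongrightarrow> F t (v t)"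
      by (rule continuous_on_tendsto_compose[OF cont[OF t]]) auto
  qed
qed

text \<open>Young's inequality with a free scale takes the place of Hoelder's: \<eta> makes one
  chosen term small when its integral is finite, and the other integral is then made small by other
  means. The two later smallness statements use this freedom in opposite directions.\<close>

lemma nn_integral_Young:
  fixes a b :: "'a \<Rightarrow> real"
  assumes [measurable]: "a \<in> borel_measurable M" "b \<in> borel_measurable M"
    and a: "\<And>x. 0 \<le> a x" and b: "\<And>x. 0 \<le> b x"
    and r: "r > 1" and q: "q = r / (r - 1)" and \<eta>: "\<eta> > 0"
  shows "(\<integral>\<^sup>+x. ennreal (a x * b x) \<partial>M) \<le>
    ennreal (\<eta> powr q) * (\<integral>\<^sup>+x. ennreal (a x powr q) \<partial>M) +
    ennreal (\<eta> powr - r) * (\<integral>\<^sup>+x. ennreal (b x powr r) \<partial>M)"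
proof -
  have q1: "q > 1" unfolding q using r by (simp add: field_simps)
  have qr: "1 / q + 1 / r = 1" unfolding q using r by (simp add: field_simps)
  have pw: "a x * b x \<le> \<eta> powr q * a x powr q + \<eta> powr - r * b x powr r" for x
  proof -
    have "a x * b x = (\<eta> * a x) * (b x / \<eta>)" using \<eta> by simp
    also have "\<dots> \<le> (\<eta> * a x) powr q / q + (b x / \<eta>) powr r / r"
      by (rule Youngs_inequality[OF q1 r qr]) (use a b \<eta> in auto)
    also have "\<dots> \<le> (\<eta> * a x) powr q + (b x / \<eta>) powr r"
      using q1 r by (intro add_mono) (simp_all add: divide_le_eq mult_le_cancel_left1)
    also have "\<dots> = \<eta> powr q * a x powr q + \<eta> powr - r * b x powr r"
      using \<eta> a[of x] b[of x] by (simp add: powr_mult powr_divide powr_minus divide_inverse mult.commute inverse_powr)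
    finally show ?thesis .
  qed
  have "(\<integral>\<^sup>+x. ennreal (a x * b x) \<partial>M) \<le>
      (\<integral>\<^sup>+x. ennreal (\<eta> powr q) * ennreal (a x powr q) + ennreal (\<eta> powr - r) * ennreal (b x powr r) \<partial>M)"
    by (intro nn_integral_mono) (simp add: pw ennreal_leI flip: ennreal_mult ennreal_plus)
  then show ?thesis
    by (simp add: nn_integral_add nn_integral_cmult)
qed

subsection \<open>The Riemann-Liouville kernel\<close>

text \<open>\<open>r\<close> is the integrability exponent of the Lipschitz weight. The bound
  \<open>1 / \<alpha> < r\<close> places the singularity of order \<open>\<alpha> - 1\<close> in the
  conjugate space L^q.\<close>

locale fractional_kernel =
  fixes \<alpha> T r :: real
  assumes \<alpha>: "0 < \<alpha>" "\<alpha> < 1" and T: "0 < T" and r: "1 / \<alpha> < r"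
begin

text \<open>The cut-off at zero turns integrals over \<open>{0..t}\<close> and \<open>{t..T}\<close>
  into convolutions over the whole line. The cut-off at \<open>T\<close> keeps the kernel in L^q of
  the line, and two points of \<open>{0..T}\<close> are never further apart.\<close>

definition kern :: "real \<Rightarrow> real" where
  "kern \<sigma> = (if 0 < \<sigma> \<and> \<sigma> \<le> T then \<sigma> powr (\<alpha> - 1) / Gamma \<alpha> else 0)"

definition q :: real where "q = r / (r - 1)"

lemma r_gt_1: "r > 1"
  using \<alpha> r by (smt (verit) less_divide_eq_1_pos)

lemma q_gt_1: "q > 1"
  using r_gt_1 by (simp add: q_def field_simps)

lemma kern_nonneg [simp]: "kern \<sigma> \<ge> 0"
  using Gamma_real_pos[of \<alpha>] \<alpha> by (simp add: kern_def)

lemma kern_borel [measurable]: "kern \<in> borel_measurable borel"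
  unfolding kern_def by measurable

text \<open>The q-th power of the L^q norm of the damped kernel: what is left of the kernel in
  exponentially weighted norms.\<close>

definition kq :: "real \<Rightarrow> ennreal" where
  "kq \<mu> = (\<integral>\<^sup>+\<sigma>. ennreal ((kern \<sigma> * exp (- \<mu> * \<sigma>)) powr q) \<partial>lebesgue)"

lemma kq_0_finite: "kq 0 < \<infinity>"
proof -
  \<comment> \<open>Integrability of the power at zero, \<open>(1 - \<alpha>) * q < 1\<close>, is a
    restatement of \<open>r > 1 / \<alpha>\<close>.\<close>
  have e: "(\<alpha> - 1) * q > -1"
  proof -
    have "(1 - \<alpha>) * r < r - 1" using r \<alpha> by (simp add: field_simps)
    then show ?thesis using r_gt_1 by (simp add: q_def field_simps)
  qed
  have "kq 0 \<le> (\<integral>\<^sup>+\<sigma>. ennreal (1 / Gamma \<alpha> powr q) * (ennreal (\<sigma> powr ((\<alpha> - 1) * q)) * indicator {0..T} \<sigma>) \<partial>lebesgue)"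
    unfolding kq_def
    using Gamma_real_pos[of \<alpha>] \<alpha>
    by (intro nn_integral_mono) (auto simp: kern_def powr_divide powr_powr divide_simps simp flip: ennreal_mult)
  also have "\<dots> = ennreal (1 / Gamma \<alpha> powr q) * (\<integral>\<^sup>+\<sigma>. (ennreal (\<sigma> powr ((\<alpha> - 1) * q)) * indicator {0..T} \<sigma>) \<partial>lborel)"
    by (simp add: nn_integral_cmult nn_integral_completion)
  also have "\<dots> = ennreal (1 / Gamma \<alpha> powr q) * ennreal (T powr ((\<alpha> - 1) * q + 1) / ((\<alpha> - 1) * q + 1))"
    using nn_integral_has_integral_lebesgue'[OF _ has_integral_powr_from_0[OF e, of T]] T by simp
  also have "\<dots> < \<infinity>" by (simp add: ennreal_mult_less_top)
  finally show ?thesis .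
qed

text \<open>The damping factor tends to zero wherever the kernel lives, and the undamped kernel is
  an integrable majorant.\<close>

lemma kq_tendsto_0: "(\<lambda>n. kq (real n)) \<longlonglongrightarrow> 0"
proof -
  have "(\<lambda>n. kq (real n)) \<longlonglongrightarrow> (\<integral>\<^sup>+\<sigma>. 0 \<partial>(lebesgue :: real measure))"
    unfolding kq_def
  proof (rule nn_integral_dominated_convergence[where w="\<lambda>\<sigma>. ennreal (kern \<sigma> powr q)"])
    show "(\<integral>\<^sup>+ x. ennreal (kern x powr q) \<partial>lebesgue) < \<infinity>" using kq_0_finite by (simp add: kq_def)
    show "AE x in lebesgue. ennreal ((kern x * exp (- real n * x)) powr q) \<le> ennreal (kern x powr q)" for n
    proof (intro AE_I2 ennreal_leI)
      fix x
      have "kern x * exp (- real n * x) \<le> kern x"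
      proof (cases "x > 0")
        case True
        then show ?thesis by (intro mult_right_le_one_le) auto
      qed (simp add: kern_def)
      then show "(kern x * exp (- real n * x)) powr q \<le> kern x powr q"
        using q_gt_1 by (intro powr_mono2) auto
    qed
    show "AE x in lebesgue. (\<lambda>n. ennreal ((kern x * exp (- real n * x)) powr q)) \<longlonglongrightarrow> 0"
    proof (rule AE_I2)
      fix x :: real
      show "(\<lambda>n. ennreal ((kern x * exp (- real n * x)) powr q)) \<longlonglongrightarrow> 0"
      proof (cases "x > 0")
        case True
        have "(\<lambda>n. (kern x * exp (- x) ^ n) powr q) \<longlonglongrightarrow> (kern x * 0) powr q"
          using True q_gt_1 by (intro tendsto_powr2 tendsto_intros LIMSEQ_power_zero) auto
        then have "(\<lambda>n. (kern x * exp (- real n * x)) powr q) \<longlonglongrightarrow> 0"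
          by (simp add: mult.commute flip: exp_of_nat_mult)
        then show ?thesis using tendsto_ennrealI by fastforce
      qed (simp add: kern_def)
    qed
  qed measurable
  then show ?thesis by simp
qed

text \<open>Translations and the reflection \<open>s \<mapsto> t - s\<close> preserve the norm of
  the damped kernel. The bound is thus uniform in the base point and serves forward and backward
  equations alike.\<close>

lemma kern_Young:
  fixes W :: "real \<Rightarrow> real" and \<mu> :: real
  assumes [measurable]: "W \<in> borel_measurable lebesgue" and W: "\<And>s. 0 \<le> W s" and \<eta>: "\<eta> > 0"
  defines "I \<equiv> ennreal (\<eta> powr q) * kq \<mu> +
    ennreal (\<eta> powr - r) * (\<integral>\<^sup>+s. ennreal (W s powr r) \<partial>lebesgue)"
  shows "(\<integral>\<^sup>+s. ennreal (kern (s - \<tau>) * exp (- \<mu> * (s - \<tau>)) * W s) \<partial>lebesgue) \<le> I"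
    and "(\<integral>\<^sup>+s. ennreal (kern (t - s) * exp (- \<mu> * (t - s)) * W s) \<partial>lebesgue) \<le> I"
proof -
  let ?k = "\<lambda>\<sigma>. kern \<sigma> * exp (- \<mu> * \<sigma>)"
  have m: "?k \<in> borel_measurable borel" by measurable
  have "(\<integral>\<^sup>+s. ennreal (?k (s - \<tau>) powr q) \<partial>lebesgue) = kq \<mu>"
    unfolding kq_def
    by (rule nn_integral_lebesgue_shift[where f="\<lambda>\<sigma>. ennreal (?k \<sigma> powr q)"]) measurable
  then show "(\<integral>\<^sup>+s. ennreal (kern (s - \<tau>) * exp (- \<mu> * (s - \<tau>)) * W s) \<partial>lebesgue) \<le> I"
    using nn_integral_Young[of "\<lambda>s. ?k (s - \<tau>)" lebesgue W r q \<eta>] W \<eta> r_gt_1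
    by (simp add: I_def q_def)
  have "(\<integral>\<^sup>+s. ennreal (?k (t - s) powr q) \<partial>lebesgue) = kq \<mu>"
    unfolding kq_def
    by (rule nn_integral_lebesgue_shift[where f="\<lambda>\<sigma>. ennreal (?k \<sigma> powr q)"]) measurable
  then show "(\<integral>\<^sup>+s. ennreal (kern (t - s) * exp (- \<mu> * (t - s)) * W s) \<partial>lebesgue) \<le> I"
    using nn_integral_Young[of "\<lambda>s. ?k (t - s)" lebesgue W r q \<eta>] W \<eta> r_gt_1
    by (simp add: I_def q_def)
qed

text \<open>The order of choices matters: \<eta> makes the contribution of \<open>W\<close> at most
  half of \<epsilon>, and only then is \<mu> chosen, with \<eta> fixed, from the decay of
  \<open>kq\<close>. \<open>W\<close> itself is not small here.\<close>

lemma kern_weight_small: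
  fixes W :: "real \<Rightarrow> real"
  assumes W: "W \<in> borel_measurable lebesgue" "\<And>s. 0 \<le> W s"
    and fin: "(\<integral>\<^sup>+s. ennreal (W s powr r) \<partial>lebesgue) < \<infinity>" and \<epsilon>: "\<epsilon> > 0"
  obtains \<mu> :: real where "\<mu> \<ge> 0"
    and "\<And>\<tau>. (\<integral>\<^sup>+s. ennreal (kern (s - \<tau>) * exp (- \<mu> * (s - \<tau>)) * W s) \<partial>lebesgue) \<le> ennreal \<epsilon>"
    and "\<And>t. (\<integral>\<^sup>+s. ennreal (kern (t - s) * exp (- \<mu> * (t - s)) * W s) \<partial>lebesgue) \<le> ennreal \<epsilon>"
proof -
  obtain w where w: "(\<integral>\<^sup>+s. ennreal (W s powr r) \<partial>lebesgue) = ennreal w" "w \<ge> 0"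
    using fin by (cases "\<integral>\<^sup>+s. ennreal (W s powr r) \<partial>lebesgue") auto
  \<comment> \<open>Solves \<open>\<eta> powr - r = \<epsilon> / (2 * (w + 1))\<close>; the added 1
    keeps \<eta> positive when \<open>w = 0\<close>.\<close>
  define \<eta> where "\<eta> = (2 * (w + 1) / \<epsilon>) powr (1 / r)"
  have \<eta>: "\<eta> > 0" using w \<epsilon> by (simp add: \<eta>_def)
  have "\<eta> powr - r = \<epsilon> / (2 * (w + 1))"
    using w \<epsilon> r_gt_1 by (simp add: \<eta>_def powr_powr powr_minus field_simps)
  moreover have "\<epsilon> / (2 * (w + 1)) * w \<le> \<epsilon> / 2"
    using w \<epsilon> by (simp add: divide_simps)
  ultimately have "\<eta> powr - r * w \<le> \<epsilon> / 2" by simp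
  then have 1: "ennreal (\<eta> powr - r) * ennreal w \<le> ennreal (\<epsilon> / 2)"
    using w by (simp add: ennreal_leI flip: ennreal_mult)
  have "(\<lambda>n. ennreal (\<eta> powr q) * kq (real n)) \<longlonglongrightarrow> ennreal (\<eta> powr q) * 0"
    by (intro ennreal_tendsto_cmult kq_tendsto_0) simp
  then have "\<forall>\<^sub>F n in sequentially. ennreal (\<eta> powr q) * kq (real n) < ennreal (\<epsilon> / 2)"
    using \<epsilon> by (intro order_tendstoD) auto
  then obtain n where n: "ennreal (\<eta> powr q) * kq (real n) < ennreal (\<epsilon> / 2)"
    by (auto simp: eventually_sequentially)
  have "ennreal (\<eta> powr q) * kq (real n) + ennreal (\<eta> powr - r) * ennreal w \<le> ennreal (\<epsilon> / 2) + ennreal (\<epsilon> / 2)"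
    using n 1 by (intro add_mono) auto
  also have "\<dots> = ennreal \<epsilon>" using \<epsilon> by (simp flip: ennreal_plus)
  finally have le: "ennreal (\<eta> powr q) * kq (real n) + ennreal (\<eta> powr - r) * (\<integral>\<^sup>+s. ennreal (W s powr r) \<partial>lebesgue) \<le> ennreal \<epsilon>"
    unfolding w .
  show thesis
    by (rule that[of "real n"]) (use kern_Young[OF W \<eta>, of _ "real n", THEN order_trans, OF le] in simp_all)
qed

text \<open>The roles are reversed: without damping, \<eta> tames the fixed kernel and the decay of
  the L^r norms of \<open>W n\<close> does the rest. This is how L^r convergence of the remainder
  quotients becomes a bound uniform in \<tau>.\<close>

lemma kern_uniformly_small:
  fixes W :: "nat \<Rightarrow> real \<Rightarrow> real"
  assumes W: "\<And>n. W n \<in> borel_measurable lebesgue" "\<And>n s. 0 \<le> W n s"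
    and lim: "(\<lambda>n. \<integral>\<^sup>+s. ennreal (W n s powr r) \<partial>lebesgue) \<longlonglongrightarrow> 0" and \<epsilon>: "\<epsilon> > 0"
  shows "\<forall>\<^sub>F n in sequentially. \<forall>\<tau>. (\<integral>\<^sup>+s. ennreal (kern (s - \<tau>) * W n s) \<partial>lebesgue) \<le> ennreal \<epsilon>"
proof -
  obtain k where k: "kq 0 = ennreal k" "k \<ge> 0"
    using kq_0_finite by (cases "kq 0") auto
  define \<eta> where "\<eta> = (\<epsilon> / (2 * (k + 1))) powr (1 / q)"
  have \<eta>: "\<eta> > 0" using k \<epsilon> by (simp add: \<eta>_def)
  have "\<eta> powr q = \<epsilon> / (2 * (k + 1))"
    using k \<epsilon> q_gt_1 by (simp add: \<eta>_def powr_powr)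
  moreover have "\<epsilon> / (2 * (k + 1)) * k \<le> \<epsilon> / 2"
    using k \<epsilon> by (simp add: divide_simps)
  ultimately have "\<eta> powr q * k \<le> \<epsilon> / 2" by simp
  then have 1: "ennreal (\<eta> powr q) * ennreal k \<le> ennreal (\<epsilon> / 2)"
    using k by (simp add: ennreal_leI flip: ennreal_mult)
  have "(\<lambda>n. ennreal (\<eta> powr - r) * (\<integral>\<^sup>+s. ennreal (W n s powr r) \<partial>lebesgue)) \<longlonglongrightarrow> ennreal (\<eta> powr - r) * 0"
    by (intro ennreal_tendsto_cmult lim) simp
  then have "\<forall>\<^sub>F n in sequentially. ennreal (\<eta> powr - r) * (\<integral>\<^sup>+s. ennreal (W n s powr r) \<partial>lebesgue) < ennreal (\<epsilon> / 2)"
    using \<epsilon> by (intro order_tendstoD) auto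
  then show ?thesis
  proof eventually_elim
    case (elim n)
    have "ennreal (\<eta> powr q) * kq 0 + ennreal (\<eta> powr - r) * (\<integral>\<^sup>+s. ennreal (W n s powr r) \<partial>lebesgue) \<le> ennreal (\<epsilon> / 2) + ennreal (\<epsilon> / 2)"
      using elim 1 k by (intro add_mono) auto
    also have "\<dots> = ennreal \<epsilon>" using \<epsilon> by (simp flip: ennreal_plus)
    finally show ?case
      using kern_Young(1)[of "W n" \<eta> _ 0, OF W(1) W(2) \<eta>, THEN order_trans] by simp
  qed
qed

end

subsection \<open>Volterra equations\<close>

text \<open>Here \<open>\<kappa>\<close> is the kernel seen from a fixed time \<open>t\<close>,
  \<open>c = w t\<close>, and \<open>e\<close> is the damping between \<open>t\<close> and
  \<open>s\<close>. As the shifted weight is not larger than the unshifted one, two copies of 1/4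
  give the contraction factor 1/2.\<close>

lemma weighted_contraction:
  fixes \<kappa> e l w :: "real \<Rightarrow> real"
  assumes [measurable]: "\<kappa> \<in> borel_measurable lebesgue" "e \<in> borel_measurable lebesgue" "l \<in> borel_measurable lebesgue"
    and \<kappa>: "\<And>s. 0 \<le> \<kappa> s" and l: "\<And>s. 0 \<le> l s" and c: "0 \<le> c"
    and w: "\<And>s. w s = c * e s" "\<And>s. w (s + \<sigma>) \<le> w s"
    and int: "(\<integral>\<^sup>+s. ennreal (\<kappa> s * e s * l s) \<partial>lebesgue) \<le> ennreal (1/4)"
  shows "(\<integral>\<^sup>+s. ennreal (\<kappa> s * (l s * (w s + w (s + \<sigma>)))) \<partial>lebesgue) \<le> ennreal (c / 2)"
proof -
  have "(\<integral>\<^sup>+s. ennreal (\<kappa> s * (l s * (w s + w (s + \<sigma>)))) \<partial>lebesgue) \<le>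
      (\<integral>\<^sup>+s. ennreal (2 * c) * ennreal (\<kappa> s * e s * l s) \<partial>lebesgue)"
  proof (intro nn_integral_mono)
    fix s
    have "\<kappa> s * (l s * (w s + w (s + \<sigma>))) \<le> \<kappa> s * (l s * (2 * w s))"
      using w(2)[of s] by (intro mult_left_mono \<kappa> l) simp
    also have "\<dots> = 2 * c * (\<kappa> s * e s * l s)" by (subst w(1)) simp
    finally show "ennreal (\<kappa> s * (l s * (w s + w (s + \<sigma>)))) \<le> ennreal (2 * c) * ennreal (\<kappa> s * e s * l s)"
      using c by (subst ennreal_mult'[symmetric]) (auto intro: ennreal_leI)
  qed
  also have "\<dots> = ennreal (2 * c) * (\<integral>\<^sup>+s. ennreal (\<kappa> s * e s * l s) \<partial>lebesgue)"
    by (rule nn_integral_cmult) measurable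
  also have "\<dots> \<le> ennreal (2 * c) * ennreal (1/4)" by (intro mult_left_mono int) simp
  also have "\<dots> = ennreal (c / 2)" using c by (subst ennreal_mult'[symmetric]) auto
  finally show ?thesis .
qed

text \<open>Picard iteration among measurable functions bounded by a multiple of \<open>w\<close>,
  with contraction factor 1/2. It works with functions and not with classes modulo null sets, so
  that the equation holds at every point of \<open>S\<close>, as the integral form of the Caputo
  equations demands. The number \<sigma> is the delay or advance with its sign.\<close>

lemma weighted_Volterra_solution:
  fixes \<kappa> :: "real \<Rightarrow> real \<Rightarrow> real" and w l m :: "real \<Rightarrow> real"
    and \<Phi> :: "real \<Rightarrow> 'a::euclidean_space \<Rightarrow> 'a \<Rightarrow> 'a"
  assumes \<kappa>0: "\<And>t s. 0 \<le> \<kappa> t s"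
    and \<kappa>m [measurable]: "(\<lambda>p. \<kappa> (fst p) (snd p)) \<in> borel_measurable (lebesgue \<Otimes>\<^sub>M lebesgue)"
    and S [measurable]: "S \<in> sets lebesgue"
    and w: "\<And>t. 0 < w t" "w \<in> borel_measurable lebesgue"
    and l: "\<And>s. 0 \<le> l s" "l \<in> borel_measurable lebesgue"
    and m: "\<And>s. 0 \<le> m s" "m \<in> borel_measurable lebesgue"
    and \<Phi>m: "\<And>x z. x \<in> borel_measurable lebesgue \<Longrightarrow> z \<in> borel_measurable lebesgue \<Longrightarrow>
      (\<lambda>s. \<Phi> s (x s) (z s)) \<in> borel_measurable lebesgue"
    and \<Phi>0: "\<And>s. norm (\<Phi> s 0 0) \<le> m s"
    and Lip: "\<And>s a b a' b'. norm (\<Phi> s a b - \<Phi> s a' b') \<le> l s * (norm (a - a') + norm (b - b'))"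
    and c: "0 \<le> c" "\<And>t. t \<in> S \<Longrightarrow> (\<integral>\<^sup>+s. ennreal (\<kappa> t s * m s) \<partial>lebesgue) \<le> ennreal (c * w t)"
    and contr: "\<And>t. t \<in> S \<Longrightarrow>
      (\<integral>\<^sup>+s. ennreal (\<kappa> t s * (l s * (w s + w (s + \<sigma>)))) \<partial>lebesgue) \<le> ennreal (w t / 2)"
  obtains x where "x \<in> borel_measurable lebesgue" "\<And>t. norm (x t) \<le> 2 * c * w t" "\<And>t. t \<notin> S \<Longrightarrow> x t = 0"
    "\<And>t. t \<in> S \<Longrightarrow> integrable lebesgue (\<lambda>s. \<kappa> t s *\<^sub>R \<Phi> s (x s) (x (s + \<sigma>)))"
    "\<And>t. t \<in> S \<Longrightarrow> x t = (\<integral>s. \<kappa> t s *\<^sub>R \<Phi> s (x s) (x (s + \<sigma>)) \<partial>lebesgue)"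
proof -
  note [measurable] = w(2) l(2) m(2) shift_measurable_lebesgue(1)[OF w(2), of \<sigma>]
  have \<kappa>t [measurable]: "\<kappa> t \<in> borel_measurable lebesgue" for t
    using measurable_compose[OF measurable_Pair1'[of t lebesgue lebesgue] \<kappa>m] by simp
  \<comment> \<open>\<open>X\<close> records measurability only; the weighted bounds are carried
    separately because their constants vary.\<close>
  define X where "X = {x :: real \<Rightarrow> 'a. x \<in> borel_measurable lebesgue}"
  define P where "P x t = indicator S t *\<^sub>R (\<integral>s. \<kappa> t s *\<^sub>R \<Phi> s (x s) (x (s + \<sigma>)) \<partial>lebesgue)" for x t
  have comp [measurable]: "(\<lambda>s. \<Phi> s (x s) (x (s + \<sigma>))) \<in> borel_measurable lebesgue" if "x \<in> X" for x
    using that by (intro \<Phi>m) (auto simp: X_def intro: shift_measurable_lebesgue)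
  have PX: "P x \<in> X" if "x \<in> X" for x
  proof -
    note [measurable] = comp[OF that]
    have "(\<lambda>t. \<integral>s. \<kappa> t s *\<^sub>R \<Phi> s (x s) (x (s + \<sigma>)) \<partial>lebesgue) \<in> borel_measurable lebesgue"
      by (rule lebesgue.borel_measurable_lebesgue_integral) (simp add: split_beta')
    then show ?thesis unfolding X_def P_def by simp
  qed
  have wint: "(\<integral>\<^sup>+s. ennreal (\<kappa> t s * (l s * (C * (w s + w (s + \<sigma>))))) \<partial>lebesgue) \<le> ennreal (C * w t / 2)"
    if "t \<in> S" "C \<ge> 0" for t C
  proof -
    have "(\<integral>\<^sup>+s. ennreal (\<kappa> t s * (l s * (C * (w s + w (s + \<sigma>))))) \<partial>lebesgue)
      = (\<integral>\<^sup>+s. ennreal C * ennreal (\<kappa> t s * (l s * (w s + w (s + \<sigma>)))) \<partial>lebesgue)"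
      using that \<kappa>0 l by (intro nn_integral_cong) (simp add: mult_ac flip: ennreal_mult')
    also have "\<dots> = ennreal C * (\<integral>\<^sup>+s. ennreal (\<kappa> t s * (l s * (w s + w (s + \<sigma>)))) \<partial>lebesgue)"
      by (rule nn_integral_cmult) measurable
    also have "\<dots> \<le> ennreal C * ennreal (w t / 2)"
      by (intro mult_left_mono contr that) simp
    also have "\<dots> = ennreal (C * w t / 2)" using that by (simp flip: ennreal_mult')
    finally show ?thesis .
  qed
  have bnd: "(\<integral>\<^sup>+s. ennreal (norm (\<kappa> t s *\<^sub>R \<Phi> s (x s) (x (s + \<sigma>)))) \<partial>lebesgue) \<le> ennreal ((c + C / 2) * w t)"
    if x: "x \<in> X" "\<And>t. norm (x t) \<le> C * w t" and t: "t \<in> S" and C: "C \<ge> 0" for x C t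
  proof -
    have "norm (\<Phi> s (x s) (x (s + \<sigma>))) \<le> m s + l s * (C * (w s + w (s + \<sigma>)))" for s
    proof -
      have "norm (\<Phi> s (x s) (x (s + \<sigma>))) \<le> norm (\<Phi> s 0 0) + norm (\<Phi> s (x s) (x (s + \<sigma>)) - \<Phi> s 0 0)"
        by norm
      also have "norm (\<Phi> s (x s) (x (s + \<sigma>)) - \<Phi> s 0 0) \<le> l s * (norm (x s) + norm (x (s + \<sigma>)))"
        using Lip[of s "x s" "x (s + \<sigma>)" 0 0] by simp
      also have "\<dots> \<le> l s * (C * (w s + w (s + \<sigma>)))"
        using x(2)[of s] x(2)[of "s + \<sigma>"] l by (intro mult_left_mono) (auto simp: algebra_simps)
      finally show ?thesis using \<Phi>0[of s] by linarith
    qed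
    then have "\<kappa> t s * norm (\<Phi> s (x s) (x (s + \<sigma>))) \<le> \<kappa> t s * m s + \<kappa> t s * (l s * (C * (w s + w (s + \<sigma>))))" for s
      using mult_left_mono[OF _ \<kappa>0] by (metis distrib_left)
    then have "(\<integral>\<^sup>+s. ennreal (norm (\<kappa> t s *\<^sub>R \<Phi> s (x s) (x (s + \<sigma>)))) \<partial>lebesgue)
      \<le> (\<integral>\<^sup>+s. ennreal (\<kappa> t s * m s) + ennreal (\<kappa> t s * (l s * (C * (w s + w (s + \<sigma>))))) \<partial>lebesgue)"
      using \<kappa>0 m l w(1)[THEN less_imp_le] C by (intro nn_integral_mono) (auto simp: ennreal_leI simp flip: ennreal_plus)
    also have "\<dots> = (\<integral>\<^sup>+s. ennreal (\<kappa> t s * m s) \<partial>lebesgue) + (\<integral>\<^sup>+s. ennreal (\<kappa> t s * (l s * (C * (w s + w (s + \<sigma>))))) \<partial>lebesgue)"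
      by (intro nn_integral_add) measurable
    also have "\<dots> \<le> ennreal (c * w t) + ennreal (C * w t / 2)"
      by (intro add_mono c wint t C)
    also have "\<dots> = ennreal ((c + C / 2) * w t)"
      using c(1) C w(1)[of t, THEN less_imp_le] by (subst ennreal_plus[symmetric]) (auto simp: algebra_simps)
    finally show ?thesis .
  qed
  have int: "integrable lebesgue (\<lambda>s. \<kappa> t s *\<^sub>R \<Phi> s (x s) (x (s + \<sigma>)))"
    if x: "x \<in> X" "\<And>t. norm (x t) \<le> C * w t" and t: "t \<in> S" and C: "C \<ge> 0" for x C t
    using comp[OF x(1)] le_less_trans[OF bnd[OF that]] by (intro integrableI_bounded) auto
  have Pb: "norm (P x t) \<le> (c + C / 2) * w t"
    if x: "x \<in> X" "\<And>t. norm (x t) \<le> C * w t" and C: "C \<ge> 0" for x C t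
  proof (cases "t \<in> S")
    case True
    have "ennreal (norm (P x t)) \<le> ennreal ((c + C / 2) * w t)"
      using integral_norm_bound_ennreal[OF int[OF x True C]] bnd[OF x True C] True
      by (simp add: P_def)
    then show ?thesis using c(1) C w(1)[of t, THEN less_imp_le] by simp
  qed (use c(1) C w(1)[of t, THEN less_imp_le] in \<open>simp add: P_def\<close>)
  have Pd: "norm (P x t - P x' t) \<le> C / 2 * w t"
    if x: "x \<in> X" "\<And>t. norm (x t) \<le> B * w t" and x': "x' \<in> X" "\<And>t. norm (x' t) \<le> B' * w t"
      and d: "\<And>t. norm (x t - x' t) \<le> C * w t" and C: "C \<ge> 0" and B: "B \<ge> 0" "B' \<ge> 0" for x x' B B' C t
  proof (cases "t \<in> S")
    case True
    have i: "integrable lebesgue (\<lambda>s. \<kappa> t s *\<^sub>R \<Phi> s (x s) (x (s + \<sigma>)) - \<kappa> t s *\<^sub>R \<Phi> s (x' s) (x' (s + \<sigma>)))"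
      by (intro Bochner_Integration.integrable_diff int[OF x True] int[OF x' True] B)
    have "ennreal (norm (P x t - P x' t)) \<le>
      (\<integral>\<^sup>+s. ennreal (norm (\<kappa> t s *\<^sub>R \<Phi> s (x s) (x (s + \<sigma>)) - \<kappa> t s *\<^sub>R \<Phi> s (x' s) (x' (s + \<sigma>)))) \<partial>lebesgue)"
      using integral_norm_bound_ennreal[OF i] True
      by (simp add: P_def Bochner_Integration.integral_diff[OF int[OF x True B(1)] int[OF x' True B(2)]])
    also have "\<dots> \<le> (\<integral>\<^sup>+s. ennreal (\<kappa> t s * (l s * (C * (w s + w (s + \<sigma>))))) \<partial>lebesgue)"
    proof (intro nn_integral_mono ennreal_leI)
      fix s
      have "norm (\<Phi> s (x s) (x (s + \<sigma>)) - \<Phi> s (x' s) (x' (s + \<sigma>))) \<le> l s * (C * (w s + w (s + \<sigma>)))"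
        using d[of s] d[of "s + \<sigma>"] l(1)[of s]
        by (intro order_trans[OF Lip] mult_left_mono) (auto simp: algebra_simps)
      then show "norm (\<kappa> t s *\<^sub>R \<Phi> s (x s) (x (s + \<sigma>)) - \<kappa> t s *\<^sub>R \<Phi> s (x' s) (x' (s + \<sigma>))) \<le> \<kappa> t s * (l s * (C * (w s + w (s + \<sigma>))))"
        using \<kappa>0[of t s] by (simp add: mult_left_mono flip: scaleR_diff_right)
    qed
    also have "\<dots> \<le> ennreal (C / 2 * w t)" using wint[OF True C] by simp
    finally show ?thesis using C w(1)[of t, THEN less_imp_le] by simp
  qed (use C w(1)[of t, THEN less_imp_le] in \<open>simp add: P_def\<close>)
  define xk where "xk k = (P ^^ k) (\<lambda>_. 0)" for k
  have xS: "xk (Suc k) = P (xk k)" for k by (simp add: xk_def)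
  have xX: "xk k \<in> X" for k
    by (induction k) (simp_all add: xS PX, simp add: xk_def X_def)
  \<comment> \<open>\<open>2 * c\<close> is the fixed point of \<open>C \<mapsto> c + C / 2\<close>,
    the effect of one iteration on the bound.\<close>
  have xb: "norm (xk k t) \<le> 2 * c * w t" for k t
  proof (induction k arbitrary: t)
    case 0
    then show ?case using c(1) w(1)[of t, THEN less_imp_le] by (simp add: xk_def)
  next
    case (Suc k)
    have "norm (P (xk k) t) \<le> (c + 2 * c / 2) * w t"
      by (rule Pb[OF xX]) (use Suc c in auto)
    then show ?case by (simp add: xS)
  qed
  \<comment> \<open>Both iterates arise by applying \<open>P\<close> exactly \<open>k\<close> times,
    to \<open>xk i\<close> and to zero; hence a geometric rate uniform in \<open>i\<close>.\<close>
  have xd: "norm (xk (k + i) t - xk k t) \<le> (2 * c / 2 ^ k) * w t" for i k t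
  proof (induction k arbitrary: t)
    case 0
    then show ?case using xb[of i t] by (simp add: xk_def)
  next
    case (Suc k)
    have "norm (P (xk (k + i)) t - P (xk k) t) \<le> (2 * c / 2 ^ k) / 2 * w t"
      by (rule Pd[OF xX xb xX xb]) (use Suc c in auto)
    then show ?case by (simp add: xS)
  qed
  have zero: "(\<lambda>k. (2 * c / 2 ^ k) * w t) \<longlonglongrightarrow> 0" for t
  proof -
    have "(\<lambda>k. (2 * c * w t) * (1 / 2) ^ k) \<longlonglongrightarrow> (2 * c * w t) * 0"
      by (intro tendsto_intros LIMSEQ_power_zero) simp
    then show ?thesis by (simp add: power_one_over field_simps)
  qed
  have "Cauchy (\<lambda>k. xk k t)" for t
  proof (rule metric_CauchyI)
    fix e :: real assume "e > 0"
    then have "e / 2 > 0" by simp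
    from order_tendstoD(2)[OF zero this, of t] obtain k where k: "(2 * c / 2 ^ k) * w t < e / 2"
      by (auto simp: eventually_sequentially)
    show "\<exists>M. \<forall>m\<ge>M. \<forall>n\<ge>M. dist (xk m t) (xk n t) < e"
    proof (intro exI allI impI)
      fix m n assume "m \<ge> k" "n \<ge> k"
      then have "norm (xk m t - xk k t) < e / 2" "norm (xk n t - xk k t) < e / 2"
        using xd[of k "m - k" t] xd[of k "n - k" t] k by auto
      then show "dist (xk m t) (xk n t) < e" by (simp add: dist_norm) norm
    qed
  qed
  then have "\<exists>L. (\<lambda>k. xk k t) \<longlonglongrightarrow> L" for t
    using Cauchy_convergent convergent_def by blast
  then obtain x where lim: "(\<lambda>k. xk k t) \<longlonglongrightarrow> x t" for t by metis
  have x: "x \<in> X"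
    unfolding X_def mem_Collect_eq
    by (rule borel_measurable_LIMSEQ_metric[of xk]) (use xX lim in \<open>auto simp: X_def\<close>)
  have xbd: "norm (x t) \<le> 2 * c * w t" for t
    by (rule Lim_norm_ubound[OF _ lim]) (use xb in auto)
  have xkd: "norm (x t - xk k t) \<le> (2 * c / 2 ^ k) * w t" for k t
  proof (rule Lim_norm_ubound)
    show "(\<lambda>i. xk (i + k) t - xk k t) \<longlonglongrightarrow> x t - xk k t"
      by (intro tendsto_intros LIMSEQ_ignore_initial_segment[OF lim])
    show "\<forall>\<^sub>F i in sequentially. norm (xk (i + k) t - xk k t) \<le> (2 * c / 2 ^ k) * w t"
      using xd[of k _ t] by (intro always_eventually allI) (simp only: add.commute[of _ k])
  qed simp
  have fix_x: "P x t = x t" for t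
  proof -
    have "(\<lambda>k. P (xk k) t) \<longlonglongrightarrow> P x t"
    proof (rule LIM_zero_cancel, rule Lim_null_comparison)
      show "\<forall>\<^sub>F k in sequentially. norm (P (xk k) t - P x t) \<le> (2 * c / 2 ^ k) * w t / 2"
      proof (intro always_eventually allI)
        fix k
        have "norm (P x t - P (xk k) t) \<le> (2 * c / 2 ^ k) / 2 * w t"
          by (rule Pd[OF x xbd xX xb xkd]) (use c in auto)
        then show "norm (P (xk k) t - P x t) \<le> (2 * c / 2 ^ k) * w t / 2"
          by (simp add: norm_minus_commute)
      qed
      show "(\<lambda>k. (2 * c / 2 ^ k) * w t / 2) \<longlonglongrightarrow> 0"
        using tendsto_divide_zero[OF zero] .
    qed
    moreover have "(\<lambda>k. P (xk k) t) \<longlonglongrightarrow> x t"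
      using LIMSEQ_Suc[OF lim] by (simp add: xS)
    ultimately show ?thesis by (rule LIMSEQ_unique)
  qed
  show thesis
  proof (rule that[of x])
    show "x \<in> borel_measurable lebesgue" using x by (simp add: X_def)
    show "norm (x t) \<le> 2 * c * w t" for t by (rule xbd)
    show "x t = 0" if "t \<notin> S" for t using fix_x[of t] that by (simp add: P_def)
    show "integrable lebesgue (\<lambda>s. \<kappa> t s *\<^sub>R \<Phi> s (x s) (x (s + \<sigma>)))" if "t \<in> S" for t
      by (rule int[OF x xbd that]) (use c in simp)
    show "x t = (\<integral>s. \<kappa> t s *\<^sub>R \<Phi> s (x s) (x (s + \<sigma>)) \<partial>lebesgue)" if "t \<in> S" for t
      using fix_x[of t] that by (simp add: P_def)
  qed
qed

section \<open>Convolution estimates, stability in L1 and fractional integration by parts\<close>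

context fractional_kernel
begin

lemma kern_Tonelli:
  fixes W D :: "real \<Rightarrow> ennreal"
  assumes [measurable]: "W \<in> borel_measurable lebesgue" "D \<in> borel_measurable lebesgue"
  shows "(\<integral>\<^sup>+s. W s * (\<integral>\<^sup>+\<tau>. ennreal (kern (s - a - \<tau>)) * D \<tau> \<partial>lebesgue) \<partial>lebesgue) =
    (\<integral>\<^sup>+\<tau>. D \<tau> * (\<integral>\<^sup>+s. ennreal (kern (s - (\<tau> + a))) * W s \<partial>lebesgue) \<partial>lebesgue)"
proof -
  have "(\<integral>\<^sup>+s. W s * (\<integral>\<^sup>+\<tau>. ennreal (kern (s - a - \<tau>)) * D \<tau> \<partial>lebesgue) \<partial>lebesgue) =
      (\<integral>\<^sup>+s. \<integral>\<^sup>+\<tau>. W s * (ennreal (kern (s - a - \<tau>)) * D \<tau>) \<partial>lebesgue \<partial>lebesgue)"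
    by (intro nn_integral_cong nn_integral_cmult[symmetric]) measurable
  also have "\<dots> = (\<integral>\<^sup>+\<tau>. \<integral>\<^sup>+s. W s * (ennreal (kern (s - a - \<tau>)) * D \<tau>) \<partial>lebesgue \<partial>lebesgue)"
    by (rule lebesgue_pair.Fubini'[symmetric]) measurable
  also have "\<dots> = (\<integral>\<^sup>+\<tau>. \<integral>\<^sup>+s. D \<tau> * (ennreal (kern (s - (\<tau> + a))) * W s) \<partial>lebesgue \<partial>lebesgue)"
    by (intro nn_integral_cong) (simp add: mult_ac algebra_simps)
  also have "\<dots> = (\<integral>\<^sup>+\<tau>. D \<tau> * (\<integral>\<^sup>+s. ennreal (kern (s - (\<tau> + a))) * W s \<partial>lebesgue) \<partial>lebesgue)"
    by (intro nn_integral_cong nn_integral_cmult) measurable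
  finally show ?thesis .
qed

text \<open>Tonelli moves the kernel from the increment \<open>d\<close> onto the weight
  \<open>W\<close>, where bounds uniform in the base point are available. A delay \<open>a\<close>
  of \<open>d\<close> merely moves that base point.\<close>

lemma kern_convolution_le:
  fixes W D d :: "real \<Rightarrow> ennreal"
  assumes [measurable]: "W \<in> borel_measurable lebesgue" "D \<in> borel_measurable lebesgue"
    and d: "\<And>s. d s \<le> (\<integral>\<^sup>+\<tau>. ennreal (kern (s - \<tau>)) * D \<tau> \<partial>lebesgue)"
  shows "(\<integral>\<^sup>+s. W s * d (s - a) \<partial>lebesgue) \<le>
    (\<integral>\<^sup>+\<tau>. D \<tau> * (\<integral>\<^sup>+s. ennreal (kern (s - (\<tau> + a))) * W s \<partial>lebesgue) \<partial>lebesgue)"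
  unfolding kern_Tonelli[OF assms(1,2), symmetric]
  by (intro nn_integral_mono mult_left_mono d) simp

lemma kern_delayed_convolution_le:
  fixes W D d :: "real \<Rightarrow> ennreal"
  assumes m [measurable]: "W \<in> borel_measurable lebesgue" "D \<in> borel_measurable lebesgue"
    "d \<in> borel_measurable lebesgue"
    and d: "\<And>s. d s \<le> (\<integral>\<^sup>+\<tau>. ennreal (kern (s - \<tau>)) * D \<tau> \<partial>lebesgue)"
    and W: "\<And>\<tau>. (\<integral>\<^sup>+s. ennreal (kern (s - \<tau>)) * W s \<partial>lebesgue) \<le> \<epsilon>"
  shows "(\<integral>\<^sup>+s. W s * (d s + d (s - h)) \<partial>lebesgue) \<le> 2 * \<epsilon> * (\<integral>\<^sup>+\<tau>. D \<tau> \<partial>lebesgue)"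
proof -
  note [measurable] = shift_measurable_lebesgue(2)[OF m(3), of h]
  have a: "(\<integral>\<^sup>+s. W s * d (s - a) \<partial>lebesgue) \<le> \<epsilon> * (\<integral>\<^sup>+\<tau>. D \<tau> \<partial>lebesgue)" for a
  proof -
    have "(\<integral>\<^sup>+s. W s * d (s - a) \<partial>lebesgue) \<le> (\<integral>\<^sup>+\<tau>. D \<tau> * \<epsilon> \<partial>lebesgue)"
      by (intro order_trans[OF kern_convolution_le[OF m(1,2) d]] nn_integral_mono mult_left_mono W) simp
    also have "\<dots> = (\<integral>\<^sup>+\<tau>. D \<tau> \<partial>lebesgue) * \<epsilon>" by (rule nn_integral_multc) measurable
    finally show ?thesis by (simp add: mult.commute)
  qed
  have "(\<integral>\<^sup>+s. W s * (d s + d (s - h)) \<partial>lebesgue) =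
      (\<integral>\<^sup>+s. W s * d (s - 0) \<partial>lebesgue) + (\<integral>\<^sup>+s. W s * d (s - h) \<partial>lebesgue)"
    by (simp add: distrib_left nn_integral_add)
  also have "\<dots> \<le> \<epsilon> * (\<integral>\<^sup>+\<tau>. D \<tau> \<partial>lebesgue) + \<epsilon> * (\<integral>\<^sup>+\<tau>. D \<tau> \<partial>lebesgue)"
    by (intro add_mono a)
  finally show ?thesis by (simp add: mult_2 distrib_right)
qed

text \<open>Testing the inequality for \<open>D\<close> against \<open>exp (- \<mu> * s)\<close> and
  moving the kernel onto \<open>l\<close> gives \<open>N \<le> N / 4 + N / 4 + \<integral> b\<close>
  for the weighted L1 norm \<open>N\<close> of \<open>D\<close>. Absorption requires
  \<open>N\<close> finite, hence the assumption on \<open>D\<close>; the return to the unweighted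
  norm costs \<open>exp (\<mu> * T)\<close>. The constant is fixed before \<open>D\<close>,
  \<open>d\<close> and \<open>b\<close>, as a comparison along shrinking sets requires.\<close>

lemma kern_L1_stability:
  fixes l :: "real \<Rightarrow> real"
  assumes l: "l \<in> borel_measurable lebesgue" "\<And>s. 0 \<le> l s"
    and fin: "(\<integral>\<^sup>+s. ennreal (l s powr r) \<partial>lebesgue) < \<infinity>" and h: "h \<ge> 0"
  obtains C :: real where "C \<ge> 0"
    and "\<And>D d b :: real \<Rightarrow> ennreal. \<lbrakk>D \<in> borel_measurable lebesgue; d \<in> borel_measurable lebesgue;
      b \<in> borel_measurable lebesgue; \<And>s. s \<notin> {0..T} \<Longrightarrow> D s = 0;
      (\<integral>\<^sup>+s. D s \<partial>lebesgue) < \<infinity>;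
      \<And>s. d s \<le> (\<integral>\<^sup>+\<tau>. ennreal (kern (s - \<tau>)) * D \<tau> \<partial>lebesgue);
      \<And>s. D s \<le> ennreal (l s) * (d s + d (s - h)) + b s\<rbrakk> \<Longrightarrow>
      (\<integral>\<^sup>+s. D s \<partial>lebesgue) \<le> ennreal C * (\<integral>\<^sup>+s. b s \<partial>lebesgue)"
proof -
  obtain \<mu> where \<mu>: "\<mu> \<ge> 0"
    "\<And>\<tau>. (\<integral>\<^sup>+s. ennreal (kern (s - \<tau>) * exp (- \<mu> * (s - \<tau>)) * l s) \<partial>lebesgue) \<le> ennreal (1/4)"
    "\<And>t. (\<integral>\<^sup>+s. ennreal (kern (t - s) * exp (- \<mu> * (t - s)) * l s) \<partial>lebesgue) \<le> ennreal (1/4)"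
    by (rule kern_weight_small[OF l fin, of "1/4"], simp, blast)
  define e where "e s = exp (- \<mu> * s)" for s
  have e0: "e s > 0" for s by (simp add: e_def)
  have eb [measurable]: "e \<in> borel_measurable borel" unfolding e_def by measurable
  note [measurable] = l(1) borel_measurable_lebesgue[OF eb]
  show thesis
  proof (rule that[of "2 * exp (\<mu> * T)"])
    fix D d b :: "real \<Rightarrow> ennreal"
    assume [measurable]: "D \<in> borel_measurable lebesgue" and d [measurable]: "d \<in> borel_measurable lebesgue"
      and [measurable]: "b \<in> borel_measurable lebesgue" and D0: "\<And>s. s \<notin> {0..T} \<Longrightarrow> D s = 0"
      and Dfin: "(\<integral>\<^sup>+s. D s \<partial>lebesgue) < \<infinity>"
      and dD: "\<And>s. d s \<le> (\<integral>\<^sup>+\<tau>. ennreal (kern (s - \<tau>)) * D \<tau> \<partial>lebesgue)"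
      and Dd: "\<And>s. D s \<le> ennreal (l s) * (d s + d (s - h)) + b s"
    note [measurable] = shift_measurable_lebesgue(2)[OF d, of h]
    define N where "N = (\<integral>\<^sup>+s. D s * ennreal (e s) \<partial>lebesgue)"
    have "N \<le> (\<integral>\<^sup>+s. D s \<partial>lebesgue)"
      unfolding N_def
    proof (intro nn_integral_mono)
      fix s
      have "e s \<le> 1" if "s \<in> {0..T}" using that \<mu>(1) by (simp add: e_def)
      then show "D s * ennreal (e s) \<le> D s"
        using D0[of s] mult_left_mono[of "ennreal (e s)" 1 "D s"] by (cases "s \<in> {0..T}") auto
    qed
    with Dfin have "N < \<infinity>" by simp
    then obtain n where n: "N = ennreal n" "n \<ge> 0" by (cases N) auto
    let ?W = "\<lambda>s. ennreal (e s * l s)"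
    have q: "(\<integral>\<^sup>+s. ?W s * d (s - a) \<partial>lebesgue) \<le> N * ennreal (1/4)" if a: "a \<ge> 0" for a
    proof -
      have "(\<integral>\<^sup>+s. ?W s * d (s - a) \<partial>lebesgue) \<le>
          (\<integral>\<^sup>+\<tau>. D \<tau> * (\<integral>\<^sup>+s. ennreal (kern (s - (\<tau> + a))) * ?W s \<partial>lebesgue) \<partial>lebesgue)"
        by (rule kern_convolution_le[OF _ _ dD]) measurable
      also have "\<dots> \<le> (\<integral>\<^sup>+\<tau>. D \<tau> * (ennreal (e \<tau>) * ennreal (1/4)) \<partial>lebesgue)"
      proof (intro nn_integral_mono mult_left_mono)
        fix \<tau>
        have "(\<integral>\<^sup>+s. ennreal (kern (s - (\<tau> + a))) * ?W s \<partial>lebesgue) =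
           (\<integral>\<^sup>+s. ennreal (e (\<tau> + a)) * ennreal (kern (s - (\<tau> + a)) * exp (- \<mu> * (s - (\<tau> + a))) * l s) \<partial>lebesgue)"
        proof (intro nn_integral_cong)
          fix s
          \<comment> \<open>The weight splits into its value at the base point and the damping over
            the remaining distance.\<close>
          have "e s = e (\<tau> + a) * exp (- \<mu> * (s - (\<tau> + a)))"
            unfolding e_def mult_exp_exp by (simp add: algebra_simps)
          then have "kern (s - (\<tau> + a)) * (e s * l s) =
              e (\<tau> + a) * (kern (s - (\<tau> + a)) * exp (- \<mu> * (s - (\<tau> + a))) * l s)"
            by simp
          then show "ennreal (kern (s - (\<tau> + a))) * ?W s =
              ennreal (e (\<tau> + a)) * ennreal (kern (s - (\<tau> + a)) * exp (- \<mu> * (s - (\<tau> + a))) * l s)"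
            using e0[of "\<tau> + a", THEN less_imp_le] by (subst (1 2) ennreal_mult'[symmetric]) (simp_all only: kern_nonneg)
        qed
        also have "\<dots> = ennreal (e (\<tau> + a)) * (\<integral>\<^sup>+s. ennreal (kern (s - (\<tau> + a)) * exp (- \<mu> * (s - (\<tau> + a))) * l s) \<partial>lebesgue)"
          by (rule nn_integral_cmult) measurable
        also have "\<dots> \<le> ennreal (e \<tau>) * ennreal (1/4)"
        proof (intro mult_mono \<mu>(2) ennreal_leI)
          \<comment> \<open>The weight decreases, so the delayed term costs no more than the
            undelayed one.\<close>
          show "e (\<tau> + a) \<le> e \<tau>" using a \<mu>(1) by (simp add: e_def mult_left_mono)
        qed simp_all
        finally show "(\<integral>\<^sup>+s. ennreal (kern (s - (\<tau> + a))) * ?W s \<partial>lebesgue) \<le> ennreal (e \<tau>) * ennreal (1/4)" .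
      qed simp
      also have "\<dots> = N * ennreal (1/4)"
        unfolding N_def mult.assoc[symmetric] by (rule nn_integral_multc) measurable
      finally show ?thesis .
    qed
    have "N \<le> (\<integral>\<^sup>+s. ?W s * d (s - 0) + ?W s * d (s - h) + b s \<partial>lebesgue)"
      unfolding N_def
    proof (intro nn_integral_mono)
      fix s
      show "D s * ennreal (e s) \<le> ?W s * d (s - 0) + ?W s * d (s - h) + b s"
      proof (cases "s \<in> {0..T}")
        case True
        then have "e s \<le> 1" using \<mu>(1) by (simp add: e_def)
        have "D s * ennreal (e s) \<le> (ennreal (l s) * (d s + d (s - h)) + b s) * ennreal (e s)"
          by (intro mult_right_mono Dd) simp
        also have "\<dots> = ?W s * d (s - 0) + ?W s * d (s - h) + b s * ennreal (e s)"
          using ennreal_mult[OF e0[of s, THEN less_imp_le] l(2)[of s]]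
          by (simp add: distrib_left distrib_right mult_ac)
        also have "b s * ennreal (e s) \<le> b s"
          using mult_left_mono[of "ennreal (e s)" 1 "b s"] \<open>e s \<le> 1\<close> by simp
        finally show ?thesis by (simp add: add_left_mono)
      qed (simp add: D0)
    qed
    also have "\<dots> = (\<integral>\<^sup>+s. ?W s * d (s - 0) \<partial>lebesgue) + (\<integral>\<^sup>+s. ?W s * d (s - h) \<partial>lebesgue) + (\<integral>\<^sup>+s. b s \<partial>lebesgue)"
      by (simp add: nn_integral_add)
    also have "\<dots> \<le> N * ennreal (1/4) + N * ennreal (1/4) + (\<integral>\<^sup>+s. b s \<partial>lebesgue)"
      using q[of 0] q[of h] h by (intro add_mono) auto
    finally have "N \<le> N * ennreal (1/4) + N * ennreal (1/4) + (\<integral>\<^sup>+s. b s \<partial>lebesgue)" .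
    moreover have "N * ennreal (1/4) = ennreal (n / 4)"
      unfolding n(1) using ennreal_mult[OF n(2), of "1/4"] by simp
    then have "N * ennreal (1/4) + N * ennreal (1/4) = ennreal (n / 2)"
      using n(2) ennreal_plus[of "n / 4" "n / 4"] by simp
    ultimately have le: "N \<le> ennreal (n / 2) + (\<integral>\<^sup>+s. b s \<partial>lebesgue)" by simp
    \<comment> \<open>Nothing is to be shown if \<open>\<integral> b\<close> is infinite; otherwise
      half of the finite number \<open>n\<close> is absorbed.\<close>
    have N2: "N \<le> 2 * (\<integral>\<^sup>+s. b s \<partial>lebesgue)"
    proof (cases "\<integral>\<^sup>+s. b s \<partial>lebesgue")
      case (real B)
      with le n have "ennreal n \<le> ennreal (n / 2 + B)" by (simp add: ennreal_plus)
      with real n have "n \<le> n / 2 + B" by (subst (asm) ennreal_le_iff) auto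
      then have "ennreal n \<le> ennreal (2 * B)" by (intro ennreal_leI) simp
      then show ?thesis using real n ennreal_mult[of 2 B] by simp
    qed (simp add: ennreal_mult_top)
    have "(\<integral>\<^sup>+s. D s \<partial>lebesgue) \<le> (\<integral>\<^sup>+s. ennreal (exp (\<mu> * T)) * (D s * ennreal (e s)) \<partial>lebesgue)"
    proof (intro nn_integral_mono)
      fix s
      show "D s \<le> ennreal (exp (\<mu> * T)) * (D s * ennreal (e s))"
      proof (cases "s \<in> {0..T}")
        case True
        then have "1 \<le> exp (\<mu> * T) * e s"
          using \<mu>(1) by (simp add: e_def mult_exp_exp mult_left_mono)
        then have "1 \<le> ennreal (exp (\<mu> * T)) * ennreal (e s)"
          by (subst ennreal_mult'[symmetric]) (simp_all add: ennreal_1[symmetric] ennreal_leI del: ennreal_1)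
        then have "D s * 1 \<le> D s * (ennreal (exp (\<mu> * T)) * ennreal (e s))"
          by (rule mult_left_mono) simp
        then show ?thesis by (simp add: mult_ac)
      qed (simp add: D0)
    qed
    also have "\<dots> = ennreal (exp (\<mu> * T)) * N"
      unfolding N_def by (rule nn_integral_cmult) measurable
    also have "\<dots> \<le> ennreal (exp (\<mu> * T)) * (2 * (\<integral>\<^sup>+s. b s \<partial>lebesgue))"
      by (intro mult_left_mono N2) simp
    also have "\<dots> = ennreal (2 * exp (\<mu> * T)) * (\<integral>\<^sup>+s. b s \<partial>lebesgue)"
      using ennreal_mult'[of 2 "exp (\<mu> * T)"] by (simp add: mult_ac)
    finally show "(\<integral>\<^sup>+s. D s \<partial>lebesgue) \<le> ennreal (2 * exp (\<mu> * T)) * (\<integral>\<^sup>+s. b s \<partial>lebesgue)" .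
  qed simp
qed

text \<open>Fractional integration by parts. Joint absolute integrability comes from the bound
  \<open>C\<close>, uniform in \<tau>, together with integrability of \<open>D\<close>. The inner
  integral is assumed to exist only where \<open>G\<close> does not vanish, because the increment is
  represented by it only on \<open>{0..T}\<close>.\<close>

lemma kern_duality:
  fixes G D :: "real \<Rightarrow> 'a::euclidean_space"
  assumes G [measurable]: "G \<in> borel_measurable lebesgue" and D: "integrable lebesgue D"
    and C: "\<And>\<tau>. (\<integral>\<^sup>+s. ennreal (kern (s - \<tau>) * norm (G s)) \<partial>lebesgue) \<le> ennreal C"
    and int: "\<And>s. G s \<noteq> 0 \<Longrightarrow> integrable lebesgue (\<lambda>\<tau>. kern (s - \<tau>) *\<^sub>R D \<tau>)"
  shows "(\<integral>s. G s \<bullet> (\<integral>\<tau>. kern (s - \<tau>) *\<^sub>R D \<tau> \<partial>lebesgue) \<partial>lebesgue) =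
    (\<integral>\<tau>. (\<integral>s. kern (s - \<tau>) *\<^sub>R G s \<partial>lebesgue) \<bullet> D \<tau> \<partial>lebesgue)"
proof -
  note [measurable] = borel_measurable_integrable[OF D]
  have [measurable]: "(\<lambda>(s, \<tau>). kern (s - \<tau>) * (G s \<bullet> D \<tau>)) \<in> borel_measurable (lebesgue \<Otimes>\<^sub>M lebesgue)"
    by measurable
  have "(\<integral>\<^sup>+p. ennreal (norm (case p of (s, \<tau>) \<Rightarrow> kern (s - \<tau>) * (G s \<bullet> D \<tau>))) \<partial>(lebesgue \<Otimes>\<^sub>M lebesgue)) =
      (\<integral>\<^sup>+\<tau>. \<integral>\<^sup>+s. ennreal (norm (kern (s - \<tau>) * (G s \<bullet> D \<tau>))) \<partial>lebesgue \<partial>lebesgue)"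
    by (subst lebesgue_pair.nn_integral_snd[symmetric]) auto
  also have "\<dots> \<le> (\<integral>\<^sup>+\<tau>. \<integral>\<^sup>+s. ennreal (kern (s - \<tau>) * norm (G s)) * ennreal (norm (D \<tau>)) \<partial>lebesgue \<partial>lebesgue)"
    by (intro nn_integral_mono)
      (auto simp: abs_mult mult.assoc Cauchy_Schwarz_ineq2 intro!: ennreal_leI mult_left_mono simp flip: ennreal_mult')
  also have "\<dots> = (\<integral>\<^sup>+\<tau>. (\<integral>\<^sup>+s. ennreal (kern (s - \<tau>) * norm (G s)) \<partial>lebesgue) * ennreal (norm (D \<tau>)) \<partial>lebesgue)"
    by (intro nn_integral_cong nn_integral_multc) measurable
  also have "\<dots> \<le> (\<integral>\<^sup>+\<tau>. ennreal C * ennreal (norm (D \<tau>)) \<partial>lebesgue)"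
    by (intro nn_integral_mono mult_right_mono C) simp
  also have "\<dots> = ennreal C * (\<integral>\<^sup>+\<tau>. ennreal (norm (D \<tau>)) \<partial>lebesgue)"
    by (rule nn_integral_cmult) measurable
  also have "\<dots> < \<infinity>"
    using D by (simp add: integrable_iff_bounded ennreal_mult_less_top)
  finally have i: "integrable (lebesgue \<Otimes>\<^sub>M lebesgue) (\<lambda>(s, \<tau>). kern (s - \<tau>) * (G s \<bullet> D \<tau>))"
    by (intro integrableI_bounded) auto
  have iG: "integrable lebesgue (\<lambda>s. kern (s - \<tau>) *\<^sub>R G s)" for \<tau>
    using le_less_trans[OF C[of \<tau>]] by (intro integrableI_bounded) auto
  have "(\<integral>s. G s \<bullet> (\<integral>\<tau>. kern (s - \<tau>) *\<^sub>R D \<tau> \<partial>lebesgue) \<partial>lebesgue) =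
      (\<integral>s. \<integral>\<tau>. kern (s - \<tau>) * (G s \<bullet> D \<tau>) \<partial>lebesgue \<partial>lebesgue)"
    by (intro Bochner_Integration.integral_cong refl)
      (subst integral_inner_right[symmetric], auto simp: int)
  also have "\<dots> = (\<integral>\<tau>. \<integral>s. kern (s - \<tau>) * (G s \<bullet> D \<tau>) \<partial>lebesgue \<partial>lebesgue)"
    by (rule lebesgue_pair.Fubini_integral[OF i, symmetric])
  also have "\<dots> = (\<integral>\<tau>. (\<integral>s. kern (s - \<tau>) *\<^sub>R G s \<partial>lebesgue) \<bullet> D \<tau> \<partial>lebesgue)"
    by (intro Bochner_Integration.integral_cong refl)
      (subst integral_inner_left[symmetric], auto simp: iG)
  finally show ?thesis .
qed

section \<open>Nonnegative weights in L^r of the line\<close>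

definition r_integrable :: "(real \<Rightarrow> real) \<Rightarrow> bool" where
  "r_integrable W \<longleftrightarrow> W \<in> borel_measurable lebesgue \<and> (\<forall>s. 0 \<le> W s) \<and>
     (\<integral>\<^sup>+s. ennreal (W s powr r) \<partial>lebesgue) < \<infinity>"

lemma r_integrable_measurable: "r_integrable W \<Longrightarrow> W \<in> borel_measurable lebesgue"
  and r_integrable_nonneg: "r_integrable W \<Longrightarrow> 0 \<le> W s"
  and r_integrable_finite: "r_integrable W \<Longrightarrow> (\<integral>\<^sup>+s. ennreal (W s powr r) \<partial>lebesgue) < \<infinity>"
  by (auto simp: r_integrable_def)

lemma r_integrable_add:
  assumes V: "r_integrable V" and W: "r_integrable W"
  shows "r_integrable (\<lambda>s. V s + W s)"
proof -
  note [measurable] = V[THEN r_integrable_measurable] W[THEN r_integrable_measurable]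
  have pw: "(V s + W s) powr r \<le> 2 powr r * (V s powr r + W s powr r)" for s
  proof -
    have V0: "0 \<le> V s" "0 \<le> W s" using V W by (auto intro: r_integrable_nonneg)
    then have "(V s + W s) powr r \<le> (2 * max (V s) (W s)) powr r"
      using r_gt_1 by (intro powr_mono2) auto
    also have "\<dots> = 2 powr r * max (V s) (W s) powr r"
      using V0 by (simp add: powr_mult)
    also have "\<dots> \<le> 2 powr r * (V s powr r + W s powr r)"
      by (intro mult_left_mono) (auto simp: max_def)
    finally show ?thesis .
  qed
  have "(\<integral>\<^sup>+s. ennreal ((V s + W s) powr r) \<partial>lebesgue) \<le>
      (\<integral>\<^sup>+s. ennreal (2 powr r) * (ennreal (V s powr r) + ennreal (W s powr r)) \<partial>lebesgue)"
    using pw by (intro nn_integral_mono) (simp add: ennreal_leI flip: ennreal_mult' ennreal_plus)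
  also have "\<dots> = ennreal (2 powr r) * ((\<integral>\<^sup>+s. ennreal (V s powr r) \<partial>lebesgue) + (\<integral>\<^sup>+s. ennreal (W s powr r) \<partial>lebesgue))"
    by (simp add: nn_integral_cmult nn_integral_add)
  also have "\<dots> < \<infinity>"
    using V W by (simp add: r_integrable_def ennreal_mult_less_top)
  finally show ?thesis using V W by (simp add: r_integrable_def)
qed

lemma r_integrable_cmult:
  assumes W: "r_integrable W" and c: "0 \<le> c"
  shows "r_integrable (\<lambda>s. c * W s)"
proof -
  note [measurable] = W[THEN r_integrable_measurable]
  have "(\<integral>\<^sup>+s. ennreal ((c * W s) powr r) \<partial>lebesgue) =
      (\<integral>\<^sup>+s. ennreal (c powr r) * ennreal (W s powr r) \<partial>lebesgue)"
    using W c by (intro nn_integral_cong) (simp add: powr_mult r_integrable_nonneg flip: ennreal_mult')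
  also have "\<dots> = ennreal (c powr r) * (\<integral>\<^sup>+s. ennreal (W s powr r) \<partial>lebesgue)"
    by (rule nn_integral_cmult) measurable
  also have "\<dots> < \<infinity>"
    using W by (simp add: r_integrable_def ennreal_mult_less_top)
  finally show ?thesis using W c by (simp add: r_integrable_def)
qed

lemma r_integrable_indicator:
  assumes [measurable]: "A \<in> sets lebesgue" and fin: "emeasure lebesgue A < \<infinity>"
  shows "r_integrable (indicator A :: real \<Rightarrow> real)"
proof -
  have "(\<integral>\<^sup>+s. ennreal ((indicator A s :: real) powr r) \<partial>lebesgue) = (\<integral>\<^sup>+s. indicator A s \<partial>lebesgue)"
    using r_gt_1 by (intro nn_integral_cong) (auto simp: indicator_def)
  with fin show ?thesis by (simp add: r_integrable_def)
qed

lemma r_integrable_shift: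
  assumes "r_integrable W"
  shows "r_integrable (\<lambda>s. W (s + c))"
proof -
  note [measurable] = r_integrable_measurable[OF assms]
  have "(\<lambda>s. ennreal (W s powr r)) \<in> borel_measurable lebesgue" by measurable
  from nn_integral_lebesgue_shift(1)[OF this, of c] show ?thesis
    using assms shift_measurable_lebesgue(1)[of W c] by (simp add: r_integrable_def)
qed

lemma r_integrable_integrable:
  assumes W: "r_integrable W" and supp: "\<And>s. s \<notin> {0..T} \<Longrightarrow> W s = 0"
  shows "integrable lebesgue W"
proof (rule integrableI_bounded)
  note [measurable] = W[THEN r_integrable_measurable]
  show "W \<in> borel_measurable lebesgue" by measurable
  have pw: "W s \<le> indicator {0..T} s + W s powr r" for s
  proof (cases "s \<in> {0..T}")
    case True
    have "W s \<le> 1 + W s powr r"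
    proof (cases "W s \<le> 1")
      case False
      then have "W s powr 1 \<le> W s powr r" using r_gt_1 by (intro powr_mono) auto
      then show ?thesis using False by simp
    qed (simp add: add_increasing2)
    then show ?thesis using True by simp
  qed (simp add: supp)
  have "(\<integral>\<^sup>+s. ennreal (norm (W s)) \<partial>lebesgue) \<le> (\<integral>\<^sup>+s. indicator {0..T} s + ennreal (W s powr r) \<partial>lebesgue)"
  proof (intro nn_integral_mono)
    fix s
    have "ennreal (norm (W s)) \<le> ennreal (indicator {0..T} s + W s powr r)"
      using pw[of s] W by (intro ennreal_leI) (simp add: r_integrable_nonneg)
    then show "ennreal (norm (W s)) \<le> indicator {0..T} s + ennreal (W s powr r)"
      by (simp add: ennreal_indicator ennreal_plus)
  qed
  also have "\<dots> = emeasure lebesgue {0..T} + (\<integral>\<^sup>+s. ennreal (W s powr r) \<partial>lebesgue)"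
    by (simp add: nn_integral_add)
  also have "\<dots> < \<infinity>" using W T by (simp add: r_integrable_def)
  finally show "(\<integral>\<^sup>+s. ennreal (norm (W s)) \<partial>lebesgue) < \<infinity>" .
qed

lemma r_integrable_kern_bounded:
  assumes "r_integrable W"
  obtains C :: real where "C \<ge> 0"
    and "\<And>\<tau>. (\<integral>\<^sup>+s. ennreal (kern (s - \<tau>) * W s) \<partial>lebesgue) \<le> ennreal C"
    and "\<And>t. (\<integral>\<^sup>+s. ennreal (kern (t - s) * W s) \<partial>lebesgue) \<le> ennreal C"
proof -
  note W = r_integrable_measurable[OF assms] r_integrable_nonneg[OF assms]
  have "kq 0 + (\<integral>\<^sup>+s. ennreal (W s powr r) \<partial>lebesgue) < \<infinity>" using r_integrable_finite[OF assms] kq_0_finite by simp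
  then obtain C where C: "kq 0 + (\<integral>\<^sup>+s. ennreal (W s powr r) \<partial>lebesgue) = ennreal C" "C \<ge> 0"
    by (cases "kq 0 + (\<integral>\<^sup>+s. ennreal (W s powr r) \<partial>lebesgue)") auto
  have "kq 0 + (\<integral>\<^sup>+s. ennreal (W s powr r) \<partial>lebesgue) \<le> ennreal C" by (simp add: C)
  \<comment> \<open>Only finiteness is wanted, so \<open>\<eta> = 1\<close> and no damping.\<close>
  then show thesis
    using kern_Young[OF W, of 1 _ 0] C(2) by (intro that[of C]) (simp_all add: C(1))
qed

text \<open>The weight \<open>exp (\<mu> * t)\<close> damps the kernel towards the past and is
  smaller at the delayed argument. It is at least 1 on \<open>{0..T}\<close>, so the forcing bound
  \<open>C\<close> carries over unchanged.\<close>

lemma forward_Volterra_solution: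
  fixes \<Phi> :: "real \<Rightarrow> 'a::euclidean_space \<Rightarrow> 'a \<Rightarrow> 'a"
  assumes l: "r_integrable l" and m: "r_integrable m" and h: "0 \<le> h"
    and \<Phi>m: "\<And>x z. x \<in> borel_measurable lebesgue \<Longrightarrow> z \<in> borel_measurable lebesgue \<Longrightarrow>
      (\<lambda>s. \<Phi> s (x s) (z s)) \<in> borel_measurable lebesgue"
    and \<Phi>0: "\<And>s. norm (\<Phi> s 0 0) \<le> m s"
    and Lip: "\<And>s a b a' b'. norm (\<Phi> s a b - \<Phi> s a' b') \<le> l s * (norm (a - a') + norm (b - b'))"
  obtains x K where "x \<in> borel_measurable lebesgue" "0 \<le> K" "\<And>t. norm (x t) \<le> K"
    "\<And>t. t \<notin> {0..T} \<Longrightarrow> x t = 0"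
    "\<And>t. t \<in> {0..T} \<Longrightarrow> integrable lebesgue (\<lambda>s. kern (t - s) *\<^sub>R \<Phi> s (x s) (x (s - h)))"
    "\<And>t. t \<in> {0..T} \<Longrightarrow> x t = (\<integral>s. kern (t - s) *\<^sub>R \<Phi> s (x s) (x (s - h)) \<partial>lebesgue)"
proof -
  obtain \<mu> where \<mu>: "\<mu> \<ge> 0"
    "\<And>t. (\<integral>\<^sup>+s. ennreal (kern (t - s) * exp (- \<mu> * (t - s)) * l s) \<partial>lebesgue) \<le> ennreal (1/4)"
    by (rule kern_weight_small[OF r_integrable_measurable r_integrable_nonneg r_integrable_finite, OF l l l, of "1/4"],
        simp, rule that)
  obtain C where C: "C \<ge> 0" "\<And>t. (\<integral>\<^sup>+s. ennreal (kern (t - s) * m s) \<partial>lebesgue) \<le> ennreal C"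
    by (rule r_integrable_kern_bounded[OF m], rule that)
  note [measurable] = l[THEN r_integrable_measurable] m[THEN r_integrable_measurable]
  define w where "w t = exp (\<mu> * t)" for t
  have [measurable]: "w \<in> borel_measurable lebesgue"
    unfolding w_def by (rule borel_measurable_lebesgue) measurable
  have contr: "(\<integral>\<^sup>+s. ennreal (kern (t - s) * (l s * (w s + w (s + - h)))) \<partial>lebesgue) \<le> ennreal (w t / 2)" for t
  proof (rule weighted_contraction[OF _ _ r_integrable_measurable[OF l] _ r_integrable_nonneg[OF l]])
    show "w s = w t * exp (- \<mu> * (t - s))" for s
      unfolding w_def mult_exp_exp by (simp add: algebra_simps)
    show "w (s + - h) \<le> w s" for s using \<mu>(1) h by (simp add: w_def mult_left_mono)
    show "(\<integral>\<^sup>+s. ennreal (kern (t - s) * exp (- \<mu> * (t - s)) * l s) \<partial>lebesgue) \<le> ennreal (1/4)" by (rule \<mu>(2))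
  qed (simp_all add: w_def)
  have cw: "(\<integral>\<^sup>+s. ennreal (kern (t - s) * m s) \<partial>lebesgue) \<le> ennreal (C * w t)" if "t \<in> {0..T}" for t
  proof -
    have "C * 1 \<le> C * w t" using that \<mu>(1) C(1) by (intro mult_left_mono) (auto simp: w_def)
    then have "ennreal C \<le> ennreal (C * w t)" by (intro ennreal_leI) simp
    with C(2)[of t] show ?thesis by (rule order_trans)
  qed
  show thesis
  proof (rule weighted_Volterra_solution[where \<kappa>="\<lambda>t s. kern (t - s)" and S="{0..T}" and w=w and l=l
        and m=m and \<Phi>=\<Phi> and c=C and \<sigma>="- h"])
    fix x
    assume x: "x \<in> borel_measurable lebesgue" "\<And>t. norm (x t) \<le> 2 * C * w t" "\<And>t. t \<notin> {0..T} \<Longrightarrow> x t = 0"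
    "\<And>t. t \<in> {0..T} \<Longrightarrow> integrable lebesgue (\<lambda>s. kern (t - s) *\<^sub>R \<Phi> s (x s) (x (s + - h)))"
    "\<And>t. t \<in> {0..T} \<Longrightarrow> x t = (\<integral>s. kern (t - s) *\<^sub>R \<Phi> s (x s) (x (s + - h)) \<partial>lebesgue)"
    show thesis
    proof (rule that[of x "2 * C * exp (\<mu> * T)"])
      show "norm (x t) \<le> 2 * C * exp (\<mu> * T)" for t
      proof (cases "t \<in> {0..T}")
        case True
        then have "2 * C * w t \<le> 2 * C * exp (\<mu> * T)"
          using \<mu>(1) C(1) by (intro mult_left_mono) (auto simp: w_def mult_left_mono)
        with x(2)[of t] show ?thesis by linarith
      qed (use x(3) C(1) in simp)
    qed (use x(1,3) x(4,5) C(1) in auto)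
  qed (use r_integrable_nonneg[OF l] r_integrable_nonneg[OF m] \<Phi>m \<Phi>0 Lip contr cw C(1)
      in \<open>auto simp: w_def\<close>)
qed

text \<open>The time-reversed weight \<open>exp (- \<mu> * t)\<close> damps the kernel towards the
  future and is smaller at the advanced argument. On \<open>{0..T}\<close> it is only bounded below
  by \<open>exp (- \<mu> * T)\<close>, whence the factor in \<open>c\<close>.\<close>

lemma backward_Volterra_solution:
  fixes \<Phi> :: "real \<Rightarrow> 'a::euclidean_space \<Rightarrow> 'a \<Rightarrow> 'a"
  assumes l: "r_integrable l" and m: "r_integrable m" and h: "0 \<le> h"
    and \<Phi>m: "\<And>x z. x \<in> borel_measurable lebesgue \<Longrightarrow> z \<in> borel_measurable lebesgue \<Longrightarrow>
      (\<lambda>s. \<Phi> s (x s) (z s)) \<in> borel_measurable lebesgue"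
    and \<Phi>0: "\<And>s. norm (\<Phi> s 0 0) \<le> m s"
    and Lip: "\<And>s a b a' b'. norm (\<Phi> s a b - \<Phi> s a' b') \<le> l s * (norm (a - a') + norm (b - b'))"
  obtains x K where "x \<in> borel_measurable lebesgue" "0 \<le> K" "\<And>t. norm (x t) \<le> K"
    "\<And>t. t \<notin> {0..T} \<Longrightarrow> x t = 0"
    "\<And>t. t \<in> {0..T} \<Longrightarrow> integrable lebesgue (\<lambda>s. kern (s - t) *\<^sub>R \<Phi> s (x s) (x (s + h)))"
    "\<And>t. t \<in> {0..T} \<Longrightarrow> x t = (\<integral>s. kern (s - t) *\<^sub>R \<Phi> s (x s) (x (s + h)) \<partial>lebesgue)"
proof -
  obtain \<mu> where \<mu>: "\<mu> \<ge> 0"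
    "\<And>t. (\<integral>\<^sup>+s. ennreal (kern (s - t) * exp (- \<mu> * (s - t)) * l s) \<partial>lebesgue) \<le> ennreal (1/4)"
    by (rule kern_weight_small[OF r_integrable_measurable r_integrable_nonneg r_integrable_finite, OF l l l, of "1/4"],
        simp, rule that)
  obtain C where C: "C \<ge> 0" "\<And>t. (\<integral>\<^sup>+s. ennreal (kern (s - t) * m s) \<partial>lebesgue) \<le> ennreal C"
    by (rule r_integrable_kern_bounded[OF m], rule that)
  note [measurable] = l[THEN r_integrable_measurable] m[THEN r_integrable_measurable]
  define w where "w t = exp (- \<mu> * t)" for t
  have [measurable]: "w \<in> borel_measurable lebesgue"
    unfolding w_def by (rule borel_measurable_lebesgue) measurable
  have contr: "(\<integral>\<^sup>+s. ennreal (kern (s - t) * (l s * (w s + w (s + h)))) \<partial>lebesgue) \<le> ennreal (w t / 2)" for t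
  proof (rule weighted_contraction[OF _ _ r_integrable_measurable[OF l] _ r_integrable_nonneg[OF l]])
    show "w s = w t * exp (- \<mu> * (s - t))" for s
      unfolding w_def mult_exp_exp by (simp add: algebra_simps)
    show "w (s + h) \<le> w s" for s using \<mu>(1) h by (simp add: w_def mult_left_mono)
    show "(\<integral>\<^sup>+s. ennreal (kern (s - t) * exp (- \<mu> * (s - t)) * l s) \<partial>lebesgue) \<le> ennreal (1/4)" by (rule \<mu>(2))
  qed (simp_all add: w_def)
  define c where "c = C * exp (\<mu> * T)"
  have c0: "c \<ge> 0" using C(1) by (simp add: c_def)
  have cw: "(\<integral>\<^sup>+s. ennreal (kern (s - t) * m s) \<partial>lebesgue) \<le> ennreal (c * w t)" if "t \<in> {0..T}" for t
  proof -
    have "1 \<le> exp (\<mu> * T) * w t"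
      using that \<mu>(1) by (simp add: w_def mult_exp_exp mult_left_mono)
    then have "C * 1 \<le> C * (exp (\<mu> * T) * w t)" using C(1) by (rule mult_left_mono)
    then have "ennreal C \<le> ennreal (c * w t)" by (intro ennreal_leI) (simp add: c_def mult.assoc)
    with C(2)[of t] show ?thesis by (rule order_trans)
  qed
  show thesis
  proof (rule weighted_Volterra_solution[where \<kappa>="\<lambda>t s. kern (s - t)" and S="{0..T}" and w=w and l=l
        and m=m and \<Phi>=\<Phi> and c=c and \<sigma>=h])
    fix x
    assume x: "x \<in> borel_measurable lebesgue" "\<And>t. norm (x t) \<le> 2 * c * w t" "\<And>t. t \<notin> {0..T} \<Longrightarrow> x t = 0"
    "\<And>t. t \<in> {0..T} \<Longrightarrow> integrable lebesgue (\<lambda>s. kern (s - t) *\<^sub>R \<Phi> s (x s) (x (s + h)))"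
    "\<And>t. t \<in> {0..T} \<Longrightarrow> x t = (\<integral>s. kern (s - t) *\<^sub>R \<Phi> s (x s) (x (s + h)) \<partial>lebesgue)"
    show thesis
    proof (rule that[of x "2 * c"])
      show "norm (x t) \<le> 2 * c" for t
      proof (cases "t \<in> {0..T}")
        case True
        then have "2 * c * w t \<le> 2 * c * 1"
          using \<mu>(1) c0 by (intro mult_left_mono) (auto simp: w_def)
        with x(2)[of t] show ?thesis by linarith
      qed (use x(3) c0 in simp)
    qed (use x(1,3,4,5) c0 in auto)
  qed (use r_integrable_nonneg[OF l] r_integrable_nonneg[OF m] \<Phi>m \<Phi>0 Lip contr cw C(1) c0
      in \<open>auto simp: w_def\<close>)
qed

end

subsection \<open>Spike variations\<close>

text \<open>A grid of mesh \<open>e\<close> cuts \<open>A\<close> into countably many pieces, which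
  cannot all be null.\<close>

lemma lebesgue_small_subset:
  fixes A :: "real set"
  assumes [measurable]: "A \<in> sets lebesgue" and A: "0 < emeasure lebesgue A" and e: "0 < e"
  obtains E where "E \<in> sets lebesgue" "E \<subseteq> A" "0 < emeasure lebesgue E" "emeasure lebesgue E \<le> ennreal e"
proof -
  define E where "E i = A \<inter> {e * of_int i..e * (of_int i + 1)}" for i :: int
  have [measurable]: "E i \<in> sets lebesgue" for i unfolding E_def by (intro sets.Int assms(1)) simp
  have "\<exists>i. E i \<notin> null_sets lebesgue"
  proof (rule ccontr)
    assume "\<not> ?thesis"
    then have "(\<Union>i. E i) \<in> null_sets lebesgue" by (intro null_sets_UN) auto
    moreover have "A \<subseteq> (\<Union>i. E i)"
    proof
      fix x assume "x \<in> A"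
      moreover have "e * of_int \<lfloor>x / e\<rfloor> \<le> x" "x \<le> e * (of_int \<lfloor>x / e\<rfloor> + 1)"
        using floor_divide_lower[OF e, of x] floor_divide_upper[OF e, of x]
        by (simp_all add: mult.commute)
      ultimately show "x \<in> (\<Union>i. E i)" by (auto simp: E_def)
    qed
    ultimately have "A \<in> null_sets lebesgue" using null_sets_subset[OF _ assms(1)] by blast
    with A show False by (simp add: null_sets_def)
  qed
  then obtain i where i: "E i \<notin> null_sets lebesgue" by blast
  have "emeasure lebesgue (E i) \<le> emeasure lebesgue {e * of_int i..e * (of_int i + 1)}"
    by (intro emeasure_mono) (auto simp: E_def)
  also have "\<dots> = ennreal e" using e by (simp add: algebra_simps)
  finally have "emeasure lebesgue (E i) \<le> ennreal e" .
  moreover have "emeasure lebesgue (E i) \<noteq> 0" using i by auto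
  ultimately show thesis
    by (intro that[of "E i"]) (auto simp: E_def zero_less_iff_neq_zero)
qed

text \<open>Testing the adjoint relation with \<open>a = y\<close> transfers the bound of an
  operator to its transpose with the same constant.\<close>

lemma adjoint_bound:
  fixes x y :: "'a::real_inner"
  assumes adj: "\<And>a. y \<bullet> a = x \<bullet> F a" and F: "norm (F y) \<le> c * norm y" and c: "0 \<le> c"
  shows "norm y \<le> c * norm x"
proof (cases "y = 0")
  case False
  have "norm y * norm y = x \<bullet> F y"
    using adj[of y] by (simp add: power2_norm_eq_inner flip: power2_eq_square)
  also have "\<dots> \<le> norm x * norm (F y)" by (rule norm_cauchy_schwarz)
  also have "\<dots> \<le> norm x * (c * norm y)" by (intro mult_left_mono F) simp
  finally have "norm y * norm y \<le> (c * norm x) * norm y" by (simp add: mult_ac)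
  then show ?thesis using False by (simp add: mult_le_cancel_right)
qed (use c in simp)

lemma has_derivative_pair_remainder:
  fixes F :: "'a::real_normed_vector \<Rightarrow> 'b::real_normed_vector \<Rightarrow> 'c::real_normed_vector"
  assumes F: "((\<lambda>(a, b). F a b) has_derivative (\<lambda>(a, b). P a + Q b)) (at (0, 0))" and F0: "F 0 0 = 0" and e: "0 < e"
  obtains \<delta> where "0 < \<delta>"
    and "\<And>a b. norm a + norm b < \<delta> \<Longrightarrow> norm (F a b - P a - Q b) \<le> e * (norm a + norm b)"
proof -
  from F e obtain \<delta> where \<delta>: "0 < \<delta>"
    "\<And>y. norm (y - (0, 0)) < \<delta> \<Longrightarrow> norm ((case y of (a, b) \<Rightarrow> F a b) - (case (0, 0) of (a, b) \<Rightarrow> F a b) -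
      (case y - (0, 0) of (a, b) \<Rightarrow> P a + Q b)) \<le> e * norm (y - (0, 0))"
    unfolding has_derivative_at_alt by blast
  show thesis
  proof (rule that[OF \<delta>(1)])
    fix a :: 'a and b :: 'b assume ab: "norm a + norm b < \<delta>"
    have n: "norm (a, b) \<le> norm a + norm b" by (rule norm_Pair_le)
    then have "norm (F a b - P a - Q b) \<le> e * norm (a, b)"
      using \<delta>(2)[of "(a, b)"] ab F0 by (simp add: diff_diff_eq)
    also have "\<dots> \<le> e * (norm a + norm b)" using n e by (intro mult_left_mono) auto
    finally show "norm (F a b - P a - Q b) \<le> e * (norm a + norm b)" .
  qed
qed

lemma integrable_bounded_mult:
  fixes F :: "real \<Rightarrow> real"
  assumes "integrable lebesgue W" "F \<in> borel_measurable lebesgue" "\<And>s. \<bar>F s\<bar> \<le> c * W s"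
  shows "integrable lebesgue F"
  by (rule Bochner_Integration.integrable_bound[of _ "\<lambda>s. c * W s"])
    (use assms in \<open>auto intro: order_trans[OF _ abs_ge_self]\<close>)

section \<open>Spike variations of an abstract delayed system with zero reference trajectory\<close>

definition spike :: "real set \<Rightarrow> (real \<Rightarrow> 'a \<Rightarrow> 'b \<Rightarrow> 'c) \<Rightarrow> (real \<Rightarrow> 'a \<Rightarrow> 'b \<Rightarrow> 'c) \<Rightarrow>
    real \<Rightarrow> 'a \<Rightarrow> 'b \<Rightarrow> 'c" where
  "spike E F Fv s a b = (if s \<in> E then Fv s a b else F s a b)"

text \<open>The data are increments measured from the optimal pair. \<open>\<phi>\<close> and
  \<open>\<gamma>\<close> keep the optimal control and vanish at the origin, while
  \<open>\<phi>v s 0 0\<close> and \<open>\<gamma>v s 0 0\<close> are the jumps \<delta>f and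
  \<delta>g caused by the new control value. \<open>A\<close>, \<open>B\<close> stand for the
  Jacobians and \<open>p\<close>, \<open>k\<close> for the gradients in the current and the delayed
  argument; here \<open>p\<close> is not an exponent. Since all coefficients are cut off outside
  \<open>{0..T}\<close>, the shifted terms in \<open>G_eq\<close> end by support and no
  characteristic function appears. For \<open>s \<le> 0\<close> the shift may still reach into
  \<open>{0..T}\<close>, hence the restriction \<open>0 < s\<close>.\<close>

locale spike_variation = fractional_kernel \<alpha> T r for \<alpha> T r :: real +
  fixes h M \<Psi> :: real and l :: "real \<Rightarrow> real"
    and \<phi> \<phi>v :: "real \<Rightarrow> 'a::euclidean_space \<Rightarrow> 'a \<Rightarrow> 'a"
    and \<gamma> \<gamma>v :: "real \<Rightarrow> 'a \<Rightarrow> 'a \<Rightarrow> real"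
    and A B At Bt :: "real \<Rightarrow> 'a \<Rightarrow> 'a" and p k \<psi> G :: "real \<Rightarrow> 'a"
  assumes h: "0 < h" and M: "0 \<le> M" and \<Psi>: "0 \<le> \<Psi>"
    and l: "r_integrable l" and l_supp: "\<And>s. s \<notin> {0..T} \<Longrightarrow> l s = 0"
    and \<phi>m: "\<And>x z. x \<in> borel_measurable lebesgue \<Longrightarrow> z \<in> borel_measurable lebesgue \<Longrightarrow>
      (\<lambda>s. \<phi> s (x s) (z s)) \<in> borel_measurable lebesgue"
    and \<phi>vm: "\<And>x z. x \<in> borel_measurable lebesgue \<Longrightarrow> z \<in> borel_measurable lebesgue \<Longrightarrow>
      (\<lambda>s. \<phi>v s (x s) (z s)) \<in> borel_measurable lebesgue"
    and \<gamma>m: "\<And>x z. x \<in> borel_measurable lebesgue \<Longrightarrow> z \<in> borel_measurable lebesgue \<Longrightarrow>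
      (\<lambda>s. \<gamma> s (x s) (z s)) \<in> borel_measurable lebesgue"
    and \<gamma>vm: "\<And>x z. x \<in> borel_measurable lebesgue \<Longrightarrow> z \<in> borel_measurable lebesgue \<Longrightarrow>
      (\<lambda>s. \<gamma>v s (x s) (z s)) \<in> borel_measurable lebesgue"
    and \<phi>0: "\<And>s. \<phi> s 0 0 = 0" and \<gamma>0: "\<And>s. \<gamma> s 0 0 = 0"
    and \<phi>_supp: "\<And>s a b. s \<notin> {0..T} \<Longrightarrow> \<phi> s a b = 0"
    and \<phi>v_supp: "\<And>s a b. s \<notin> {0..T} \<Longrightarrow> \<phi>v s a b = 0"
    and \<gamma>v_supp: "\<And>s a b. s \<notin> {0..T} \<Longrightarrow> \<gamma>v s a b = 0"
    and \<phi>_Lip: "\<And>s a b a' b'. norm (\<phi> s a b - \<phi> s a' b') \<le> l s * (norm (a - a') + norm (b - b'))"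
    and \<phi>v_Lip: "\<And>s a b a' b'. norm (\<phi>v s a b - \<phi>v s a' b') \<le> l s * (norm (a - a') + norm (b - b'))"
    and \<gamma>_Lip: "\<And>s a b a' b'. \<bar>\<gamma> s a b - \<gamma> s a' b'\<bar> \<le> M * indicator {0..T} s * (norm (a - a') + norm (b - b'))"
    and \<gamma>v_Lip: "\<And>s a b a' b'. \<bar>\<gamma>v s a b - \<gamma>v s a' b'\<bar> \<le> M * indicator {0..T} s * (norm (a - a') + norm (b - b'))"
    and \<phi>_deriv: "\<And>s. s \<in> {0..T} \<Longrightarrow> ((\<lambda>(a, b). \<phi> s a b) has_derivative (\<lambda>(a, b). A s a + B s b)) (at (0, 0))"
    and \<gamma>_deriv: "\<And>s. s \<in> {0..T} \<Longrightarrow> ((\<lambda>(a, b). \<gamma> s a b) has_derivative (\<lambda>(a, b). p s \<bullet> a + k s \<bullet> b)) (at (0, 0))"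
    and A_bound: "\<And>s a. norm (A s a) \<le> l s * norm a" and B_bound: "\<And>s a. norm (B s a) \<le> l s * norm a"
    and p_bound: "\<And>s. norm (p s) \<le> M * indicator {0..T} s" and k_bound: "\<And>s. norm (k s) \<le> M * indicator {0..T} s"
    and At: "\<And>s x a. At s x \<bullet> a = x \<bullet> A s a" and Bt: "\<And>s x a. Bt s x \<bullet> a = x \<bullet> B s a"
    and Am: "\<And>x. x \<in> borel_measurable lebesgue \<Longrightarrow> (\<lambda>s. A s (x s)) \<in> borel_measurable lebesgue"
    and Bm: "\<And>x. x \<in> borel_measurable lebesgue \<Longrightarrow> (\<lambda>s. B s (x s)) \<in> borel_measurable lebesgue"
    and p_meas: "p \<in> borel_measurable lebesgue" and k_meas: "k \<in> borel_measurable lebesgue"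
    and \<psi>_meas: "\<psi> \<in> borel_measurable lebesgue" and \<psi>_bound: "\<And>s. norm (\<psi> s) \<le> \<Psi>"
    and \<psi>_eq: "\<And>\<tau>. \<tau> \<in> {0..T} \<Longrightarrow> \<psi> \<tau> = (\<integral>s. kern (s - \<tau>) *\<^sub>R G s \<partial>lebesgue)"
    and G_meas: "G \<in> borel_measurable lebesgue" and G_supp: "\<And>s. s \<notin> {0..T} \<Longrightarrow> G s = 0"
    and G_eq: "AE s in lebesgue. 0 < s \<longrightarrow> G s = - p s - k (s + h) + At s (\<psi> s) + Bt (s + h) (\<psi> (s + h))"
    and \<gamma>v0: "integrable lebesgue (\<lambda>s. \<gamma>v s 0 0)"
begin

text \<open>The zero extension encodes the zero history; boundedness makes products with integrable
  weights integrable.\<close>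

definition variation :: "real set \<Rightarrow> (real \<Rightarrow> 'a) \<Rightarrow> bool" where
  "variation E d \<longleftrightarrow> d \<in> borel_measurable lebesgue \<and> (\<exists>K. \<forall>t. norm (d t) \<le> K) \<and>
     (\<forall>t. t \<notin> {0..T} \<longrightarrow> d t = 0) \<and>
     (\<forall>t\<in>{0..T}. integrable lebesgue (\<lambda>s. kern (t - s) *\<^sub>R spike E \<phi> \<phi>v s (d s) (d (s - h))) \<and>
       d t = (\<integral>s. kern (t - s) *\<^sub>R spike E \<phi> \<phi>v s (d s) (d (s - h)) \<partial>lebesgue))"

lemma spike_measurable:
  assumes [measurable]: "E \<in> sets lebesgue" and x: "x \<in> borel_measurable lebesgue" "z \<in> borel_measurable lebesgue"
  shows "(\<lambda>s. spike E \<phi> \<phi>v s (x s) (z s)) \<in> borel_measurable lebesgue"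
    and "(\<lambda>s. spike E \<gamma> \<gamma>v s (x s) (z s)) \<in> borel_measurable lebesgue"
proof -
  note [measurable] = \<phi>m[OF x] \<phi>vm[OF x] \<gamma>m[OF x] \<gamma>vm[OF x]
  show "(\<lambda>s. spike E \<phi> \<phi>v s (x s) (z s)) \<in> borel_measurable lebesgue"
    and "(\<lambda>s. spike E \<gamma> \<gamma>v s (x s) (z s)) \<in> borel_measurable lebesgue"
    unfolding spike_def by measurable
qed

lemma spike_Lip:
  "norm (spike E \<phi> \<phi>v s a b - spike E \<phi> \<phi>v s a' b') \<le> l s * (norm (a - a') + norm (b - b'))"
  "\<bar>spike E \<gamma> \<gamma>v s a b - spike E \<gamma> \<gamma>v s a' b'\<bar> \<le> M * indicator {0..T} s * (norm (a - a') + norm (b - b'))"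
  using \<phi>_Lip \<phi>v_Lip \<gamma>_Lip \<gamma>v_Lip by (auto simp: spike_def)

lemma spike_0:
  "spike E \<phi> \<phi>v s 0 0 = indicator E s *\<^sub>R \<phi>v s 0 0"
  "spike E \<gamma> \<gamma>v s 0 0 = indicator E s * \<gamma>v s 0 0"
  by (auto simp: spike_def \<phi>0 \<gamma>0)

lemma finite_emeasure_subset:
  "E \<subseteq> {0..T} \<Longrightarrow> emeasure lebesgue E < \<infinity>"
  using emeasure_mono[of E "{0..T}" lebesgue] T by (auto intro: le_less_trans)

text \<open>The bound \<open>N\<close> on \<open>E\<close> makes the forcing \<delta>f an L^r
  function, as the Volterra equation requires; in the application \<delta>f is otherwise controlled
  only by \<open>L\<close> times a distance of controls.\<close>

lemma variation_exists:
  assumes E [measurable]: "E \<in> sets lebesgue" "E \<subseteq> {0..T}" and N: "0 \<le> N"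
    and \<phi>vN: "\<And>s. s \<in> E \<Longrightarrow> norm (\<phi>v s 0 0) \<le> N"
  obtains d where "variation E d"
proof (rule forward_Volterra_solution[of l "\<lambda>s. N * indicator E s" h "spike E \<phi> \<phi>v"])
  show "r_integrable l" by (rule l)
  show "r_integrable (\<lambda>s. N * indicator E s)"
    by (intro r_integrable_cmult r_integrable_indicator E finite_emeasure_subset N)
  show "norm (spike E \<phi> \<phi>v s 0 0) \<le> N * indicator E s" for s
    using \<phi>vN[of s] by (auto simp: spike_0 indicator_def)
  fix x K
  assume "x \<in> borel_measurable lebesgue" "\<And>t. norm (x t) \<le> K"
    "\<And>t. t \<notin> {0..T} \<Longrightarrow> x t = 0"
    "\<And>t. t \<in> {0..T} \<Longrightarrow> integrable lebesgue (\<lambda>s. kern (t - s) *\<^sub>R spike E \<phi> \<phi>v s (x s) (x (s - h)))"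
    "\<And>t. t \<in> {0..T} \<Longrightarrow> x t = (\<integral>s. kern (t - s) *\<^sub>R spike E \<phi> \<phi>v s (x s) (x (s - h)) \<partial>lebesgue)"
  then have "variation E x" unfolding variation_def by blast
  then show thesis by (rule that)
qed (use h spike_measurable(1)[OF E(1)] spike_Lip(1) in auto)

lemma
  assumes d: "variation E d" and E: "E \<in> sets lebesgue" "E \<subseteq> {0..T}"
  shows variation_measurable: "d \<in> borel_measurable lebesgue"
    and variation_supp: "t \<notin> {0..T} \<Longrightarrow> d t = 0"
    and variation_nonpos: "t \<le> 0 \<Longrightarrow> d t = 0"
    and variation_rhs_measurable: "(\<lambda>s. spike E \<phi> \<phi>v s (d s) (d (s - h))) \<in> borel_measurable lebesgue"
    and variation_rhs_supp: "s \<notin> {0..T} \<Longrightarrow> spike E \<phi> \<phi>v s (d s) (d (s - h)) = 0"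
    and variation_le: "ennreal (norm (d t)) \<le>
      (\<integral>\<^sup>+\<tau>. ennreal (kern (t - \<tau>)) * ennreal (norm (spike E \<phi> \<phi>v \<tau> (d \<tau>) (d (\<tau> - h)))) \<partial>lebesgue)"
proof -
  show dm: "d \<in> borel_measurable lebesgue" and supp: "t \<notin> {0..T} \<Longrightarrow> d t = 0" for t
    using d by (auto simp: variation_def)
  show Ds: "spike E \<phi> \<phi>v s (d s) (d (s - h)) = 0" if "s \<notin> {0..T}" for s
    using E(2) that \<phi>_supp[OF that] by (auto simp: spike_def)
  show "(\<lambda>s. spike E \<phi> \<phi>v s (d s) (d (s - h))) \<in> borel_measurable lebesgue"
    by (intro spike_measurable E dm shift_measurable_lebesgue)
  show "d t = 0" if "t \<le> 0" for t
  proof (cases "t = 0")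
    case True
    \<comment> \<open>At time 0 the kernel sees only negative \<open>s\<close>, where the right-hand
      side is cut off.\<close>
    have "kern (0 - s) *\<^sub>R spike E \<phi> \<phi>v s (d s) (d (s - h)) = 0" for s
      using Ds[of s] by (cases "s \<in> {0..T}") (auto simp: kern_def)
    then have "(\<integral>s. kern (0 - s) *\<^sub>R spike E \<phi> \<phi>v s (d s) (d (s - h)) \<partial>lebesgue) = 0"
      by (simp only: Bochner_Integration.integral_zero)
    moreover have "d 0 = (\<integral>s. kern (0 - s) *\<^sub>R spike E \<phi> \<phi>v s (d s) (d (s - h)) \<partial>lebesgue)"
      using d T unfolding variation_def by (meson atLeastAtMost_iff less_imp_le order_refl)
    ultimately show ?thesis using True by simp
  qed (use supp that in auto)
  show "ennreal (norm (d t)) \<le>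
      (\<integral>\<^sup>+\<tau>. ennreal (kern (t - \<tau>)) * ennreal (norm (spike E \<phi> \<phi>v \<tau> (d \<tau>) (d (\<tau> - h)))) \<partial>lebesgue)"
  proof (cases "t \<in> {0..T}")
    case True
    then have "integrable lebesgue (\<lambda>s. kern (t - s) *\<^sub>R spike E \<phi> \<phi>v s (d s) (d (s - h)))"
      and "d t = (\<integral>s. kern (t - s) *\<^sub>R spike E \<phi> \<phi>v s (d s) (d (s - h)) \<partial>lebesgue)"
      using d by (auto simp: variation_def)
    then show ?thesis
      using integral_norm_bound_ennreal by (fastforce simp: ennreal_mult')
  qed (simp add: supp)
qed

lemma variation_rhs_bound:
  assumes "\<And>s. s \<in> E \<Longrightarrow> norm (\<phi>v s 0 0) \<le> N"
  shows "norm (spike E \<phi> \<phi>v s (d s) (d (s - h))) \<le> l s * (norm (d s) + norm (d (s - h))) + N * indicator E s"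
proof -
  have "norm (spike E \<phi> \<phi>v s (d s) (d (s - h))) \<le>
      norm (spike E \<phi> \<phi>v s (d s) (d (s - h)) - spike E \<phi> \<phi>v s 0 0) + norm (spike E \<phi> \<phi>v s 0 0)" by norm
  also have "norm (spike E \<phi> \<phi>v s (d s) (d (s - h)) - spike E \<phi> \<phi>v s 0 0) \<le> l s * (norm (d s) + norm (d (s - h)))"
    using spike_Lip(1)[of E s "d s" "d (s - h)" 0 0] by simp
  also have "norm (spike E \<phi> \<phi>v s 0 0) \<le> N * indicator E s"
    using assms[of s] by (auto simp: spike_0 indicator_def)
  finally show ?thesis by simp
qed

lemma variation_rhs_integrable:
  assumes d: "variation E d" and E: "E \<in> sets lebesgue" "E \<subseteq> {0..T}"
    and N: "\<And>s. s \<in> E \<Longrightarrow> norm (\<phi>v s 0 0) \<le> N"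
  shows "integrable lebesgue (\<lambda>s. spike E \<phi> \<phi>v s (d s) (d (s - h)))"
proof -
  obtain K where K: "\<And>t. norm (d t) \<le> K" using d by (auto simp: variation_def)
  have "integrable lebesgue (\<lambda>s. l s * (K + K) + N * indicator E s)"
    using r_integrable_integrable[OF l l_supp] finite_emeasure_subset[OF E(2)] E(1) by simp
  then show ?thesis
  proof (rule Bochner_Integration.integrable_bound)
    show "AE s in lebesgue. norm (spike E \<phi> \<phi>v s (d s) (d (s - h))) \<le> norm (l s * (K + K) + N * indicator E s)"
    proof (rule AE_I2)
      fix s
      have "norm (spike E \<phi> \<phi>v s (d s) (d (s - h))) \<le> l s * (norm (d s) + norm (d (s - h))) + N * indicator E s"
        by (rule variation_rhs_bound) (rule N)
      also have "\<dots> \<le> l s * (K + K) + N * indicator E s"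
        by (intro add_right_mono mult_left_mono add_mono K r_integrable_nonneg[OF l])
      finally show "norm (spike E \<phi> \<phi>v s (d s) (d (s - h))) \<le> norm (l s * (K + K) + N * indicator E s)" by simp
    qed
  qed (rule variation_rhs_measurable[OF d E])
qed

text \<open>The constant is chosen before \<open>E\<close>, \<open>d\<close> and \<open>N\<close>,
  so the increment of the right-hand side is linear in the measure of \<open>E\<close>.\<close>

lemma variation_L1:
  obtains C where "0 \<le> C"
    and "\<And>E d N. \<lbrakk>variation E d; E \<in> sets lebesgue; E \<subseteq> {0..T}; 0 \<le> N; \<And>s. s \<in> E \<Longrightarrow> norm (\<phi>v s 0 0) \<le> N\<rbrakk> \<Longrightarrow>
      (\<integral>\<^sup>+s. ennreal (norm (spike E \<phi> \<phi>v s (d s) (d (s - h)))) \<partial>lebesgue) \<le> ennreal (C * N * measure lebesgue E)"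
proof (rule kern_L1_stability[of l h])
  fix C assume C0: "0 \<le> C"
    and C: "\<And>D d b :: real \<Rightarrow> ennreal. \<lbrakk>D \<in> borel_measurable lebesgue; d \<in> borel_measurable lebesgue;
      b \<in> borel_measurable lebesgue; \<And>s. s \<notin> {0..T} \<Longrightarrow> D s = 0;
      (\<integral>\<^sup>+s. D s \<partial>lebesgue) < \<infinity>;
      \<And>s. d s \<le> (\<integral>\<^sup>+\<tau>. ennreal (kern (s - \<tau>)) * D \<tau> \<partial>lebesgue);
      \<And>s. D s \<le> ennreal (l s) * (d s + d (s - h)) + b s\<rbrakk> \<Longrightarrow>
      (\<integral>\<^sup>+s. D s \<partial>lebesgue) \<le> ennreal C * (\<integral>\<^sup>+s. b s \<partial>lebesgue)"
  show thesis
  proof (rule that[OF C0])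
    fix E d N
    assume d: "variation E d" and E [measurable]: "E \<in> sets lebesgue" "E \<subseteq> {0..T}" and N0: "0 \<le> N"
      and N: "\<And>s. s \<in> E \<Longrightarrow> norm (\<phi>v s 0 0) \<le> N"
    note [measurable] = variation_measurable[OF d E] variation_rhs_measurable[OF d E]
    have "(\<integral>\<^sup>+s. ennreal (norm (spike E \<phi> \<phi>v s (d s) (d (s - h)))) \<partial>lebesgue) \<le>
        ennreal C * (\<integral>\<^sup>+s. ennreal (N * indicator E s) \<partial>lebesgue)"
    proof (rule C[where d="\<lambda>s. ennreal (norm (d s))"])
      show "(\<integral>\<^sup>+s. ennreal (norm (spike E \<phi> \<phi>v s (d s) (d (s - h)))) \<partial>lebesgue) < \<infinity>"
        using variation_rhs_integrable[OF d E N] by (simp add: integrable_iff_bounded)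
      show "ennreal (norm (spike E \<phi> \<phi>v s (d s) (d (s - h)))) \<le>
          ennreal (l s) * (ennreal (norm (d s)) + ennreal (norm (d (s - h)))) + ennreal (N * indicator E s)" for s
      proof -
        have "ennreal (norm (spike E \<phi> \<phi>v s (d s) (d (s - h)))) \<le> ennreal (l s * (norm (d s) + norm (d (s - h))) + N * indicator E s)"
          by (intro ennreal_leI variation_rhs_bound N)
        then show ?thesis
          using N0 r_integrable_nonneg[OF l, of s] by (simp add: ennreal_mult ennreal_plus)
      qed
    qed (use variation_le[OF d E] variation_rhs_supp[OF d E] in auto)
    also have "(\<integral>\<^sup>+s. ennreal (N * indicator E s) \<partial>lebesgue) = ennreal N * emeasure lebesgue E"
      using N0 by (simp add: ennreal_mult' ennreal_indicator nn_integral_cmult_indicator)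
    also have "emeasure lebesgue E = ennreal (measure lebesgue E)"
      using finite_emeasure_subset[OF E(2)] by (intro emeasure_eq_ennreal_measure) auto
    finally show "(\<integral>\<^sup>+s. ennreal (norm (spike E \<phi> \<phi>v s (d s) (d (s - h)))) \<partial>lebesgue) \<le> ennreal (C * N * measure lebesgue E)"
      using C0 N0 by (simp add: ennreal_mult mult.assoc)
  qed
qed (use l h in \<open>auto simp: r_integrable_def\<close>)

text \<open>Used with two weights: the indicator of \<open>{0..T}\<close> shows that the increments
  are small in L1, and the remainder quotient, for which \<epsilon> is small, shows that the
  remainder is small relative to the measure of \<open>E\<close>.\<close>

lemma variation_weighted_L1:
  assumes d: "variation E d" and E: "E \<in> sets lebesgue" "E \<subseteq> {0..T}"
    and D: "(\<integral>\<^sup>+s. ennreal (norm (spike E \<phi> \<phi>v s (d s) (d (s - h)))) \<partial>lebesgue) \<le> ennreal c" and c: "0 \<le> c"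
    and W: "W \<in> borel_measurable lebesgue" "\<And>s. 0 \<le> W s"
    and \<epsilon>: "0 \<le> \<epsilon>" "\<And>\<tau>. (\<integral>\<^sup>+s. ennreal (kern (s - \<tau>) * W s) \<partial>lebesgue) \<le> ennreal \<epsilon>"
  shows "(\<integral>\<^sup>+s. ennreal (W s * (norm (d s) + norm (d (s - h)))) \<partial>lebesgue) \<le> ennreal (2 * \<epsilon> * c)"
proof -
  note [measurable] = variation_measurable[OF d E] variation_rhs_measurable[OF d E] W(1)
  have "(\<integral>\<^sup>+s. ennreal (W s * (norm (d s) + norm (d (s - h)))) \<partial>lebesgue) =
      (\<integral>\<^sup>+s. ennreal (W s) * (ennreal (norm (d s)) + ennreal (norm (d (s - h)))) \<partial>lebesgue)"
    using W(2) by (intro nn_integral_cong) (simp add: ennreal_mult' ennreal_plus)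
  also have "\<dots> \<le> 2 * ennreal \<epsilon> * (\<integral>\<^sup>+s. ennreal (norm (spike E \<phi> \<phi>v s (d s) (d (s - h)))) \<partial>lebesgue)"
  proof (rule kern_delayed_convolution_le[where d="\<lambda>s. ennreal (norm (d s))"])
    show "(\<integral>\<^sup>+s. ennreal (kern (s - \<tau>)) * ennreal (W s) \<partial>lebesgue) \<le> ennreal \<epsilon>" for \<tau>
      using \<epsilon>(2)[of \<tau>] by (simp add: ennreal_mult')
  qed (use variation_le[OF d E] in auto)
  also have "\<dots> \<le> 2 * ennreal \<epsilon> * ennreal c" by (intro mult_left_mono D) simp
  also have "\<dots> = ennreal (2 * \<epsilon> * c)" using \<epsilon>(1) c by (simp add: ennreal_mult)
  finally show ?thesis .
qed

lemma At_bound: "norm (At s x) \<le> l s * norm x" and Bt_bound: "norm (Bt s x) \<le> l s * norm x"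
  by (rule adjoint_bound[OF At A_bound r_integrable_nonneg[OF l]],
      rule adjoint_bound[OF Bt B_bound r_integrable_nonneg[OF l]])

text \<open>Because \<psi> is bounded, \<open>G\<close> is dominated almost everywhere by an L^r
  weight built from \<open>l\<close> and indicators; this gives the uniform kernel bound that
  duality asks for.\<close>

lemma G_kern_bounded:
  obtains C where "\<And>\<tau>. (\<integral>\<^sup>+s. ennreal (kern (s - \<tau>) * norm (G s)) \<partial>lebesgue) \<le> ennreal C"
proof -
  let ?W = "\<lambda>s. 2 * M * indicator {0..T} s + M * indicator {0..T} (s + h) + \<Psi> * (l s + l (s + h))"
  have ind: "r_integrable (indicator {0..T} :: real \<Rightarrow> real)"
    using T by (intro r_integrable_indicator) auto
  have W: "r_integrable ?W"
    by (intro r_integrable_add r_integrable_cmult ind l r_integrable_shift[OF ind] r_integrable_shift[OF l])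
      (use M \<Psi> in auto)
  have tri: "norm (- a - b + c + e) \<le> norm a + norm b + norm c + norm e" for a b c e :: 'a
    by norm
  show thesis
  proof (rule r_integrable_kern_bounded[OF W])
    fix C assume C: "\<And>\<tau>. (\<integral>\<^sup>+s. ennreal (kern (s - \<tau>) * ?W s) \<partial>lebesgue) \<le> ennreal C"
    have *: "AE s in lebesgue. norm (G s) \<le> ?W s"
    proof -
      \<comment> \<open>The formula for \<open>G\<close> covers positive \<open>s\<close> only, so
        the endpoint 0 is discarded as a null set.\<close>
      have "AE s in (lebesgue :: real measure). s \<noteq> 0"
        by (rule AE_I'[of "{0}"]) auto
      then show ?thesis using G_eq
      proof eventually_elim
        case (elim s)
        have W0: "0 \<le> ?W s" using r_integrable_nonneg[OF W] .
        show ?case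
        proof (cases "s \<in> {0..T}")
          case True
          with elim have "G s = - p s - k (s + h) + At s (\<psi> s) + Bt (s + h) (\<psi> (s + h))" by auto
          then have "norm (G s) \<le> norm (p s) + norm (k (s + h)) + norm (At s (\<psi> s)) + norm (Bt (s + h) (\<psi> (s + h)))"
            using tri by simp
          also have "\<dots> \<le> M * indicator {0..T} s + M * indicator {0..T} (s + h) + l s * \<Psi> + l (s + h) * \<Psi>"
            using r_integrable_nonneg[OF l]
            by (intro add_mono p_bound k_bound order_trans[OF At_bound] order_trans[OF Bt_bound] mult_left_mono \<psi>_bound)
          also have "\<dots> \<le> ?W s" using M by (simp add: algebra_simps)
          finally show ?thesis .
        qed (use W0 G_supp in auto)
      qed
    qed
    show thesis
    proof (rule that)
      fix \<tau>
      have "(\<integral>\<^sup>+s. ennreal (kern (s - \<tau>) * norm (G s)) \<partial>lebesgue) \<le> (\<integral>\<^sup>+s. ennreal (kern (s - \<tau>) * ?W s) \<partial>lebesgue)"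
        using * by (intro nn_integral_mono_AE) (auto elim!: eventually_mono intro!: ennreal_leI mult_left_mono)
      then show "(\<integral>\<^sup>+s. ennreal (kern (s - \<tau>) * norm (G s)) \<partial>lebesgue) \<le> ennreal C"
        using C[of \<tau>] by (rule order_trans)
    qed
  qed
qed

text \<open>The linear part belongs to the optimal control even on \<open>E\<close>. Off
  \<open>E\<close> this is a genuine first-order remainder; on \<open>E\<close> only the Lipschitz
  bound is at hand, which suffices because \<open>E\<close> shrinks.\<close>

definition Rf :: "real set \<Rightarrow> (real \<Rightarrow> 'a) \<Rightarrow> real \<Rightarrow> 'a" where
  "Rf E d s = spike E \<phi> \<phi>v s (d s) (d (s - h)) - indicator E s *\<^sub>R \<phi>v s 0 0 - A s (d s) - B s (d (s - h))"

definition Rg :: "real set \<Rightarrow> (real \<Rightarrow> 'a) \<Rightarrow> real \<Rightarrow> real" where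
  "Rg E d s = spike E \<gamma> \<gamma>v s (d s) (d (s - h)) - indicator E s * \<gamma>v s 0 0 - p s \<bullet> d s - k s \<bullet> d (s - h)"

lemma Rf_bound: "norm (Rf E d s) \<le> 2 * l s * (norm (d s) + norm (d (s - h)))"
proof -
  have tri: "norm (x - y - z) \<le> norm x + norm y + norm z" for x y z :: 'a by norm
  have "norm (Rf E d s) \<le> norm (spike E \<phi> \<phi>v s (d s) (d (s - h)) - spike E \<phi> \<phi>v s 0 0) + norm (A s (d s)) + norm (B s (d (s - h)))"
    unfolding Rf_def spike_0 by (rule tri)
  also have "\<dots> \<le> l s * (norm (d s) + norm (d (s - h))) + l s * norm (d s) + l s * norm (d (s - h))"
    using spike_Lip(1)[of E s "d s" "d (s - h)" 0 0] by (intro add_mono A_bound B_bound) simp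
  finally show ?thesis by (simp add: algebra_simps)
qed

lemma Rg_bound: "\<bar>Rg E d s\<bar> \<le> 2 * (M * indicator {0..T} s) * (norm (d s) + norm (d (s - h)))"
proof -
  let ?M = "M * indicator {0..T} s"
  have tri: "\<bar>x - y - z\<bar> \<le> \<bar>x\<bar> + \<bar>y\<bar> + \<bar>z\<bar>" for x y z :: real by linarith
  have "\<bar>Rg E d s\<bar> \<le> \<bar>spike E \<gamma> \<gamma>v s (d s) (d (s - h)) - spike E \<gamma> \<gamma>v s 0 0\<bar> + \<bar>p s \<bullet> d s\<bar> + \<bar>k s \<bullet> d (s - h)\<bar>"
    unfolding Rg_def spike_0 by (rule tri)
  also have "\<dots> \<le> ?M * (norm (d s) + norm (d (s - h))) + ?M * norm (d s) + ?M * norm (d (s - h))"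
  proof (intro add_mono)
    show "\<bar>spike E \<gamma> \<gamma>v s (d s) (d (s - h)) - spike E \<gamma> \<gamma>v s 0 0\<bar> \<le> ?M * (norm (d s) + norm (d (s - h)))"
      using spike_Lip(2)[of E s "d s" "d (s - h)" 0 0] by simp
    show "\<bar>p s \<bullet> d s\<bar> \<le> ?M * norm (d s)"
      by (rule order_trans[OF Cauchy_Schwarz_ineq2]) (intro mult_right_mono p_bound norm_ge_zero)
    show "\<bar>k s \<bullet> d (s - h)\<bar> \<le> ?M * norm (d (s - h))"
      by (rule order_trans[OF Cauchy_Schwarz_ineq2]) (intro mult_right_mono k_bound norm_ge_zero)
  qed
  finally show ?thesis by (simp add: algebra_simps)
qed

text \<open>Duality turns \<open>\<integral> \<psi> \<bullet> D\<close> into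
  \<open>\<integral> G \<bullet> d\<close>, and inserting the adjoint equation cancels every term
  linear in \<open>d\<close>. What survives is the integral of the jumps over \<open>E\<close> and
  the remainders, with no approximation.\<close>

lemma variation_first_order:
  assumes d: "variation E d" and E: "E \<in> sets lebesgue" "E \<subseteq> {0..T}"
    and N: "\<And>s. s \<in> E \<Longrightarrow> norm (\<phi>v s 0 0) \<le> N"
  defines "H \<equiv> \<lambda>s. indicator E s * (\<gamma>v s 0 0 - \<psi> s \<bullet> \<phi>v s 0 0) + (Rg E d s - \<psi> s \<bullet> Rf E d s)"
  shows "integrable lebesgue H"
    and "(\<integral>s. spike E \<gamma> \<gamma>v s (d s) (d (s - h)) \<partial>lebesgue) = (\<integral>s. H s \<partial>lebesgue)"
proof -
  let ?D = "\<lambda>s. spike E \<phi> \<phi>v s (d s) (d (s - h))" and ?\<Gamma> = "\<lambda>s. spike E \<gamma> \<gamma>v s (d s) (d (s - h))"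
  let ?I = "indicator {0..T} :: real \<Rightarrow> real"
  obtain K where K: "\<And>t. norm (d t) \<le> K" using d by (auto simp: variation_def)
  have K0: "0 \<le> K" using K[of 0] norm_ge_zero order_trans by blast
  note dm [measurable] = variation_measurable[OF d E]
  note [measurable] = variation_rhs_measurable[OF d E] shift_measurable_lebesgue(2)[OF dm, of h] E(1)
    spike_measurable(2)[OF E(1) dm shift_measurable_lebesgue(2)[OF dm, of h]]
    \<psi>_meas p_meas k_meas G_meas Am[OF dm] Bm[OF shift_measurable_lebesgue(2)[OF dm, of h]]
    shift_measurable_lebesgue(1)[OF k_meas, of h] shift_measurable_lebesgue(1)[OF \<psi>_meas, of h]
  have iI: "integrable lebesgue ?I" using T by (intro integrable_real_indicator) auto
  have il: "integrable lebesgue l" by (rule r_integrable_integrable[OF l l_supp])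
  have ip: "integrable lebesgue (\<lambda>s. p s \<bullet> d s)"
  proof (rule integrable_bounded_mult[OF iI, where c="M * K"])
    show "\<bar>p s \<bullet> d s\<bar> \<le> M * K * ?I s" for s
      using order_trans[OF Cauchy_Schwarz_ineq2 mult_mono[OF p_bound K], of s s] M by (simp add: mult_ac)
  qed measurable
  have ik: "integrable lebesgue (\<lambda>s. k s \<bullet> d (s - h))"
  proof (rule integrable_bounded_mult[OF iI, where c="M * K"])
    show "\<bar>k s \<bullet> d (s - h)\<bar> \<le> M * K * ?I s" for s
      using order_trans[OF Cauchy_Schwarz_ineq2 mult_mono[OF k_bound K], of s "s - h"] M by (simp add: mult_ac)
  qed measurable
  have iA: "integrable lebesgue (\<lambda>s. \<psi> s \<bullet> A s (d s))"
  proof (rule integrable_bounded_mult[OF il, where c="\<Psi> * K"])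
    fix s
    have "\<bar>\<psi> s \<bullet> A s (d s)\<bar> \<le> \<Psi> * (l s * K)"
      using r_integrable_nonneg[OF l, of s] \<Psi>
      by (intro order_trans[OF Cauchy_Schwarz_ineq2] mult_mono \<psi>_bound order_trans[OF A_bound] mult_left_mono K) auto
    then show "\<bar>\<psi> s \<bullet> A s (d s)\<bar> \<le> \<Psi> * K * l s" by (simp add: mult_ac)
  qed measurable
  have iB: "integrable lebesgue (\<lambda>s. \<psi> s \<bullet> B s (d (s - h)))"
  proof (rule integrable_bounded_mult[OF il, where c="\<Psi> * K"])
    fix s
    have "\<bar>\<psi> s \<bullet> B s (d (s - h))\<bar> \<le> \<Psi> * (l s * K)"
      using r_integrable_nonneg[OF l, of s] \<Psi>
      by (intro order_trans[OF Cauchy_Schwarz_ineq2] mult_mono \<psi>_bound order_trans[OF B_bound] mult_left_mono K) auto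
    then show "\<bar>\<psi> s \<bullet> B s (d (s - h))\<bar> \<le> \<Psi> * K * l s" by (simp add: mult_ac)
  qed measurable
  have iD: "integrable lebesgue ?D" by (rule variation_rhs_integrable[OF d E N])
  have i\<psi>D: "integrable lebesgue (\<lambda>s. \<psi> s \<bullet> ?D s)"
  proof (rule integrable_bounded_mult[OF integrable_norm[OF iD], where c=\<Psi>])
    show "\<bar>\<psi> s \<bullet> ?D s\<bar> \<le> \<Psi> * norm (?D s)" for s
      by (intro order_trans[OF Cauchy_Schwarz_ineq2] mult_right_mono \<psi>_bound) simp
  qed measurable
  have i\<gamma>E: "integrable lebesgue (\<lambda>s. indicator E s * \<gamma>v s 0 0)"
    using integrable_mult_indicator[OF E(1) \<gamma>v0] by simp
  have i\<Gamma>: "integrable lebesgue ?\<Gamma>"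
  proof -
    have "integrable lebesgue (\<lambda>s. ?\<Gamma> s - indicator E s * \<gamma>v s 0 0)"
    proof (rule integrable_bounded_mult[OF iI, where c="M * (K + K)"])
      fix s
      have "\<bar>?\<Gamma> s - indicator E s * \<gamma>v s 0 0\<bar> \<le> M * ?I s * (norm (d s) + norm (d (s - h)))"
        using spike_Lip(2)[of E s "d s" "d (s - h)" 0 0] by (simp add: spike_0)
      also have "\<dots> \<le> M * ?I s * (K + K)"
        using M by (intro mult_left_mono add_mono K) auto
      finally show "\<bar>?\<Gamma> s - indicator E s * \<gamma>v s 0 0\<bar> \<le> M * (K + K) * ?I s" by (simp add: mult_ac)
    qed (use borel_measurable_integrable[OF i\<gamma>E] in measurable)
    from Bochner_Integration.integrable_add[OF this i\<gamma>E] show ?thesis by simp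
  qed
  \<comment> \<open>Written in terms whose integrals exist one by one.\<close>
  have H: "H s = ?\<Gamma> s - p s \<bullet> d s - k s \<bullet> d (s - h) + (\<psi> s \<bullet> A s (d s) + \<psi> s \<bullet> B s (d (s - h)) - \<psi> s \<bullet> ?D s)" for s
    unfolding H_def Rf_def Rg_def by (cases "s \<in> E") (simp_all add: inner_diff_right inner_add_right)
  show "integrable lebesgue H"
    unfolding H using i\<Gamma> ip ik iA iB i\<psi>D by simp
  have dual: "(\<integral>s. G s \<bullet> d s \<partial>lebesgue) = (\<integral>s. \<psi> s \<bullet> ?D s \<partial>lebesgue)"
  proof -
    have deq: "d t = (\<integral>s. kern (t - s) *\<^sub>R ?D s \<partial>lebesgue)" "integrable lebesgue (\<lambda>s. kern (t - s) *\<^sub>R ?D s)"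
      if "t \<in> {0..T}" for t using d that by (auto simp: variation_def)
    have "(\<integral>s. G s \<bullet> d s \<partial>lebesgue) = (\<integral>s. G s \<bullet> (\<integral>\<tau>. kern (s - \<tau>) *\<^sub>R ?D \<tau> \<partial>lebesgue) \<partial>lebesgue)"
    proof (intro Bochner_Integration.integral_cong refl)
      show "G s \<bullet> d s = G s \<bullet> (\<integral>\<tau>. kern (s - \<tau>) *\<^sub>R ?D \<tau> \<partial>lebesgue)" for s
        by (cases "s \<in> {0..T}") (simp_all add: deq(1)[symmetric] G_supp)
    qed
    also have "\<dots> = (\<integral>\<tau>. (\<integral>s. kern (s - \<tau>) *\<^sub>R G s \<partial>lebesgue) \<bullet> ?D \<tau> \<partial>lebesgue)"
    proof (rule G_kern_bounded)
      fix C assume C: "\<And>\<tau>. (\<integral>\<^sup>+s. ennreal (kern (s - \<tau>) * norm (G s)) \<partial>lebesgue) \<le> ennreal C"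
      show ?thesis
        by (rule kern_duality[OF G_meas iD C deq(2)]) (use G_supp in blast)
    qed
    also have "\<dots> = (\<integral>s. \<psi> s \<bullet> ?D s \<partial>lebesgue)"
    proof (intro Bochner_Integration.integral_cong refl)
      show "(\<integral>s. kern (s - \<tau>) *\<^sub>R G s \<partial>lebesgue) \<bullet> ?D \<tau> = \<psi> \<tau> \<bullet> ?D \<tau>" for \<tau>
        using variation_rhs_supp[OF d E] by (cases "\<tau> \<in> {0..T}") (simp_all add: \<psi>_eq[symmetric])
    qed
    finally show ?thesis .
  qed
  \<comment> \<open>The translation by \<open>h\<close> matches the advanced terms of the adjoint
    equation with the delayed terms of the state equation; over the whole line no limits of
    integration have to be adjusted.\<close>
  have sk: "(\<integral>s. k (s + h) \<bullet> d s \<partial>lebesgue) = (\<integral>s. k s \<bullet> d (s - h) \<partial>lebesgue)"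
    and isk: "integrable lebesgue (\<lambda>s. k (s + h) \<bullet> d s)"
    using lebesgue_integral_real_affine[of 1 "\<lambda>s. k s \<bullet> d (s - h)" h] lebesgue_integrable_real_affine[OF ik, of 1 h]
    by (simp_all add: add.commute)
  have sB: "(\<integral>s. \<psi> (s + h) \<bullet> B (s + h) (d s) \<partial>lebesgue) = (\<integral>s. \<psi> s \<bullet> B s (d (s - h)) \<partial>lebesgue)"
    and isB: "integrable lebesgue (\<lambda>s. \<psi> (s + h) \<bullet> B (s + h) (d s))"
    using lebesgue_integral_real_affine[of 1 "\<lambda>s. \<psi> s \<bullet> B s (d (s - h))" h] lebesgue_integrable_real_affine[OF iB, of 1 h]
    by (simp_all add: add.commute)
  have B0: "B s 0 = 0" and A0: "A s 0 = 0" for s using B_bound[of s 0] A_bound[of s 0] by auto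
  have "(\<integral>s. G s \<bullet> d s \<partial>lebesgue) =
      (\<integral>s. - (p s \<bullet> d s) - k (s + h) \<bullet> d s + \<psi> s \<bullet> A s (d s) + \<psi> (s + h) \<bullet> B (s + h) (d s) \<partial>lebesgue)"
  proof (rule integral_cong_AE)
    show "AE s in lebesgue. G s \<bullet> d s = - (p s \<bullet> d s) - k (s + h) \<bullet> d s + \<psi> s \<bullet> A s (d s) + \<psi> (s + h) \<bullet> B (s + h) (d s)"
      using G_eq
    proof eventually_elim
      case (elim s)
      show ?case
      proof (cases "0 < s")
        case True
        with elim show ?thesis by (simp add: inner_diff_left inner_add_left At Bt)
      qed (simp add: variation_nonpos[OF d E] A0 B0)
    qed
  qed (use borel_measurable_integrable[OF ip] borel_measurable_integrable[OF isk] borel_measurable_integrable[OF iA]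
      borel_measurable_integrable[OF isB] in measurable)
  also have "\<dots> = - (\<integral>s. p s \<bullet> d s \<partial>lebesgue) - (\<integral>s. k s \<bullet> d (s - h) \<partial>lebesgue)
      + (\<integral>s. \<psi> s \<bullet> A s (d s) \<partial>lebesgue) + (\<integral>s. \<psi> s \<bullet> B s (d (s - h)) \<partial>lebesgue)"
    using ip isk iA isB by (simp add: sk sB)
  finally have key: "(\<integral>s. p s \<bullet> d s \<partial>lebesgue) + (\<integral>s. k s \<bullet> d (s - h) \<partial>lebesgue) =
      (\<integral>s. \<psi> s \<bullet> A s (d s) \<partial>lebesgue) + (\<integral>s. \<psi> s \<bullet> B s (d (s - h)) \<partial>lebesgue) - (\<integral>s. \<psi> s \<bullet> ?D s \<partial>lebesgue)"
    using dual by simp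
  have "(\<integral>s. H s \<partial>lebesgue) = (\<integral>s. ?\<Gamma> s \<partial>lebesgue) - (\<integral>s. p s \<bullet> d s \<partial>lebesgue) - (\<integral>s. k s \<bullet> d (s - h) \<partial>lebesgue)
      + ((\<integral>s. \<psi> s \<bullet> A s (d s) \<partial>lebesgue) + (\<integral>s. \<psi> s \<bullet> B s (d (s - h)) \<partial>lebesgue) - (\<integral>s. \<psi> s \<bullet> ?D s \<partial>lebesgue))"
    unfolding H using i\<Gamma> ip ik iA iB i\<psi>D by simp
  with key show "(\<integral>s. ?\<Gamma> s \<partial>lebesgue) = (\<integral>s. H s \<partial>lebesgue)" by simp
qed

text \<open>This is the quotient rho_E of the overview; \<Psi> accounts for the multiplier \<psi> in
  front of the dynamics remainder. It isolates a factor with an L^r majorant independent of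
  \<open>E\<close> and \<open>d\<close>.\<close>

definition ratio :: "real set \<Rightarrow> (real \<Rightarrow> 'a) \<Rightarrow> real \<Rightarrow> real" where
  "ratio E d s = (\<bar>Rg E d s\<bar> + \<Psi> * norm (Rf E d s)) / (norm (d s) + norm (d (s - h)))"

abbreviation "ratio_bound s \<equiv> 2 * (M * indicator {0..T} s) + \<Psi> * (2 * l s)"

lemma remainder_bound:
  "\<bar>Rg E d s\<bar> + \<Psi> * norm (Rf E d s) \<le> ratio_bound s * (norm (d s) + norm (d (s - h)))"
  using add_mono[OF Rg_bound[of E d s] mult_left_mono[OF Rf_bound[of E d s] \<Psi>]] by (simp add: algebra_simps)

text \<open>If the denominator vanishes, then so does the numerator, so \<open>x / 0 = 0\<close> does no harm.\<close>

lemma ratio_mult: "ratio E d s * (norm (d s) + norm (d (s - h))) = \<bar>Rg E d s\<bar> + \<Psi> * norm (Rf E d s)"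
proof (cases "norm (d s) + norm (d (s - h)) = 0")
  case True
  have "0 \<le> \<bar>Rg E d s\<bar> + \<Psi> * norm (Rf E d s)" using \<Psi> by simp
  with remainder_bound[of E d s] True show ?thesis by simp
qed (simp add: ratio_def)

lemma ratio_nonneg: "0 \<le> ratio E d s"
  unfolding ratio_def using \<Psi> by (intro divide_nonneg_nonneg add_nonneg_nonneg mult_nonneg_nonneg) auto

lemma ratio_bound_nonneg: "0 \<le> ratio_bound s"
  using M \<Psi> r_integrable_nonneg[OF l, of s] by simp

lemma ratio_le: "ratio E d s \<le> ratio_bound s"
proof (cases "norm (d s) + norm (d (s - h)) = 0")
  case True
  then show ?thesis using ratio_bound_nonneg by (simp add: ratio_def)
next
  case False
  then have "0 < norm (d s) + norm (d (s - h))"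
    using norm_ge_zero[of "d s"] norm_ge_zero[of "d (s - h)"] by linarith
  then show ?thesis using remainder_bound[of E d s] unfolding ratio_def by (simp add: pos_divide_le_eq)
qed

lemma ratio_measurable:
  assumes d: "variation E d" and E: "E \<in> sets lebesgue" "E \<subseteq> {0..T}"
  shows "Rf E d \<in> borel_measurable lebesgue" "Rg E d \<in> borel_measurable lebesgue" "ratio E d \<in> borel_measurable lebesgue"
proof -
  note dm [measurable] = variation_measurable[OF d E]
  note dh [measurable] = shift_measurable_lebesgue(2)[OF dm, of h]
  note [measurable] = variation_rhs_measurable[OF d E] E(1) spike_measurable(2)[OF E(1) dm dh]
    p_meas k_meas Am[OF dm] Bm[OF dh] \<phi>vm[of "\<lambda>_. 0" "\<lambda>_. 0", simplified] \<gamma>vm[of "\<lambda>_. 0" "\<lambda>_. 0", simplified]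
  show [measurable]: "Rf E d \<in> borel_measurable lebesgue" "Rg E d \<in> borel_measurable lebesgue"
    unfolding Rf_def Rg_def by measurable
  show "ratio E d \<in> borel_measurable lebesgue"
    unfolding ratio_def by measurable
qed

text \<open>Differentiability at the origin for one fixed \<open>s\<close>; the radius may depend on
  \<open>s\<close> but not on \<open>E\<close> or \<open>d\<close>.\<close>

lemma ratio_small:
  assumes s: "s \<in> {0..T}" and e: "0 < e"
  obtains \<delta> where "0 < \<delta>"
    and "\<And>E d. s \<notin> E \<Longrightarrow> norm (d s) + norm (d (s - h)) < \<delta> \<Longrightarrow> ratio E d s \<le> e"
proof -
  \<comment> \<open>Chosen so that the cost remainder and \<Psi> times the dynamics remainder add up
    to \<open>e\<close>.\<close>
  define e' where "e' = e / (1 + \<Psi>)"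
  have "e' * (1 + \<Psi>) = e" using \<Psi> by (simp add: e'_def add_nonneg_eq_0_iff)
  then have e': "e' > 0" "e' + \<Psi> * e' = e"
    using e \<Psi> by (simp add: e'_def, simp add: algebra_simps del: times_divide_eq_left)
  obtain \<delta>1 where 1: "0 < \<delta>1"
    "\<And>a b. norm a + norm b < \<delta>1 \<Longrightarrow> norm (\<phi> s a b - A s a - B s b) \<le> e' * (norm a + norm b)"
    by (rule has_derivative_pair_remainder[OF \<phi>_deriv[OF s] \<phi>0 e'(1)], rule that)
  obtain \<delta>2 where 2: "0 < \<delta>2"
    "\<And>a b. norm a + norm b < \<delta>2 \<Longrightarrow> norm (\<gamma> s a b - p s \<bullet> a - k s \<bullet> b) \<le> e' * (norm a + norm b)"
    by (rule has_derivative_pair_remainder[OF \<gamma>_deriv[OF s] \<gamma>0 e'(1)], rule that)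
  show thesis
  proof (rule that[of "min \<delta>1 \<delta>2"])
    fix E and d :: "real \<Rightarrow> 'a" assume sE: "s \<notin> E" and small: "norm (d s) + norm (d (s - h)) < min \<delta>1 \<delta>2"
    let ?n = "norm (d s) + norm (d (s - h))"
    have "norm (Rf E d s) \<le> e' * ?n" "\<bar>Rg E d s\<bar> \<le> e' * ?n"
      using 1(2)[of "d s" "d (s - h)"] 2(2)[of "d s" "d (s - h)"] small sE
      by (simp_all add: Rf_def Rg_def spike_def)
    then have "\<bar>Rg E d s\<bar> + \<Psi> * norm (Rf E d s) \<le> e' * ?n + \<Psi> * (e' * ?n)"
      using \<Psi> by (intro add_mono mult_left_mono) auto
    also have "\<dots> = e * ?n" unfolding e'(2)[symmetric] by (simp add: algebra_simps)
    finally have le: "\<bar>Rg E d s\<bar> + \<Psi> * norm (Rf E d s) \<le> e * ?n" .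
    show "ratio E d s \<le> e"
    proof (cases "?n = 0")
      case False
      then have "0 < ?n" using norm_ge_zero[of "d s"] norm_ge_zero[of "d (s - h)"] by linarith
      with le show ?thesis unfolding ratio_def by (simp add: pos_divide_le_eq)
    qed (use e in \<open>simp add: ratio_def\<close>)
  qed (use 1(1) 2(1) in simp)
qed

text \<open>Dominated convergence with the power of \<open>ratio_bound\<close> as majorant.
  Including the indicator of \<open>E j\<close> in \<open>lim\<close> makes one limit carry two
  facts: the increments at \<open>s\<close> tend to zero, and \<open>s\<close> eventually lies
  outside \<open>E j\<close>.\<close>

lemma ratio_r_tendsto_0:
  assumes d: "\<And>j. variation (E j) (d j)" and E: "\<And>j. E j \<in> sets lebesgue" "\<And>j. E j \<subseteq> {0..T}"
    and lim: "AE s in lebesgue. (\<lambda>j. indicator {0..T} s * (norm (d j s) + norm (d j (s - h))) + indicator (E j) s :: real) \<longlonglongrightarrow> 0"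
  shows "(\<lambda>j. \<integral>\<^sup>+s. ennreal (ratio (E j) (d j) s powr r) \<partial>lebesgue) \<longlonglongrightarrow> 0"
proof -
  have rb: "r_integrable (\<lambda>s. ratio_bound s)"
    using T M \<Psi> by (intro r_integrable_add r_integrable_cmult l r_integrable_indicator) auto
  have "(\<lambda>j. \<integral>\<^sup>+s. ennreal (ratio (E j) (d j) s powr r) \<partial>lebesgue) \<longlonglongrightarrow> (\<integral>\<^sup>+s. 0 \<partial>(lebesgue :: real measure))"
  proof (rule nn_integral_dominated_convergence[where w="\<lambda>s. ennreal (ratio_bound s powr r)"])
    show "(\<lambda>s. ennreal (ratio (E j) (d j) s powr r)) \<in> borel_measurable lebesgue" for j
      using ratio_measurable(3)[OF d E] by measurable
    show "(\<lambda>s. ennreal (ratio_bound s powr r)) \<in> borel_measurable lebesgue"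
      using r_integrable_measurable[OF rb] by measurable
    show "(\<integral>\<^sup>+s. ennreal (ratio_bound s powr r) \<partial>lebesgue) < \<infinity>"
      by (rule r_integrable_finite[OF rb])
    show "AE s in lebesgue. ennreal (ratio (E j) (d j) s powr r) \<le> ennreal (ratio_bound s powr r)" for j
      using r_gt_1 by (intro AE_I2 ennreal_leI powr_mono2 ratio_le ratio_nonneg) auto
    show "AE s in lebesgue. (\<lambda>j. ennreal (ratio (E j) (d j) s powr r)) \<longlonglongrightarrow> 0"
      using lim
    proof eventually_elim
      case (elim s)
      have "(\<lambda>j. ratio (E j) (d j) s) \<longlonglongrightarrow> 0"
      proof (cases "s \<in> {0..T}")
        case True
        show ?thesis
        proof (rule tendstoI)
          fix e :: real assume "0 < e"
          then have "0 < e / 2" by simp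
          from ratio_small[OF True this] obtain \<delta> where \<delta>: "0 < \<delta>"
            "\<And>E d. s \<notin> E \<Longrightarrow> norm (d s) + norm (d (s - h)) < \<delta> \<Longrightarrow> ratio E d s \<le> e / 2" by blast
          \<comment> \<open>Below 1 the indicator must vanish, so \<open>s\<close> is off
            \<open>E j\<close>; below \<delta> the quotient is small.\<close>
          have "0 < min \<delta> 1" using \<delta>(1) by simp
          from order_tendstoD(2)[OF elim this]
          show "\<forall>\<^sub>F j in sequentially. dist (ratio (E j) (d j) s) 0 < e"
          proof eventually_elim
            case (elim j)
            have "s \<notin> E j"
            proof
              assume "s \<in> E j"
              with elim True have "norm (d j s) + norm (d j (s - h)) + 1 < 1" by simp
              with norm_ge_zero[of "d j s"] norm_ge_zero[of "d j (s - h)"] show False by linarith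
            qed
            with elim True have "norm (d j s) + norm (d j (s - h)) < \<delta>" by simp
            with \<open>s \<notin> E j\<close>
            have "ratio (E j) (d j) s \<le> e / 2" by (rule \<delta>(2))
            then show ?case using ratio_nonneg[of "E j" "d j" s] \<open>0 < e\<close> by simp
          qed
        qed
      next
        case False
        then have "ratio (E j) (d j) s = 0" for j
          using ratio_le[of "E j" "d j" s] ratio_nonneg[of "E j" "d j" s] l_supp[of s] by simp
        then show ?thesis by simp
      qed
      then have "(\<lambda>j. ratio (E j) (d j) s powr r) \<longlonglongrightarrow> 0 powr r"
        using r_gt_1 ratio_nonneg by (intro tendsto_powr2 tendsto_const) (auto intro: always_eventually)
      then show ?case using tendsto_ennrealI by fastforce
    qed
  qed auto
  then show ?thesis by simp
qed

text \<open>Were the inequality to fail on a set of positive measure, a spike there would gain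
  \<open>1 / N\<close> per unit of measure, while the remainder costs strictly less.\<close>

lemma maximum_principle:
  assumes minimal: "\<And>E d. E \<in> sets lebesgue \<Longrightarrow> E \<subseteq> {0..T} \<Longrightarrow> variation E d \<Longrightarrow>
    0 \<le> (\<integral>s. spike E \<gamma> \<gamma>v s (d s) (d (s - h)) \<partial>lebesgue)"
  shows "AE s in lebesgue. 0 \<le> \<gamma>v s 0 0 - \<psi> s \<bullet> \<phi>v s 0 0"
proof -
  define Q where "Q s = \<gamma>v s 0 0 - \<psi> s \<bullet> \<phi>v s 0 0" for s
  note [measurable] = \<phi>vm[of "\<lambda>_. 0" "\<lambda>_. 0", simplified] \<gamma>vm[of "\<lambda>_. 0" "\<lambda>_. 0", simplified] \<psi>_meas
  have Qm [measurable]: "Q \<in> borel_measurable lebesgue" unfolding Q_def by measurable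
  \<comment> \<open>One index controls both the gap and the size of \<delta>f, so countably many
    sets exhaust the failure set and each of them admits spikes.\<close>
  define Bad where "Bad n = {s \<in> space lebesgue. Q s < - (1 / real (Suc n)) \<and> norm (\<phi>v s 0 0) \<le> real (Suc n)} \<inter> {0..T}" for n :: nat
  have [measurable]: "Bad n \<in> sets lebesgue" for n unfolding Bad_def by measurable
  have null: "Bad n \<in> null_sets lebesgue" for n
  proof (rule ccontr)
    assume "Bad n \<notin> null_sets lebesgue"
    then have pos: "0 < emeasure lebesgue (Bad n)" by (auto simp: zero_less_iff_neq_zero)
    define N where "N = real (Suc n)"
    have N: "0 < N" by (simp add: N_def)
    have "\<exists>E. E \<in> sets lebesgue \<and> E \<subseteq> Bad n \<and> 0 < emeasure lebesgue E \<and> emeasure lebesgue E \<le> ennreal (1 / real (Suc j))" for j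
      using lebesgue_small_subset[OF _ pos, of "1 / real (Suc j)"] by (metis \<open>Bad n \<in> sets lebesgue\<close> of_nat_0_less_iff zero_less_Suc zero_less_divide_1_iff)
    then obtain E where E: "\<And>j. E j \<in> sets lebesgue" "\<And>j. E j \<subseteq> Bad n" "\<And>j. 0 < emeasure lebesgue (E j)"
      "\<And>j. emeasure lebesgue (E j) \<le> ennreal (1 / real (Suc j))" by metis
    have ES: "E j \<subseteq> {0..T}" for j using E(2)[of j] by (auto simp: Bad_def)
    have EN: "norm (\<phi>v s 0 0) \<le> N" if "s \<in> E j" for s j using E(2)[of j] that by (auto simp: Bad_def N_def)
    have EQ: "Q s \<le> - (1 / N)" if "s \<in> E j" for s j using E(2)[of j] that by (auto simp: Bad_def N_def)
    have mE: "emeasure lebesgue (E j) = ennreal (measure lebesgue (E j))" for j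
      using finite_emeasure_subset[OF ES[of j]] by (intro emeasure_eq_ennreal_measure) simp
    have mE_pos: "0 < measure lebesgue (E j)" for j using E(3)[of j] by (simp add: mE)
    have mE_le: "measure lebesgue (E j) \<le> 1 / real (Suc j)" for j
      using E(4)[of j] by (simp add: mE del: of_nat_Suc)
    have "\<exists>d. variation (E j) d" for j
      by (rule variation_exists[OF E(1) ES less_imp_le[OF N] EN]) blast+
    then obtain d where d: "\<And>j. variation (E j) (d j)" by metis
    obtain C where C: "0 \<le> C" and D: "\<And>j. (\<integral>\<^sup>+s. ennreal (norm (spike (E j) \<phi> \<phi>v s (d j s) (d j (s - h)))) \<partial>lebesgue) \<le> ennreal (C * N * measure lebesgue (E j))"
    proof (rule variation_L1)
      fix C assume "0 \<le> C"
        "\<And>E d N. \<lbrakk>variation E d; E \<in> sets lebesgue; E \<subseteq> {0..T}; 0 \<le> N; \<And>s. s \<in> E \<Longrightarrow> norm (\<phi>v s 0 0) \<le> N\<rbrakk> \<Longrightarrow>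
          (\<integral>\<^sup>+s. ennreal (norm (spike E \<phi> \<phi>v s (d s) (d (s - h)))) \<partial>lebesgue) \<le> ennreal (C * N * measure lebesgue E)"
      then show thesis using d E(1) ES EN N by (intro that[of C]) (auto simp: less_imp_le)
    qed
    have CN: "0 \<le> C * N * measure lebesgue (E j)" for j using C N by simp
    note dm = variation_measurable[OF d E(1) ES]
    \<comment> \<open>L1 convergence gives almost everywhere convergence only along a subsequence.
      Joining the increments and the indicator in one function lets one subsequence serve
      both.\<close>
    define u where "u j s = indicator {0..T} s * (norm (d j s) + norm (d j (s - h))) + (indicator (E j) s :: real)" for j s
    have um [measurable]: "u j \<in> borel_measurable lebesgue" for j
    proof -
      note [measurable] = dm[of j] shift_measurable_lebesgue(2)[OF dm, of j h] E(1)[of j]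
      show ?thesis unfolding u_def by measurable
    qed
    have indS: "r_integrable (indicator {0..T} :: real \<Rightarrow> real)" using T by (intro r_integrable_indicator) auto
    obtain c where c: "0 \<le> c" "\<And>\<tau>. (\<integral>\<^sup>+s. ennreal (kern (s - \<tau>) * indicator {0..T} s) \<partial>lebesgue) \<le> ennreal c"
      by (rule r_integrable_kern_bounded[OF indS], rule that)
    have u0: "0 \<le> u j s" for j s by (simp add: u_def)
    have uint: "(\<integral>\<^sup>+s. ennreal (u j s) \<partial>lebesgue) \<le> ennreal ((2 * c * (C * N) + 1) * measure lebesgue (E j))" for j
    proof -
      note [measurable] = dm[of j] shift_measurable_lebesgue(2)[OF dm, of j h] E(1)[of j]
      have "(\<integral>\<^sup>+s. ennreal (u j s) \<partial>lebesgue) =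
          (\<integral>\<^sup>+s. ennreal (indicator {0..T} s * (norm (d j s) + norm (d j (s - h)))) + indicator (E j) s \<partial>lebesgue)"
        unfolding u_def by (intro nn_integral_cong) (subst ennreal_plus, auto simp: ennreal_indicator)
      also have "\<dots> = (\<integral>\<^sup>+s. ennreal (indicator {0..T} s * (norm (d j s) + norm (d j (s - h)))) \<partial>lebesgue) + emeasure lebesgue (E j)"
        by (subst nn_integral_add) auto
      also have "\<dots> \<le> ennreal (2 * c * (C * N * measure lebesgue (E j))) + ennreal (measure lebesgue (E j))"
        unfolding mE by (intro add_mono order_refl variation_weighted_L1[OF d E(1) ES D CN _ _ c]) auto
      also have "\<dots> = ennreal ((2 * c * (C * N) + 1) * measure lebesgue (E j))"
        using mult_nonneg_nonneg[OF c(1) CN[of j]] by (subst ennreal_plus[symmetric]) (auto simp: algebra_simps)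
      finally show ?thesis .
    qed
    have ui: "integrable lebesgue (u j)" for j
      using le_less_trans[OF uint[of j]] u0[of j] by (intro integrableI_nonneg) auto
    have "(\<lambda>j. \<integral>s. norm (u j s) \<partial>lebesgue) \<longlonglongrightarrow> 0"
    proof (rule tendsto_sandwich[of "\<lambda>_. 0" _ _ "\<lambda>j. (2 * c * (C * N) + 1) * (1 / real (Suc j))"])
      show "\<forall>\<^sub>F j in sequentially. (\<integral>s. norm (u j s) \<partial>lebesgue) \<le> (2 * c * (C * N) + 1) * (1 / real (Suc j))"
      proof (intro always_eventually allI)
        fix j
        have "(\<integral>s. norm (u j s) \<partial>lebesgue) = enn2real (\<integral>\<^sup>+s. ennreal (u j s) \<partial>lebesgue)"
          using u0 by (subst integral_eq_nn_integral) auto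
        also have "\<dots> \<le> (2 * c * (C * N) + 1) * measure lebesgue (E j)"
          using c(1) C N by (intro enn2real_leI uint mult_nonneg_nonneg) auto
        also have "\<dots> \<le> (2 * c * (C * N) + 1) * (1 / real (Suc j))"
          using c(1) C N by (intro mult_left_mono mE_le) auto
        finally show "(\<integral>s. norm (u j s) \<partial>lebesgue) \<le> (2 * c * (C * N) + 1) * (1 / real (Suc j))" .
      qed
      show "(\<lambda>j. (2 * c * (C * N) + 1) * (1 / real (Suc j))) \<longlonglongrightarrow> 0"
        by (intro tendsto_mult_right_zero LIMSEQ_Suc[OF lim_1_over_n])
    qed auto
    from tendsto_L1_AE_subseq[OF ui this] obtain m :: "nat \<Rightarrow> nat"
      where m: "AE s in lebesgue. (\<lambda>j. u (m j) s) \<longlonglongrightarrow> 0" by blast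
    \<comment> \<open>These constants yield \<open>2 * \<epsilon> * (C * N) < 1 / N\<close>, that
      is, a remainder strictly below the gap; the added 1 covers \<open>C * N = 0\<close>.\<close>
    define a where "a = 1 / (2 * (C * N + 1))"
    define \<epsilon> where "\<epsilon> = a / N / 2"
    have CN0: "0 \<le> C * N" using C N by simp
    then have a: "0 < a" by (simp add: a_def)
    then have \<epsilon>: "0 < \<epsilon>" using N by (simp add: \<epsilon>_def)
    have "a * (C * N) < 1" using CN0 by (simp add: a_def divide_less_eq_1_pos)
    then have "a * (C * N) / N < 1 / N" using N by (rule divide_strict_right_mono)
    moreover have "2 * \<epsilon> * (C * N) = a * (C * N) / N" by (simp only: \<epsilon>_def) simp
    ultimately have small: "2 * \<epsilon> * (C * N) < 1 / N" by simp
    have "\<forall>\<^sub>F j in sequentially. \<forall>\<tau>. (\<integral>\<^sup>+s. ennreal (kern (s - \<tau>) * ratio (E (m j)) (d (m j)) s) \<partial>lebesgue) \<le> ennreal \<epsilon>"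
      by (intro kern_uniformly_small ratio_r_tendsto_0 ratio_measurable(3) ratio_nonneg d E(1) ES \<epsilon> m[unfolded u_def])
    then obtain j0 where \<tau>_bound: "\<And>\<tau>. (\<integral>\<^sup>+s. ennreal (kern (s - \<tau>) * ratio (E (m j0)) (d (m j0)) s) \<partial>lebesgue) \<le> ennreal \<epsilon>"
      by (auto simp: eventually_sequentially)
    define j where "j = m j0"
    let ?R = "\<lambda>s. ratio (E j) (d j) s * (norm (d j s) + norm (d j (s - h)))"
    note [measurable] = dm[of j] shift_measurable_lebesgue(2)[OF dm, of j h] E(1)[of j] ratio_measurable(3)[OF d E(1) ES, of j]
    have Rint: "(\<integral>\<^sup>+s. ennreal (?R s) \<partial>lebesgue) \<le> ennreal (2 * \<epsilon> * (C * N * measure lebesgue (E j)))"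
      by (rule variation_weighted_L1[OF d E(1) ES D CN ratio_measurable(3)[OF d E(1) ES]])
        (use ratio_nonneg \<epsilon> \<tau>_bound in \<open>auto simp: j_def\<close>)
    have R0: "0 \<le> ?R s" for s using ratio_nonneg by simp
    have Ri: "integrable lebesgue ?R"
      using le_less_trans[OF Rint] R0 by (intro integrableI_nonneg) auto
    have "(\<integral>s. ?R s \<partial>lebesgue) \<le> 2 * \<epsilon> * (C * N * measure lebesgue (E j))"
      using R0 \<epsilon> CN[of j] by (subst integral_eq_nn_integral) (auto intro!: enn2real_leI Rint)
    also have "\<dots> = 2 * \<epsilon> * (C * N) * measure lebesgue (E j)" by simp
    also have "\<dots> < 1 / N * measure lebesgue (E j)"
      by (intro mult_strict_right_mono small mE_pos)
    finally have Rlt: "(\<integral>s. ?R s \<partial>lebesgue) < 1 / N * measure lebesgue (E j)" .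
    let ?H = "\<lambda>s. indicator (E j) s * (\<gamma>v s 0 0 - \<psi> s \<bullet> \<phi>v s 0 0) + (Rg (E j) (d j) s - \<psi> s \<bullet> Rf (E j) (d j) s)"
    have iE: "integrable lebesgue (indicator (E j) :: real \<Rightarrow> real)"
      by (intro integrable_real_indicator E(1) finite_emeasure_subset[OF ES])
    have "0 \<le> (\<integral>s. spike (E j) \<gamma> \<gamma>v s (d j s) (d j (s - h)) \<partial>lebesgue)"
      by (rule minimal[OF E(1) ES d])
    also have "\<dots> = (\<integral>s. ?H s \<partial>lebesgue)"
      by (rule variation_first_order(2)[OF d E(1) ES EN])
    also have "\<dots> \<le> (\<integral>s. - (1 / N) * indicator (E j) s + ?R s \<partial>lebesgue)"
    proof (rule integral_mono)
      show "integrable lebesgue ?H" by (rule variation_first_order(1)[OF d E(1) ES EN])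
      show "integrable lebesgue (\<lambda>s. - (1 / N) * indicator (E j) s + ?R s)" using iE Ri by simp
      fix s
      have "indicator (E j) s * (\<gamma>v s 0 0 - \<psi> s \<bullet> \<phi>v s 0 0) \<le> - (1 / N) * indicator (E j) s"
        using EQ[of s j] by (auto simp: Q_def indicator_def)
      moreover have "Rg (E j) (d j) s - \<psi> s \<bullet> Rf (E j) (d j) s \<le> ?R s"
      proof -
        have "\<bar>\<psi> s \<bullet> Rf (E j) (d j) s\<bar> \<le> \<Psi> * norm (Rf (E j) (d j) s)"
          by (rule order_trans[OF Cauchy_Schwarz_ineq2]) (intro mult_right_mono \<psi>_bound norm_ge_zero)
        then show ?thesis unfolding ratio_mult by linarith
      qed
      ultimately show "?H s \<le> - (1 / N) * indicator (E j) s + ?R s" by (rule add_mono)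
    qed
    also have "\<dots> = - (1 / N) * measure lebesgue (E j) + (\<integral>s. ?R s \<partial>lebesgue)"
      using iE Ri by simp
    finally show False using Rlt by simp
  qed
  have "(\<Union>n. Bad n) \<in> null_sets lebesgue" using null by (intro null_sets_UN) auto
  then have "AE s in lebesgue. s \<notin> (\<Union>n. Bad n)" by (rule AE_not_in)
  moreover have good: "0 \<le> Q s" if s: "s \<notin> (\<Union>n. Bad n)" "s \<in> {0..T}" for s
  proof (rule ccontr)
    assume neg: "\<not> 0 \<le> Q s"
    obtain n1 where n1: "inverse (real (Suc n1)) < - Q s" using neg reals_Archimedean[of "- Q s"] by auto
    obtain n2 where n2: "norm (\<phi>v s 0 0) \<le> real n2" using real_arch_simple by blast
    have "inverse (real (Suc (max n1 n2))) \<le> inverse (real (Suc n1))" by (intro le_imp_inverse_le) auto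
    then have "s \<in> Bad (max n1 n2)"
      using n1 n2 s(2) unfolding Bad_def by (auto simp: inverse_eq_divide)
    then show False using s(1) by blast
  qed
  moreover have zero: "Q s = 0" if "s \<notin> {0..T}" for s
    using \<phi>v_supp[OF that] \<gamma>v_supp[OF that] by (simp add: Q_def)
  ultimately have "AE s in lebesgue. 0 \<le> Q s"
    by (elim eventually_mono) (metis good zero order_refl)
  then show ?thesis by (simp add: Q_def)
qed

end

subsection \<open>Derivatives and the Caputo equations\<close>

lemma separable_space_second_countable:
  "separable_space (euclidean :: 'a::{second_countable_topology, metric_space} topology)"
proof -
  obtain D :: "'a set" where D: "countable D" "\<And>X. open X \<Longrightarrow> X \<noteq> {} \<Longrightarrow> \<exists>d\<in>D. d \<in> X"
    using countable_dense_exists by blast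
  have "x \<in> closure D" for x
    unfolding closure_approachable
    using D(2)[of "ball x e" for e] by (force simp: dist_commute)
  then have "closure D = UNIV" by blast
  with D(1) show ?thesis unfolding separable_space_def by auto
qed

text \<open>The control is inserted with both states frozen, and the pair of states afterwards.
  Separability of the control space and of the state space are thus used one after the other, and
  measurability of the combined triple is never invoked.\<close>

lemma borel_measurable_Caratheodory3:
  fixes F :: "real \<Rightarrow> 'a::euclidean_space \<Rightarrow> 'a \<Rightarrow> 'u::metric_space \<Rightarrow> 'b::metric_space"
  assumes sep: "separable_space (euclidean :: 'u topology)"
    and F: "\<And>y z u. (\<lambda>t. F t y z u) \<in> borel_measurable M"
    and cont: "\<And>t. t \<in> space M \<Longrightarrow> continuous_on UNIV (\<lambda>(y, z, u). F t y z u)"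
    and x: "x \<in> borel_measurable M" and z: "z \<in> borel_measurable M" and u: "u \<in> borel_measurable M"
  shows "(\<lambda>t. F t (x t) (z t) (u t)) \<in> borel_measurable M"
proof -
  have Fu: "(\<lambda>t. F t y w (u t)) \<in> borel_measurable M" for y w
  proof (rule borel_measurable_Caratheodory[OF sep F _ u])
    show "continuous_on UNIV (F t y w)" if "t \<in> space M" for t
      using continuous_on_compose2[OF cont[OF that], of UNIV "\<lambda>u. (y, w, u)"]
      by (simp add: continuous_on_Pair)
  qed
  have "(\<lambda>t. (\<lambda>(y, w). F t y w (u t)) (x t, z t)) \<in> borel_measurable M"
  proof (rule borel_measurable_Caratheodory[OF separable_space_second_countable])
    show "(\<lambda>t. (\<lambda>(y, w). F t y w (u t)) yw) \<in> borel_measurable M" for yw :: "'a \<times> 'a"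
      using Fu by (cases yw) simp
    show "continuous_on UNIV (\<lambda>(y, w). F t y w (u t))" if "t \<in> space M" for t
    proof -
      have "continuous_on UNIV (\<lambda>yw :: 'a \<times> 'a. (fst yw, snd yw, u t))"
        by (intro continuous_intros)
      from continuous_on_compose2[OF cont[OF that] this] show ?thesis
        by (simp add: split_beta)
    qed
    show "(\<lambda>t. (x t, z t)) \<in> borel_measurable M" using x z by measurable
  qed
  then show ?thesis by simp
qed

text \<open>The derivative is tested on a multiple of \<open>a\<close> so short that the first-order
  remainder is at most \<open>e'\<close> times its norm; by linearity the scale cancels.\<close>

lemma has_derivative_bound_Lipschitz:
  assumes F: "(F has_derivative D) (at x)" and L: "\<And>y. norm (F y - F x) \<le> L * norm (y - x)"
  shows "norm (D a) \<le> L * norm a"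
proof (rule field_le_epsilon)
  fix e :: real assume e: "0 < e"
  define e' where "e' = e / (1 + norm a)"
  have n: "0 < 1 + norm a" by (simp add: add_pos_nonneg)
  have e': "0 < e'" "e' * norm a \<le> e" using e n by (simp_all add: e'_def divide_simps)
  obtain \<delta> where \<delta>: "0 < \<delta>" "\<And>y. norm (y - x) < \<delta> \<Longrightarrow> norm (F y - F x - D (y - x)) \<le> e' * norm (y - x)"
    using F e'(1) unfolding has_derivative_at_alt by blast
  interpret D: bounded_linear D using F by (rule has_derivative_bounded_linear)
  define t where "t = \<delta> / (2 * (1 + norm a))"
  have t: "0 < t" using \<delta>(1) n by (simp add: t_def)
  have "norm (t *\<^sub>R a) < \<delta>"
  proof -
    have "norm (t *\<^sub>R a) = t * norm a" using t by simp
    also have "\<dots> \<le> t * (1 + norm a)" using t by (intro mult_left_mono) auto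
    also have "\<dots> = \<delta> / 2" unfolding t_def using n by (simp add: divide_simps)
    finally show ?thesis using \<delta>(1) by simp
  qed
  then have "norm (F (x + t *\<^sub>R a) - F x - D (t *\<^sub>R a)) \<le> e' * norm (t *\<^sub>R a)"
    using \<delta>(2)[of "x + t *\<^sub>R a"] by simp
  moreover have "norm (F (x + t *\<^sub>R a) - F x) \<le> L * norm (t *\<^sub>R a)"
    using L[of "x + t *\<^sub>R a"] by simp
  moreover have "norm (D (t *\<^sub>R a)) \<le> norm (F (x + t *\<^sub>R a) - F x) + norm (F (x + t *\<^sub>R a) - F x - D (t *\<^sub>R a))"
    by (metis add.commute diff_add_cancel norm_minus_commute norm_triangle_sub)
  ultimately have "norm (D (t *\<^sub>R a)) \<le> (L + e') * norm (t *\<^sub>R a)" by (simp add: algebra_simps)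
  then have "t * norm (D a) \<le> t * ((L + e') * norm a)" using t by (simp add: D.scaleR mult_ac)
  then have "norm (D a) \<le> (L + e') * norm a" using t by (simp add: mult_le_cancel_left_pos)
  then show "norm (D a) \<le> L * norm a + e" using e'(2) by (simp add: algebra_simps)
qed

lemma has_derivative_partials:
  assumes F: "((\<lambda>(y, z). F y z) has_derivative D) (at (y, z))"
  shows "((\<lambda>x. F x z) has_derivative (\<lambda>a. D (a, 0))) (at y)"
    and "((\<lambda>x. F y x) has_derivative (\<lambda>b. D (0, b))) (at z)"
proof -
  have "((\<lambda>x. (x, z)) has_derivative (\<lambda>a. (a, 0))) (at y)"
    by (rule has_derivative_Pair) (auto intro: derivative_intros)
  from has_derivative_compose[OF this F] show "((\<lambda>x. F x z) has_derivative (\<lambda>a. D (a, 0))) (at y)" by simp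
  have "((\<lambda>x. (y, x)) has_derivative (\<lambda>b. (0, b))) (at z)"
    by (rule has_derivative_Pair) (auto intro: derivative_intros)
  from has_derivative_compose[OF this F] show "((\<lambda>x. F y x) has_derivative (\<lambda>b. D (0, b))) (at z)" by simp
qed

lemma has_derivative_grad:
  fixes F :: "real^'n \<Rightarrow> real"
  assumes F: "(F has_derivative D) (at x)"
  shows "D a = grad F x \<bullet> a"
proof -
  have D: "frechet_derivative F (at x) = D" using F by (metis frechet_derivative_at)
  interpret D: bounded_linear D using F by (rule has_derivative_bounded_linear)
  have "D a = D (\<Sum>i\<in>UNIV. a $ i *s axis i 1)" by (simp add: basis_expansion)
  also have "\<dots> = (\<Sum>i\<in>UNIV. a $ i * D (axis i 1))"
    by (simp add: D.sum scalar_mult_eq_scaleR D.scaleR)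
  also have "\<dots> = grad F x \<bullet> a" by (simp add: grad_def D inner_vec_def mult.commute)
  finally show ?thesis .
qed

lemma has_derivative_jacobian:
  fixes F :: "real^'n \<Rightarrow> real^'m"
  assumes F: "(F has_derivative D) (at x)"
  shows "D a = jacobian F (at x) *v a"
proof -
  have "(F has_derivative (\<lambda>h. jacobian F (at x) *v h)) (at x)"
    using F jacobian_works differentiableI by blast
  then have "D = (\<lambda>h. jacobian F (at x) *v h)" using F has_derivative_unique by blast
  then show ?thesis by simp
qed

lemma continuously_differentiable_jacobian:
  fixes F :: "real^'n \<Rightarrow> real^'n \<Rightarrow> real^'m"
  assumes "continuously_differentiable (\<lambda>(y, z). F y z)"
  shows "((\<lambda>(y, z). F y z) has_derivative
    (\<lambda>(a, b). jacobian (\<lambda>x. F x z) (at y) *v a + jacobian (\<lambda>x. F y x) (at z) *v b)) (at (y, z))"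
proof -
  obtain D where D: "((\<lambda>(y, z). F y z) has_derivative D) (at (y, z))"
    using assms unfolding continuously_differentiable_def by blast
  interpret D: bounded_linear D using D by (rule has_derivative_bounded_linear)
  have "D (a, b) = jacobian (\<lambda>x. F x z) (at y) *v a + jacobian (\<lambda>x. F y x) (at z) *v b" for a b
    using D.add[of "(a, 0)" "(0, b)"] has_derivative_jacobian[OF has_derivative_partials(1)[OF D], of a]
      has_derivative_jacobian[OF has_derivative_partials(2)[OF D], of b] by simp
  then have "D = (\<lambda>(a, b). jacobian (\<lambda>x. F x z) (at y) *v a + jacobian (\<lambda>x. F y x) (at z) *v b)" by auto
  with D show ?thesis by simp
qed

lemma continuously_differentiable_grad:
  fixes F :: "real^'n \<Rightarrow> real^'n \<Rightarrow> real"
  assumes "continuously_differentiable (\<lambda>(y, z). F y z)"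
  shows "((\<lambda>(y, z). F y z) has_derivative
    (\<lambda>(a, b). grad (\<lambda>x. F x z) y \<bullet> a + grad (\<lambda>x. F y x) z \<bullet> b)) (at (y, z))"
proof -
  obtain D where D: "((\<lambda>(y, z). F y z) has_derivative D) (at (y, z))"
    using assms unfolding continuously_differentiable_def by blast
  interpret D: bounded_linear D using D by (rule has_derivative_bounded_linear)
  have "D (a, b) = grad (\<lambda>x. F x z) y \<bullet> a + grad (\<lambda>x. F y x) z \<bullet> b" for a b
    using D.add[of "(a, 0)" "(0, b)"] has_derivative_grad[OF has_derivative_partials(1)[OF D], of a]
      has_derivative_grad[OF has_derivative_partials(2)[OF D], of b] by simp
  then have "D = (\<lambda>(a, b). grad (\<lambda>x. F x z) y \<bullet> a + grad (\<lambda>x. F y x) z \<bullet> b)" by auto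
  with D show ?thesis by simp
qed

text \<open>One argument is moved at a time, so that each partial gradient bound enters its own mean
  value inequality.\<close>

lemma grad_bound_Lipschitz:
  fixes F :: "real^'n \<Rightarrow> real^'n \<Rightarrow> real"
  assumes F: "continuously_differentiable (\<lambda>(y, z). F y z)"
    and b: "\<And>y z. norm (grad (\<lambda>x. F x z) y) \<le> L" "\<And>y z. norm (grad (\<lambda>x. F y x) z) \<le> L"
  shows "\<bar>F y z - F y' z'\<bar> \<le> L * (norm (y - y') + norm (z - z'))"
proof -
  note D = continuously_differentiable_grad[OF F]
  have "norm (F y z - F y' z) \<le> L * norm (y - y')"
  proof (rule differentiable_bound[of UNIV])
    show "((\<lambda>x. F x z) has_derivative (\<lambda>a. grad (\<lambda>x. F x z) x \<bullet> a)) (at x)" for x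
      using has_derivative_partials(1)[OF D] by simp
    show "onorm (\<lambda>a. grad (\<lambda>x. F x z) x \<bullet> a) \<le> L" for x
      using b(1)[of z x]
      by (intro onorm_le) (auto intro!: order_trans[OF Cauchy_Schwarz_ineq2] mult_right_mono)
  qed auto
  moreover have "norm (F y' z - F y' z') \<le> L * norm (z - z')"
  proof (rule differentiable_bound[of UNIV])
    show "((\<lambda>x. F y' x) has_derivative (\<lambda>a. grad (\<lambda>x. F y' x) x \<bullet> a)) (at x)" for x
      using has_derivative_partials(2)[OF D] by simp
    show "onorm (\<lambda>a. grad (\<lambda>x. F y' x) x \<bullet> a) \<le> L" for x
      using b(2)[of y' x]
      by (intro onorm_le) (auto intro!: order_trans[OF Cauchy_Schwarz_ineq2] mult_right_mono)
  qed auto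
  ultimately show ?thesis by (simp add: distrib_left)
qed

text \<open>The derivative along \<open>x s\<close> is a pointwise limit of difference quotients
  with step \<open>1 / real (Suc n)\<close>, which inherit measurability from \<open>F\<close>. In
  this way measurability in time of the Jacobians and gradients follows from that of
  \<open>f\<close> and \<open>g\<close>.\<close>

lemma has_derivative_measurable:
  fixes F :: "'t \<Rightarrow> 'a::euclidean_space \<Rightarrow> 'b::euclidean_space"
  assumes F: "\<And>x. x \<in> borel_measurable M \<Longrightarrow> (\<lambda>s. F s (x s)) \<in> borel_measurable M"
    and D: "\<And>s. s \<in> space M \<Longrightarrow> (F s has_derivative D s) (at 0)"
    and x [measurable]: "x \<in> borel_measurable M"
  shows "(\<lambda>s. D s (x s)) \<in> borel_measurable M"
proof (rule borel_measurable_LIMSEQ_metric)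
  fix n
  have [measurable]: "(\<lambda>s. F s ((1 / real (Suc n)) *\<^sub>R x s)) \<in> borel_measurable M" "(\<lambda>s. F s 0) \<in> borel_measurable M"
    by (rule F; measurable)+
  show "(\<lambda>s. real (Suc n) *\<^sub>R (F s ((1 / real (Suc n)) *\<^sub>R x s) - F s 0)) \<in> borel_measurable M"
    by measurable
next
  fix s assume "s \<in> space M"
  from D[OF this] have D: "(F s has_derivative D s) (at 0)" .
  then interpret D: bounded_linear "D s" by (rule has_derivative_bounded_linear)
  have "((\<lambda>t. t *\<^sub>R x s) has_derivative (\<lambda>t. t *\<^sub>R x s)) (at (0::real))"
    by (auto intro!: derivative_eq_intros)
  moreover have "(F s has_derivative D s) (at (0 *\<^sub>R x s))" using D by simp
  ultimately have "((\<lambda>t. F s (t *\<^sub>R x s)) has_derivative (\<lambda>t. D s (t *\<^sub>R x s))) (at 0)"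
    by (rule has_derivative_compose)
  then have "((\<lambda>t. F s (t *\<^sub>R x s)) has_vector_derivative D s (x s)) (at 0)"
    by (simp add: has_vector_derivative_def D.scaleR)
  then have lim: "((\<lambda>t. norm ((F s (t *\<^sub>R x s) - F s 0 - t *\<^sub>R D s (x s)) /\<^sub>R \<bar>t\<bar>)) \<longlongrightarrow> 0) (at 0)"
    by (intro tendsto_norm_zero) (simp add: has_vector_derivative_def has_derivative_at_within)
  \<comment> \<open>The derivative is defined with division by \<open>\<bar>t\<bar>\<close>; under
    the norm the sign is irrelevant, which leaves a difference quotient.\<close>
  have eq: "norm ((F s (t *\<^sub>R x s) - F s 0 - t *\<^sub>R D s (x s)) /\<^sub>R \<bar>t\<bar>) =
      norm ((F s (t *\<^sub>R x s) - F s 0) /\<^sub>R t - D s (x s))" if "t \<noteq> 0" for t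
  proof -
    have "(F s (t *\<^sub>R x s) - F s 0) /\<^sub>R t - D s (x s) = (F s (t *\<^sub>R x s) - F s 0 - t *\<^sub>R D s (x s)) /\<^sub>R t"
      using that by (simp add: scaleR_diff_right)
    then show ?thesis by simp
  qed
  have "((\<lambda>t. norm ((F s (t *\<^sub>R x s) - F s 0) /\<^sub>R t - D s (x s))) \<longlongrightarrow> 0) (at 0)"
    by (rule Lim_transform_eventually[OF lim]) (use eq in \<open>simp add: eventually_at_filter\<close>)
  then have "((\<lambda>t. (F s (t *\<^sub>R x s) - F s 0) /\<^sub>R t) \<longlongrightarrow> D s (x s)) (at 0)"
    by (rule LIM_zero_cancel[OF tendsto_norm_zero_cancel])
  moreover have "filterlim (\<lambda>n. 1 / real (Suc n)) (at 0) sequentially"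
    by (rule filterlim_atI[OF LIMSEQ_Suc[OF lim_1_over_n]]) simp
  ultimately have "(\<lambda>n. (F s ((1 / real (Suc n)) *\<^sub>R x s) - F s 0) /\<^sub>R (1 / real (Suc n))) \<longlonglongrightarrow> D s (x s)"
    by (rule filterlim_compose)
  then show "(\<lambda>n. real (Suc n) *\<^sub>R (F s ((1 / real (Suc n)) *\<^sub>R x s) - F s 0)) \<longlonglongrightarrow> D s (x s)"
    by simp
qed

text \<open>Each coordinate of the transposed image is the inner product of \<open>x\<close> with
  the image of a fixed basis vector.\<close>

lemma borel_measurable_adjoint:
  fixes D Dt :: "'t \<Rightarrow> 'a::euclidean_space \<Rightarrow> 'a"
  assumes D: "\<And>x. x \<in> borel_measurable M \<Longrightarrow> (\<lambda>s. D s (x s)) \<in> borel_measurable M"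
    and Dt: "\<And>s x a. Dt s x \<bullet> a = x \<bullet> D s a" and x [measurable]: "x \<in> borel_measurable M"
  shows "(\<lambda>s. Dt s (x s)) \<in> borel_measurable M"
proof (subst borel_measurable_euclidean_space, intro ballI)
  fix i :: 'a
  have [measurable]: "(\<lambda>s. D s i) \<in> borel_measurable M" by (rule D) measurable
  show "(\<lambda>s. Dt s (x s) \<bullet> i) \<in> borel_measurable M" unfolding Dt by measurable
qed

lemma borel_measurable_representer:
  fixes p :: "'t \<Rightarrow> 'a::euclidean_space"
  assumes "\<And>x. x \<in> borel_measurable M \<Longrightarrow> (\<lambda>s. p s \<bullet> x s) \<in> borel_measurable M"
  shows "p \<in> borel_measurable M"
  by (subst borel_measurable_euclidean_space) (auto intro: assms)

section \<open>Caputo equations as kernel equations on the line\<close>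

context fractional_kernel
begin

text \<open>The identity is pointwise even at \<open>s = t\<close>: there \<open>kern 0 = 0\<close>,
  and on the right \<open>0 powr (\<alpha> - 1) = 0\<close>.\<close>

lemma kern_left:
  fixes F :: "real \<Rightarrow> 'a::real_vector"
  assumes "t \<in> {0..T}"
  shows "kern (t - s) *\<^sub>R (indicator {0..T} s *\<^sub>R F s) =
    (1 / Gamma \<alpha>) *\<^sub>R (indicator {0..t} s *\<^sub>R ((t - s) powr (\<alpha> - 1) *\<^sub>R F s))"
  using assms by (cases "0 \<le> s \<and> s < t") (auto simp: kern_def indicator_def)

lemma kern_right:
  fixes F :: "real \<Rightarrow> 'a::real_vector"
  assumes "t \<in> {0..T}"
  shows "kern (s - t) *\<^sub>R (indicator {0..T} s *\<^sub>R F s) =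
    (1 / Gamma \<alpha>) *\<^sub>R (indicator {t..T} s *\<^sub>R ((s - t) powr (\<alpha> - 1) *\<^sub>R F s))"
  using assms by (cases "t < s \<and> s \<le> T") (auto simp: kern_def indicator_def)

lemma Gamma_pos: "0 < Gamma \<alpha>"
  using Gamma_real_pos \<alpha> by blast

lemma integrable_Gamma_iff:
  fixes F :: "real \<Rightarrow> 'a::euclidean_space"
  shows "integrable M (\<lambda>s. (1 / Gamma \<alpha>) *\<^sub>R F s) \<longleftrightarrow> integrable M F"
proof
  assume "integrable M (\<lambda>s. (1 / Gamma \<alpha>) *\<^sub>R F s)"
  from integrable_scaleR_right[OF this, of "Gamma \<alpha>"] show "integrable M F" using Gamma_pos by simp
qed simp

lemma left_Caputo_solution_iff:
  "left_Caputo_solution \<alpha> T F y \<longleftrightarrow> (\<forall>t\<in>{0..T}.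
     integrable lebesgue (\<lambda>s. kern (t - s) *\<^sub>R (indicator {0..T} s *\<^sub>R F s)) \<and>
     y t = (\<integral>s. kern (t - s) *\<^sub>R (indicator {0..T} s *\<^sub>R F s) \<partial>lebesgue))"
  unfolding left_Caputo_solution_def set_integrable_def set_lebesgue_integral_def
  by (intro ball_cong refl) (simp only: kern_left integral_scaleR_right integrable_Gamma_iff)

lemma right_Caputo_solution_iff:
  "right_Caputo_solution \<alpha> T F y \<longleftrightarrow> (\<forall>t\<in>{0..T}.
     integrable lebesgue (\<lambda>s. kern (s - t) *\<^sub>R (indicator {0..T} s *\<^sub>R F s)) \<and>
     y t = (\<integral>s. kern (s - t) *\<^sub>R (indicator {0..T} s *\<^sub>R F s) \<partial>lebesgue))"
  unfolding right_Caputo_solution_def set_integrable_def set_lebesgue_integral_def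
  by (intro ball_cong refl) (simp only: kern_right integral_scaleR_right integrable_Gamma_iff)

text \<open>Since the kernel is bounded below on $(0,T]$, existence of the integral at $t=T$ alone makes
  the right-hand side integrable.\<close>

lemma left_Caputo_solution_integrable:
  fixes F y :: "real \<Rightarrow> real^'n"
  assumes sol: "left_Caputo_solution \<alpha> T F y"
  shows "integrable lebesgue (\<lambda>s. indicator {0..T} s *\<^sub>R y s)"
proof -
  \<comment> \<open>The endpoint is removed because \<open>kern (T - s)\<close> vanishes at
    \<open>s = T\<close> and carries no information about \<open>F T\<close>.\<close>
  define F0 where "F0 s = indicator {0..<T} s *\<^sub>R F s" for s
  have eq: "kern (t - s) *\<^sub>R (indicator {0..T} s *\<^sub>R F s) = kern (t - s) *\<^sub>R F0 s" if "t \<in> {0..T}" for t s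
    using that by (cases "s = T") (auto simp: kern_def F0_def indicator_def)
  have i: "integrable lebesgue (\<lambda>s. kern (T - s) *\<^sub>R F0 s)"
    using sol T unfolding left_Caputo_solution_iff by (simp flip: eq)
  have y: "y t = (\<integral>s. kern (t - s) *\<^sub>R F0 s \<partial>lebesgue)" if "t \<in> {0..T}" for t
    using sol that unfolding left_Caputo_solution_iff by (simp flip: eq)
  \<comment> \<open>\<open>1 / c\<close> is the minimum of the kernel over distances in (0,T],
    attained at distance \<open>T\<close>.\<close>
  define c where "c = Gamma \<alpha> / T powr (\<alpha> - 1)"
  \<comment> \<open>Dividing the integrand at time \<open>T\<close> by the kernel recovers
    \<open>F0\<close> and its measurability; the lower bound of the kernel yields
    integrability.\<close>
  have F0k: "F0 s = (if s \<in> {0..<T} then 1 / kern (T - s) else 0) *\<^sub>R (kern (T - s) *\<^sub>R F0 s)"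
    and F0le: "norm (F0 s) \<le> norm (c *\<^sub>R (kern (T - s) *\<^sub>R F0 s))" for s
  proof -
    have "s \<notin> {0..<T} \<Longrightarrow> F0 s = 0" by (simp add: F0_def)
    moreover have "kern (T - s) > 0" "1 \<le> c * kern (T - s)" "0 < c" if "s \<in> {0..<T}"
    proof -
      show k: "kern (T - s) > 0" and c: "0 < c"
        using that Gamma_pos T by (auto simp: kern_def c_def)
      have "T powr (\<alpha> - 1) \<le> (T - s) powr (\<alpha> - 1)" using that \<alpha> by (intro powr_mono2') auto
      then show "1 \<le> c * kern (T - s)" using that Gamma_pos T
        by (auto simp: kern_def c_def divide_simps)
    qed
    ultimately show "F0 s = (if s \<in> {0..<T} then 1 / kern (T - s) else 0) *\<^sub>R (kern (T - s) *\<^sub>R F0 s)"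
      and "norm (F0 s) \<le> norm (c *\<^sub>R (kern (T - s) *\<^sub>R F0 s))"
      by (cases "s \<in> {0..<T}"; force simp: abs_mult mult_le_cancel_right1 mult.assoc[symmetric])+
  qed
  have F0m [measurable]: "F0 \<in> borel_measurable lebesgue"
  proof -
    note [measurable] = borel_measurable_integrable[OF i]
    show ?thesis by (subst fun_eq_iff[THEN iffD2, OF allI, OF F0k]) measurable
  qed
  have F0i: "integrable lebesgue F0"
    by (rule Bochner_Integration.integrable_bound[OF integrable_scaleR_right[OF i, of c] F0m AE_I2[OF F0le]])
  let ?y = "\<lambda>s. indicator {0..T} s *\<^sub>R y s"
  have ym [measurable]: "?y \<in> borel_measurable lebesgue"
  proof -
    have "?y = (\<lambda>t. indicator {0..T} t *\<^sub>R (\<integral>s. kern (t - s) *\<^sub>R F0 s \<partial>lebesgue))"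
    proof
      show "?y t = indicator {0..T} t *\<^sub>R (\<integral>s. kern (t - s) *\<^sub>R F0 s \<partial>lebesgue)" for t
        by (cases "t \<in> {0..T}") (simp_all add: y)
    qed
    then show ?thesis by simp
  qed
  \<comment> \<open>With \<open>F0\<close> integrable, Tonelli reduces integrability of the state to
    the bounded kernel integrals of the indicator of \<open>{0..T}\<close>.\<close>
  obtain C where C: "0 \<le> C" "\<And>\<tau>. (\<integral>\<^sup>+s. ennreal (kern (s - \<tau>) * indicator {0..T} s) \<partial>lebesgue) \<le> ennreal C"
    by (rule r_integrable_kern_bounded[OF r_integrable_indicator[of "{0..T}"]]) (use T in auto)
  have "(\<integral>\<^sup>+s. ennreal (norm (?y s)) \<partial>lebesgue) = (\<integral>\<^sup>+s. indicator {0..T} s * ennreal (norm (?y (s - 0))) \<partial>lebesgue)"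
    by (intro nn_integral_cong) (auto simp: indicator_def)
  also have "\<dots> \<le> (\<integral>\<^sup>+\<tau>. ennreal (norm (F0 \<tau>)) * (\<integral>\<^sup>+s. ennreal (kern (s - (\<tau> + 0))) * indicator {0..T} s \<partial>lebesgue) \<partial>lebesgue)"
  proof (rule kern_convolution_le)
    fix s
    show "ennreal (norm (?y s)) \<le> (\<integral>\<^sup>+\<tau>. ennreal (kern (s - \<tau>)) * ennreal (norm (F0 \<tau>)) \<partial>lebesgue)"
    proof (cases "s \<in> {0..T}")
      case True
      then have "integrable lebesgue (\<lambda>\<tau>. kern (s - \<tau>) *\<^sub>R F0 \<tau>)"
        using sol unfolding left_Caputo_solution_iff by (simp flip: eq)
      from integral_norm_bound_ennreal[OF this] show ?thesis using True y by (simp add: ennreal_mult')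
    qed simp
  qed measurable
  also have "\<dots> \<le> (\<integral>\<^sup>+\<tau>. ennreal (norm (F0 \<tau>)) * ennreal C \<partial>lebesgue)"
  proof (intro nn_integral_mono mult_left_mono)
    show "(\<integral>\<^sup>+s. ennreal (kern (s - (\<tau> + 0))) * indicator {0..T} s \<partial>lebesgue) \<le> ennreal C" for \<tau>
      using C(2)[of \<tau>] by (simp add: ennreal_mult' ennreal_indicator)
  qed simp
  also have "\<dots> = (\<integral>\<^sup>+\<tau>. ennreal (norm (F0 \<tau>)) \<partial>lebesgue) * ennreal C"
    by (rule nn_integral_multc) measurable
  also have "\<dots> < \<infinity>" using F0i by (simp add: integrable_iff_bounded ennreal_mult_less_top)
  finally show ?thesis using ym by (intro integrableI_bounded) auto
qed

end

subsection \<open>The maximum principle\<close>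

text \<open>Coordinates centred at the reference pair: displaced states under the control
  \<open>w\<close> are compared with the undisturbed value under \<open>u\<close>. The choices
  \<open>w = u\<close> and \<open>w\<close> constant give the four functions of the abstract
  setting; the cut-off extends data given on \<open>{0..T}\<close> to the line.\<close>

definition increment :: "real \<Rightarrow> (real \<Rightarrow> 'a::ab_group_add \<Rightarrow> 'a \<Rightarrow> 'u \<Rightarrow> 'b::real_vector) \<Rightarrow>
    (real \<Rightarrow> 'a) \<Rightarrow> (real \<Rightarrow> 'a) \<Rightarrow> (real \<Rightarrow> 'u) \<Rightarrow> (real \<Rightarrow> 'u) \<Rightarrow> real \<Rightarrow> 'a \<Rightarrow> 'a \<Rightarrow> 'b" where
  "increment T F y yh u w s a b =
     indicator {0..T} s *\<^sub>R (F s (y s + a) (yh s + b) (w s) - F s (y s) (yh s) (u s))"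

lemma increment_outside: "s \<notin> {0..T} \<Longrightarrow> increment T F y yh u w s a b = 0"
  by (simp add: increment_def)

lemma increment_self: "increment T F y yh u u s 0 0 = 0"
  by (simp add: increment_def)

text \<open>Splicing increments over \<open>E\<close> amounts to splicing controls, which links the
  abstract variation to an actual competitor.\<close>

lemma spike_increment:
  "spike E (increment T F y yh u u) (increment T F y yh u v) =
    increment T F y yh u (\<lambda>s. if s \<in> E then v s else u s)"
  by (auto simp: spike_def increment_def fun_eq_iff)

lemma increment_Lipschitz:
  fixes F :: "real \<Rightarrow> 'a::real_normed_vector \<Rightarrow> 'a \<Rightarrow> 'u \<Rightarrow> 'b::real_normed_vector"
  assumes "\<And>s y y' z z' u. s \<in> {0..T} \<Longrightarrow> norm (F s y z u - F s y' z' u) \<le> K s * (norm (y - y') + norm (z - z'))"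
  shows "norm (increment T F y yh u w s a b - increment T F y yh u w s a' b') \<le>
    indicator {0..T} s * K s * (norm (a - a') + norm (b - b'))"
proof (cases "s \<in> {0..T}")
  case True
  then show ?thesis
    using assms[OF True, of "y s + a" "yh s + b" "w s" "y s + a'" "yh s + b'"]
    by (simp add: increment_def)
qed (simp add: increment_def)

lemma lebesgue_on_iff:
  fixes F :: "real \<Rightarrow> 'b::real_normed_vector"
  shows "F \<in> borel_measurable (lebesgue_on {a..b}) \<longleftrightarrow> (\<lambda>s. indicator {a..b} s *\<^sub>R F s) \<in> borel_measurable lebesgue"
  by (rule borel_measurable_restrict_space_iff) simp

lemma increment_measurable:
  fixes F :: "real \<Rightarrow> 'a::euclidean_space \<Rightarrow> 'a \<Rightarrow> 'u::metric_space \<Rightarrow> 'b::euclidean_space"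
  assumes sep: "separable_space (euclidean :: 'u topology)"
    and F: "\<And>y z u. (\<lambda>t. F t y z u) \<in> borel_measurable (lebesgue_on {0..T})"
    and cont: "\<And>t. t \<in> {0..T} \<Longrightarrow> continuous_on UNIV (\<lambda>(y, z, u). F t y z u)"
    and y: "y \<in> borel_measurable (lebesgue_on {0..T})" "yh \<in> borel_measurable (lebesgue_on {0..T})"
    and u: "u \<in> borel_measurable (lebesgue_on {0..T})" and w: "w \<in> borel_measurable (lebesgue_on {0..T})"
    and x: "x \<in> borel_measurable lebesgue" "z \<in> borel_measurable lebesgue"
  shows "(\<lambda>s. increment T F y yh u w s (x s) (z s)) \<in> borel_measurable lebesgue"
proof -
  note [measurable] = y measurable_restrict_space1[OF x(1)] measurable_restrict_space1[OF x(2)]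
  have [measurable]: "(\<lambda>s. F s (y s + x s) (yh s + z s) (w s)) \<in> borel_measurable (lebesgue_on {0..T})"
    by (rule borel_measurable_Caratheodory3[OF sep F _ _ _ w]) (simp add: cont, measurable)
  have [measurable]: "(\<lambda>s. F s (y s) (yh s) (u s)) \<in> borel_measurable (lebesgue_on {0..T})"
    by (rule borel_measurable_Caratheodory3[OF sep F _ _ _ u]) (simp add: cont, measurable)
  show ?thesis
    unfolding increment_def lebesgue_on_iff[symmetric] by measurable
qed

lemma increment_has_derivative:
  fixes F :: "real \<Rightarrow> 'a::real_normed_vector \<Rightarrow> 'a \<Rightarrow> 'u \<Rightarrow> 'b::real_normed_vector"
  assumes s: "s \<in> {0..T}" and F: "((\<lambda>(y, z). F s y z (u s)) has_derivative D) (at (y s, yh s))"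
  shows "((\<lambda>(a, b). increment T F y yh u u s a b) has_derivative D) (at (0, 0))"
proof -
  have "((\<lambda>q. (y s, yh s) + q) has_derivative (\<lambda>q. q)) (at (0, 0))"
    by (auto intro!: derivative_eq_intros)
  moreover have "((\<lambda>(y, z). F s y z (u s)) has_derivative D) (at ((y s, yh s) + (0, 0)))" using F by simp
  ultimately have "((\<lambda>q. (\<lambda>(y, z). F s y z (u s)) ((y s, yh s) + q)) has_derivative (\<lambda>q. D q)) (at (0, 0))"
    by (rule has_derivative_compose)
  from has_derivative_diff[OF this has_derivative_const[of "F s (y s) (yh s) (u s)"]]
  show ?thesis using s by (simp add: increment_def case_prod_unfold)
qed

theorem theorem3p1:
  fixes T h \<alpha> p K Lbar :: real
    and u0 :: "'u::metric_space"
    and f :: "real \<Rightarrow> real^'n \<Rightarrow> real^'n \<Rightarrow> 'u \<Rightarrow> real^'n"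
    and g :: "real \<Rightarrow> real^'n \<Rightarrow> real^'n \<Rightarrow> 'u \<Rightarrow> real"
    and L0 L \<omega> :: "real \<Rightarrow> real"
    and ystar :: "real \<Rightarrow> real^'n"
    and ustar :: "real \<Rightarrow> 'u"
  assumes "T > 0" and "h > 0" and "0 < \<alpha>" and "\<alpha> < 1" and "p > 1 / \<alpha>"
    and "separable_space (euclidean :: 'u topology)"
    and f_measurable: "\<And>y z u. (\<lambda>t. f t y z u) \<in> borel_measurable (lebesgue_on {0..T})"
    and f_C1: "\<And>t u. t \<in> {0..T} \<Longrightarrow> continuously_differentiable (\<lambda>(y, z). f t y z u)"
    and f_cont: "\<And>t. t \<in> {0..T} \<Longrightarrow> continuous_on UNIV (\<lambda>(y, z, u). f t y z u)"
    and fy_cont: "\<And>t. t \<in> {0..T} \<Longrightarrow> continuous_on UNIV (\<lambda>(y, z, u). Jac_y f t y z u)"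
    and fyh_cont: "\<And>t. t \<in> {0..T} \<Longrightarrow> continuous_on UNIV (\<lambda>(y, z, u). Jac_yh f t y z u)"
    and L0_nonneg: "\<And>t. t \<in> {0..T} \<Longrightarrow> L0 t \<ge> 0"
    and L_nonneg: "\<And>t. t \<in> {0..T} \<Longrightarrow> L t \<ge> 0"
    and L0_Lp: "Lp_plus (1 / \<alpha>) T L0"
    and L_Lp: "Lp_plus (p / (p * \<alpha> - 1)) T L"
    and K_pos: "K > 0"
    and modulus: "modulus_of_continuity \<omega>"
    and f_bound: "\<And>t. t \<in> {0..T} \<Longrightarrow> norm (f t 0 0 u0) \<le> L0 t"
    and f_Lipschitz: "\<And>t y y' z z' u u'. t \<in> {0..T} \<Longrightarrow>
       norm (f t y z u - f t y' z' u') \<le> L t * (norm (y - y') + norm (z - z') + dist u u')"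
    and f_time: "\<And>t t' y z u. t \<in> {0..T} \<Longrightarrow> t' \<in> {0..T} \<Longrightarrow>
       norm (f t y z u - f t' y z u) \<le> K * \<omega> \<bar>t - t'\<bar> * (1 + norm y + norm z)"
    and g_measurable: "\<And>y z u. (\<lambda>t. g t y z u) \<in> borel_measurable (lebesgue_on {0..T})"
    and g_C1: "\<And>t u. t \<in> {0..T} \<Longrightarrow> continuously_differentiable (\<lambda>(y, z). g t y z u)"
    and g_cont: "\<And>t. t \<in> {0..T} \<Longrightarrow>
       continuous_on UNIV (\<lambda>(y, z, u). (g t y z u, grad_y g t y z u, grad_yh g t y z u))"
    and Lbar_pos: "Lbar > 0"
    and g_bound: "\<And>t y z u. t \<in> {0..T} \<Longrightarrow>
       \<bar>g t 0 0 u\<bar> + norm (grad_y g t y z u) + norm (grad_yh g t y z u) \<le> Lbar"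
    and optimal: "optimal_pair \<alpha> p T h u0 f g ystar ustar"
  shows "\<exists>\<psi> :: real \<Rightarrow> real^'n.
    Lp (p / (p - 1)) T \<psi> \<and>
    right_Caputo_solution \<alpha> T (adjoint_rhs T h f g ystar ustar \<psi>) \<psi> \<and>
    (\<forall>t\<in>{T..T + h}. \<psi> t = 0) \<and>
    (AE t in lebesgue_on {0..T}.
      is_maximum
        (\<psi> t \<bullet> f t (ystar t) (ystar (t - h)) (ustar t) - g t (ystar t) (ystar (t - h)) (ustar t))
        (range (\<lambda>v. \<psi> t \<bullet> f t (ystar t) (ystar (t - h)) v - g t (ystar t) (ystar (t - h)) v)))"
proof -
  have p\<alpha>: "p * \<alpha> > 1" using assms(3,5) by (simp add: field_simps)
  have p1: "p > 1" using assms(3-5) by (smt (verit) less_divide_eq_1_pos)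
  \<comment> \<open>This exponent serves throughout; it exceeds \<open>1 / \<alpha>\<close> because
    \<open>p / (p * \<alpha> - 1)\<close> does.\<close>
  obtain r where r: "r > p / (p * \<alpha> - 1)" and Lr: "Lp r T L"
    using L_Lp unfolding Lp_plus_def by blast
  have "1 / \<alpha> < p / (p * \<alpha> - 1)" using p\<alpha> \<open>0 < \<alpha>\<close> by (simp add: divide_simps algebra_simps)
  with r have "1 / \<alpha> < r" by simp
  then interpret fractional_kernel \<alpha> T r
    using \<open>0 < \<alpha>\<close> \<open>\<alpha> < 1\<close> \<open>T > 0\<close> by unfold_locales
  have T0: "{0..T} \<inter> space lebesgue \<in> sets lebesgue" by simp

  \<comment> \<open>The Lipschitz weight in L^r\<close>
  define l where "l s = indicator {0..T} s * L s" for s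
  have l: "r_integrable l"
  proof -
    have L_meas: "(\<lambda>s. indicator {0<..<T} s *\<^sub>R L s) \<in> borel_measurable lebesgue"
      using Lr by (subst borel_measurable_restrict_space_iff[symmetric]) (auto simp: Lp_def)
    \<comment> \<open>Measurability of \<open>L\<close> is given on the open interval; the two
      endpoint values are added by hand.\<close>
    have l_eq: "l = (\<lambda>s. indicator {0<..<T} s *\<^sub>R L s + indicator {0} s * L 0 + indicator {T} s * L T)"
      using \<open>T > 0\<close> by (auto simp: l_def indicator_def fun_eq_iff)
    have lm [measurable]: "l \<in> borel_measurable lebesgue"
      unfolding l_eq using L_meas by measurable
    have "integrable lebesgue (\<lambda>s. indicator {0<..<T} s *\<^sub>R (norm (L s) powr r))"
      using Lr by (subst integrable_restrict_space[symmetric]) (auto simp: Lp_def)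
    then have fin: "(\<integral>\<^sup>+s. ennreal (norm (indicator {0<..<T} s *\<^sub>R (norm (L s) powr r))) \<partial>lebesgue) < \<infinity>"
      by (simp only: integrable_iff_bounded)
    have "AE s in lebesgue. s \<noteq> 0 \<and> s \<noteq> T"
      by (rule AE_I'[of "{0, T}"]) auto
    then have "AE s in lebesgue. ennreal (l s powr r) = ennreal (norm (indicator {0<..<T} s *\<^sub>R (norm (L s) powr r)))"
      by eventually_elim (auto simp: l_def indicator_def L_nonneg)
    from nn_integral_cong_AE[OF this] fin show ?thesis
      using L_nonneg lm by (auto simp: r_integrable_def l_def indicator_def)
  qed
  have l_supp: "l s = 0" if "s \<notin> {0..T}" for s using that by (simp add: l_def)

  \<comment> \<open>Integrability of the optimal state and of the running cost\<close>
  have um: "ustar \<in> borel_measurable (lebesgue_on {0..T})" and up: "Lp p T (\<lambda>t. dist (ustar t) u0)"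
    and state: "left_Caputo_solution \<alpha> T (\<lambda>s. f s (ystar s) (ystar (s - h)) (ustar s)) ystar"
    and y0: "\<And>t. t \<in> {-h..0} \<Longrightarrow> ystar t = 0"
    and inf: "ereal (cost T h g ustar ystar) =
       Inf {ereal (cost T h g v x) | v x. v \<in> controls p T u0 \<and> is_state \<alpha> T h f v x}"
    using optimal unfolding optimal_pair_def controls_def is_state_def by auto
  define yh where "yh s = ystar (s - h)" for s
  have yi: "integrable lebesgue (\<lambda>s. indicator {0..T} s *\<^sub>R ystar s)"
    by (rule left_Caputo_solution_integrable[OF state])
  have ym: "ystar \<in> borel_measurable (lebesgue_on {0..T})"
    unfolding lebesgue_on_iff by (rule borel_measurable_integrable[OF yi])
  \<comment> \<open>Before time \<open>h\<close> the delayed state is the zero history, so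
    \<open>yh\<close> is a translate of the cut-off state and inherits its integrability.\<close>
  have yh_eq: "indicator {0..T} s *\<^sub>R yh s = indicator {0..T} s *\<^sub>R (indicator {0..T} (s - h) *\<^sub>R ystar (s - h))" for s
  proof (cases "s \<in> {0..T} \<and> s < h")
    case True
    then show ?thesis using y0[of "s - h"] by (simp add: yh_def)
  next
    case False
    then show ?thesis using \<open>h > 0\<close> by (auto simp: yh_def indicator_def)
  qed
  have yhi: "integrable lebesgue (\<lambda>s. indicator {0..T} s *\<^sub>R yh s)"
  proof -
    have "integrable lebesgue (\<lambda>s. indicator {0..T} (s - h) *\<^sub>R ystar (s - h))"
      using lebesgue_integrable_real_affine[OF yi, of 1 "-h"] by simp
    from integrable_mult_indicator[OF _ this, of "{0..T}"] show ?thesis by (simp add: yh_eq)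
  qed
  have yhm: "yh \<in> borel_measurable (lebesgue_on {0..T})"
    unfolding lebesgue_on_iff by (rule borel_measurable_integrable[OF yhi])

  have g_cont': "continuous_on UNIV (\<lambda>(y, z, u). g t y z u)" if "t \<in> {0..T}" for t
    using continuous_on_fst[OF g_cont[OF that]] by (simp add: split_beta)
  have f_Lip: "norm (f s y z u - f s y' z' u) \<le> L s * (norm (y - y') + norm (z - z'))"
    if "s \<in> {0..T}" for s y y' z z' u
    using f_Lipschitz[OF that, of y z u y' z' u] by simp
  have gy: "norm (grad_y g s y z u) \<le> Lbar" "norm (grad_yh g s y z u) \<le> Lbar" "\<bar>g s 0 0 u\<bar> \<le> Lbar"
    if "s \<in> {0..T}" for s y z u
    using g_bound[OF that, where y=y and z=z and u=u]
      norm_ge_zero[of "grad_y g s y z u"] norm_ge_zero[of "grad_yh g s y z u"] by linarith+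
  have g_Lip: "norm (g s y z u - g s y' z' u) \<le> Lbar * (norm (y - y') + norm (z - z'))"
    if "s \<in> {0..T}" for s y y' z z' u
    using grad_bound_Lipschitz[OF g_C1[OF that], of u Lbar y z y' z'] gy(1,2)[OF that]
    by (simp add: grad_y_def grad_yh_def)
  \<comment> \<open>Bounded gradients give linear growth in the states, uniformly in the control
    value; so the cost along \<open>ystar\<close> is integrable for every measurable
    control.\<close>
  have g_growth: "norm (indicator {0..T} s *\<^sub>R g s (ystar s) (yh s) u) \<le>
      Lbar * indicator {0..T} s + Lbar * (norm (indicator {0..T} s *\<^sub>R ystar s) + norm (indicator {0..T} s *\<^sub>R yh s))" for s u
  proof (cases "s \<in> {0..T}")
    case True
    then show ?thesis using g_Lip[OF True, of "ystar s" "yh s" u 0 0] gy(3)[OF True, of u] by simp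
  qed simp
  have g_int: "integrable lebesgue (\<lambda>s. indicator {0..T} s *\<^sub>R g s (ystar s) (yh s) (w s))"
    if w: "w \<in> borel_measurable (lebesgue_on {0..T})" for w
  proof (rule Bochner_Integration.integrable_bound)
    show "integrable lebesgue (\<lambda>s. Lbar * indicator {0..T} s +
        Lbar * (norm (indicator {0..T} s *\<^sub>R ystar s) + norm (indicator {0..T} s *\<^sub>R yh s)))"
      using integrable_norm[OF yi] integrable_norm[OF yhi] \<open>T > 0\<close>
      by (intro Bochner_Integration.integrable_add integrable_mult_right integrable_real_indicator) auto
    show "(\<lambda>s. indicator {0..T} s *\<^sub>R g s (ystar s) (yh s) (w s)) \<in> borel_measurable lebesgue"
      unfolding lebesgue_on_iff[symmetric]
      by (rule borel_measurable_Caratheodory3[OF assms(6) g_measurable _ ym yhm w]) (simp add: g_cont')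
  qed (use g_growth in \<open>auto intro!: AE_I2 intro: order_trans[OF _ abs_ge_self]\<close>)

  \<comment> \<open>Linearization along the optimal pair\<close>
  define \<phi> where "\<phi> = increment T f ystar yh ustar ustar"
  define \<gamma> where "\<gamma> = increment T g ystar yh ustar ustar"
  define A where "A s a = indicator {0..T} s *\<^sub>R (Jac_y f s (ystar s) (yh s) (ustar s) *v a)" for s a
  define B where "B s a = indicator {0..T} s *\<^sub>R (Jac_yh f s (ystar s) (yh s) (ustar s) *v a)" for s a
  define At where "At s a = indicator {0..T} s *\<^sub>R (transpose (Jac_y f s (ystar s) (yh s) (ustar s)) *v a)" for s a
  define Bt where "Bt s a = indicator {0..T} s *\<^sub>R (transpose (Jac_yh f s (ystar s) (yh s) (ustar s)) *v a)" for s a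
  define \<pi> where "\<pi> s = indicator {0..T} s *\<^sub>R grad_y g s (ystar s) (yh s) (ustar s)" for s
  define k where "k s = indicator {0..T} s *\<^sub>R grad_yh g s (ystar s) (yh s) (ustar s)" for s

  have inc_f: "(\<lambda>s. increment T f ystar yh ustar w s (x s) (z s)) \<in> borel_measurable lebesgue"
    and inc_g: "(\<lambda>s. increment T g ystar yh ustar w s (x s) (z s)) \<in> borel_measurable lebesgue"
    if "w \<in> borel_measurable (lebesgue_on {0..T})" "x \<in> borel_measurable lebesgue" "z \<in> borel_measurable lebesgue" for w x z
    using increment_measurable[OF assms(6) f_measurable f_cont ym yhm um that]
      increment_measurable[OF assms(6) g_measurable g_cont' ym yhm um that] by auto
  have incf_Lip: "norm (increment T f ystar yh ustar w s a b - increment T f ystar yh ustar w s a' b')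
      \<le> l s * (norm (a - a') + norm (b - b'))" for w s a b a' b'
    using increment_Lipschitz[of T f L, OF f_Lip, of ystar yh ustar w s a b a' b'] by (simp add: l_def)
  have incg_Lip: "\<bar>increment T g ystar yh ustar w s a b - increment T g ystar yh ustar w s a' b'\<bar>
      \<le> Lbar * indicator {0..T} s * (norm (a - a') + norm (b - b'))" for w s a b a' b'
    using increment_Lipschitz[of T g "\<lambda>_. Lbar", OF g_Lip, of ystar yh ustar w s a b a' b'] by (simp add: mult_ac)
  have \<phi>m: "(\<lambda>s. \<phi> s (x s) (z s)) \<in> borel_measurable lebesgue"
    and \<gamma>m: "(\<lambda>s. \<gamma> s (x s) (z s)) \<in> borel_measurable lebesgue"
    if "x \<in> borel_measurable lebesgue" "z \<in> borel_measurable lebesgue" for x z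
    unfolding \<phi>_def \<gamma>_def by (intro inc_f inc_g um that)+
  have \<phi>_Lip: "norm (\<phi> s a b - \<phi> s a' b') \<le> l s * (norm (a - a') + norm (b - b'))" for s a b a' b'
    unfolding \<phi>_def by (rule incf_Lip)
  have \<gamma>_Lip: "\<bar>\<gamma> s a b - \<gamma> s a' b'\<bar> \<le> Lbar * indicator {0..T} s * (norm (a - a') + norm (b - b'))" for s a b a' b'
    unfolding \<gamma>_def by (rule incg_Lip)
  have \<phi>_out: "\<phi> s a b = 0" "\<gamma> s a b = 0" if "s \<notin> {0..T}" for s a b
    unfolding \<phi>_def \<gamma>_def by (rule increment_outside[OF that])+
  have \<phi>_deriv: "((\<lambda>(a, b). \<phi> s a b) has_derivative (\<lambda>(a, b). A s a + B s b)) (at (0, 0))"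
    and \<gamma>_deriv: "((\<lambda>(a, b). \<gamma> s a b) has_derivative (\<lambda>(a, b). \<pi> s \<bullet> a + k s \<bullet> b)) (at (0, 0))" for s
  proof -
    have "((\<lambda>(a, b). \<phi> s a b) has_derivative (\<lambda>(a, b). A s a + B s b)) (at (0, 0)) \<and>
      ((\<lambda>(a, b). \<gamma> s a b) has_derivative (\<lambda>(a, b). \<pi> s \<bullet> a + k s \<bullet> b)) (at (0, 0))"
    proof (cases "s \<in> {0..T}")
      case True
      show ?thesis
        using increment_has_derivative[where F=f and u=ustar and y=ystar and yh=yh, OF True continuously_differentiable_jacobian[OF f_C1[OF True]]]
          increment_has_derivative[where F=g and u=ustar and y=ystar and yh=yh, OF True continuously_differentiable_grad[OF g_C1[OF True]]] True
        by (simp add: \<phi>_def \<gamma>_def A_def B_def \<pi>_def k_def Jac_y_def Jac_yh_def grad_y_def grad_yh_def)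
    next
      case False
      then show ?thesis
        using \<phi>_out[OF False] by (simp add: A_def B_def \<pi>_def k_def case_prod_unfold)
    qed
    then show "((\<lambda>(a, b). \<phi> s a b) has_derivative (\<lambda>(a, b). A s a + B s b)) (at (0, 0))"
      "((\<lambda>(a, b). \<gamma> s a b) has_derivative (\<lambda>(a, b). \<pi> s \<bullet> a + k s \<bullet> b)) (at (0, 0))" by auto
  qed
  have AB0: "A s 0 = 0" "B s 0 = 0" for s by (simp_all add: A_def B_def)
  \<comment> \<open>Partial derivatives at the origin serve twice: as limits of difference quotients
    for measurability, and through the Lipschitz bounds for the size of \<open>A\<close> and
    \<open>B\<close>.\<close>
  have AD: "((\<lambda>a. \<phi> s a 0) has_derivative A s) (at 0)" "((\<lambda>b. \<phi> s 0 b) has_derivative B s) (at 0)" for s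
    using has_derivative_partials[OF \<phi>_deriv[of s]] AB0 by simp_all
  have gD: "((\<lambda>a. \<gamma> s a 0) has_derivative (\<lambda>a. \<pi> s \<bullet> a)) (at 0)"
    "((\<lambda>b. \<gamma> s 0 b) has_derivative (\<lambda>a. k s \<bullet> a)) (at 0)" for s
    using has_derivative_partials[OF \<gamma>_deriv[of s]] by simp_all
  have Am: "(\<lambda>s. A s (x s)) \<in> borel_measurable lebesgue" and Bm: "(\<lambda>s. B s (x s)) \<in> borel_measurable lebesgue"
    and \<pi>xm: "(\<lambda>s. \<pi> s \<bullet> x s) \<in> borel_measurable lebesgue" and kxm: "(\<lambda>s. k s \<bullet> x s) \<in> borel_measurable lebesgue"
    if x: "x \<in> borel_measurable lebesgue" for x
  proof -
    show "(\<lambda>s. A s (x s)) \<in> borel_measurable lebesgue"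
      by (rule has_derivative_measurable[where F="\<lambda>s a. \<phi> s a 0", OF \<phi>m AD(1) x]) auto
    show "(\<lambda>s. B s (x s)) \<in> borel_measurable lebesgue"
      by (rule has_derivative_measurable[where F="\<lambda>s a. \<phi> s 0 a", OF \<phi>m AD(2) x]) auto
    show "(\<lambda>s. \<pi> s \<bullet> x s) \<in> borel_measurable lebesgue"
      by (rule has_derivative_measurable[where F="\<lambda>s a. \<gamma> s a 0", OF \<gamma>m gD(1) x]) auto
    show "(\<lambda>s. k s \<bullet> x s) \<in> borel_measurable lebesgue"
      by (rule has_derivative_measurable[where F="\<lambda>s a. \<gamma> s 0 a", OF \<gamma>m gD(2) x]) auto
  qed
  have \<pi>m: "\<pi> \<in> borel_measurable lebesgue" and km: "k \<in> borel_measurable lebesgue"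
    using borel_measurable_representer[of lebesgue \<pi>] borel_measurable_representer[of lebesgue k] \<pi>xm kxm by blast+
  have A_bound: "norm (A s a) \<le> l s * norm a" and B_bound: "norm (B s a) \<le> l s * norm a" for s a
    using has_derivative_bound_Lipschitz[OF AD(1)[of s], of "l s" a] has_derivative_bound_Lipschitz[OF AD(2)[of s], of "l s" a]
      \<phi>_Lip[of s _ 0 0 0] \<phi>_Lip[of s 0 _ 0 0] by simp_all
  have \<pi>_bound: "norm (\<pi> s) \<le> Lbar * indicator {0..T} s" and k_bound: "norm (k s) \<le> Lbar * indicator {0..T} s" for s
    using gy(1,2) by (auto simp: \<pi>_def k_def indicator_def)
  have At: "At s x \<bullet> a = x \<bullet> A s a" and Bt: "Bt s x \<bullet> a = x \<bullet> B s a" for s x a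
    by (simp_all add: A_def At_def B_def Bt_def dot_lmul_matrix)
  have Atm: "(\<lambda>s. At s (x s)) \<in> borel_measurable lebesgue" and Btm: "(\<lambda>s. Bt s (x s)) \<in> borel_measurable lebesgue"
    if "x \<in> borel_measurable lebesgue" for x
    using borel_measurable_adjoint[of lebesgue A At x] borel_measurable_adjoint[of lebesgue B Bt x] Am Bm At Bt that
    by blast+
  have At_bound: "norm (At s x) \<le> l s * norm x" and Bt_bound: "norm (Bt s x) \<le> l s * norm x" for s x
    by (rule adjoint_bound[OF At A_bound r_integrable_nonneg[OF l]],
        rule adjoint_bound[OF Bt B_bound r_integrable_nonneg[OF l]])
  have At_diff: "At s x - At s x' = At s (x - x')" and Bt_diff: "Bt s x - Bt s x' = Bt s (x - x')" for s x x'
    by (simp_all add: At_def Bt_def matrix_vector_mult_diff_distrib scaleR_diff_right)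

  \<comment> \<open>The adjoint state\<close>
  let ?i = "indicator {0<..<T - h} :: real \<Rightarrow> real"
  \<comment> \<open>The characteristic function is kept, so that the solution satisfies the adjoint
    equation in exactly the stated form.\<close>
  define \<Theta> where "\<Theta> s a b = indicator {0..T} s *\<^sub>R (- \<pi> s - ?i s *\<^sub>R k (s + h) + At s a + ?i s *\<^sub>R Bt (s + h) b)" for s a b
  have ind: "r_integrable (indicator {0..T} :: real \<Rightarrow> real)"
    using \<open>T > 0\<close> by (intro r_integrable_indicator) auto
  \<comment> \<open>The delayed Jacobian enters at \<open>s + h\<close>, so its Lipschitz weight is
    the translate of \<open>l\<close>.\<close>
  have l2: "r_integrable (\<lambda>s. l s + l (s + h))" by (intro r_integrable_add l r_integrable_shift)
  have m2: "r_integrable (\<lambda>s. Lbar * indicator {0..T} s + Lbar * indicator {0..T} (s + h))"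
    using Lbar_pos by (intro r_integrable_add r_integrable_cmult ind r_integrable_shift[OF ind]) auto
  have \<Theta>m: "(\<lambda>s. \<Theta> s (x s) (z s)) \<in> borel_measurable lebesgue"
    if x: "x \<in> borel_measurable lebesgue" and z: "z \<in> borel_measurable lebesgue" for x z
  proof -
    have "(\<lambda>s. Bt (s + h) (z s)) \<in> borel_measurable lebesgue"
      using shift_measurable_lebesgue(1)[OF Btm[OF shift_measurable_lebesgue(2)[OF z, of h]], of h] by simp
    note [measurable] = this \<pi>m shift_measurable_lebesgue(1)[OF km, of h] Atm[OF x]
    show ?thesis unfolding \<Theta>_def by measurable
  qed
  have i_le: "norm (?i s *\<^sub>R x) \<le> norm x" for s and x :: "real^'n" by (simp add: indicator_def)
  have \<Theta>0: "norm (\<Theta> s 0 0) \<le> Lbar * indicator {0..T} s + Lbar * indicator {0..T} (s + h)" for s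
  proof -
    have "norm (\<Theta> s 0 0) \<le> norm (- \<pi> s - ?i s *\<^sub>R k (s + h))"
      by (simp add: \<Theta>_def At_def Bt_def indicator_def)
    also have "\<dots> \<le> norm (\<pi> s) + norm (k (s + h))"
      using norm_triangle_ineq4[of "- \<pi> s" "?i s *\<^sub>R k (s + h)"] i_le[of s "k (s + h)"] by simp
    also have "\<dots> \<le> Lbar * indicator {0..T} s + Lbar * indicator {0..T} (s + h)"
      by (intro add_mono \<pi>_bound k_bound)
    finally show ?thesis .
  qed
  have \<Theta>_Lip: "norm (\<Theta> s a b - \<Theta> s a' b') \<le> (l s + l (s + h)) * (norm (a - a') + norm (b - b'))" for s a b a' b'
  proof -
    have "\<Theta> s a b - \<Theta> s a' b' = indicator {0..T} s *\<^sub>R (At s (a - a') + ?i s *\<^sub>R Bt (s + h) (b - b'))"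
      unfolding \<Theta>_def At_diff[symmetric] Bt_diff[symmetric] by (simp add: algebra_simps)
    also have "norm \<dots> \<le> norm (At s (a - a') + ?i s *\<^sub>R Bt (s + h) (b - b'))" by (simp add: indicator_def)
    also have "\<dots> \<le> norm (At s (a - a')) + norm (Bt (s + h) (b - b'))"
      using norm_triangle_ineq[of "At s (a - a')" "?i s *\<^sub>R Bt (s + h) (b - b')"] i_le[of s "Bt (s + h) (b - b')"] by simp
    also have "\<dots> \<le> l s * norm (a - a') + l (s + h) * norm (b - b')" by (intro add_mono At_bound Bt_bound)
    also have "\<dots> \<le> (l s + l (s + h)) * (norm (a - a') + norm (b - b'))"
      using r_integrable_nonneg[OF l, of s] r_integrable_nonneg[OF l, of "s + h"] by (simp add: algebra_simps)
    finally show ?thesis .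
  qed
  obtain \<psi> \<Psi> where \<psi>m: "\<psi> \<in> borel_measurable lebesgue" and \<Psi>: "0 \<le> \<Psi>" and \<psi>_bound: "\<And>t. norm (\<psi> t) \<le> \<Psi>"
    and \<psi>_out: "\<And>t. t \<notin> {0..T} \<Longrightarrow> \<psi> t = 0"
    and \<psi>_int: "\<And>t. t \<in> {0..T} \<Longrightarrow> integrable lebesgue (\<lambda>s. kern (s - t) *\<^sub>R \<Theta> s (\<psi> s) (\<psi> (s + h)))"
    and \<psi>_eq: "\<And>t. t \<in> {0..T} \<Longrightarrow> \<psi> t = (\<integral>s. kern (s - t) *\<^sub>R \<Theta> s (\<psi> s) (\<psi> (s + h)) \<partial>lebesgue)"
    by (rule backward_Volterra_solution[OF l2 m2 less_imp_le[OF \<open>h > 0\<close>] \<Theta>m \<Theta>0 \<Theta>_Lip], assumption, assumption, rule that)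
  define G where "G s = \<Theta> s (\<psi> s) (\<psi> (s + h))" for s
  have \<Theta>_rhs: "G s = indicator {0..T} s *\<^sub>R adjoint_rhs T h f g ystar ustar \<psi> s" for s
    using \<open>h > 0\<close>
    by (cases "s \<in> {0..T}"; cases "s \<in> {0<..<T - h}")
      (simp_all add: G_def \<Theta>_def adjoint_rhs_def \<pi>_def k_def At_def Bt_def yh_def)
  have G_out: "G s = 0" if "s \<notin> {0..T}" for s using that by (simp add: \<Theta>_rhs)
  have Gm: "G \<in> borel_measurable lebesgue"
    unfolding G_def by (intro \<Theta>m \<psi>m shift_measurable_lebesgue)
  \<comment> \<open>For \<open>s > 0\<close> the characteristic function and the support of the
    shifted coefficients can disagree only at \<open>s = T - h\<close>, a null set.\<close>
  have G_eq: "AE s in lebesgue. 0 < s \<longrightarrow> G s = - \<pi> s - k (s + h) + At s (\<psi> s) + Bt (s + h) (\<psi> (s + h))"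
  proof -
    have "AE s in lebesgue. s \<noteq> T - h" by (rule AE_I'[of "{T - h}"]) auto
    then show ?thesis
    proof eventually_elim
      case (elim s)
      show ?case
        using elim \<open>h > 0\<close>
        by (cases "s \<in> {0..T}"; cases "s \<in> {0<..<T - h}")
          (auto simp: G_def \<Theta>_def \<pi>_def k_def At_def Bt_def)
    qed
  qed
  have adjoint: "right_Caputo_solution \<alpha> T (adjoint_rhs T h f g ystar ustar \<psi>) \<psi>"
    unfolding right_Caputo_solution_iff \<Theta>_rhs[symmetric] G_def using \<psi>_int \<psi>_eq by blast
  \<comment> \<open>At \<open>T\<close> the kernel sees only \<open>s > T\<close>, where
    \<open>\<Theta>\<close> is cut off; beyond \<open>T\<close> the solution is zero by
    construction.\<close>
  have \<psi>_T: "\<psi> t = 0" if "t \<in> {T..T + h}" for t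
  proof (cases "t = T")
    case True
    have "kern (s - T) *\<^sub>R \<Theta> s (\<psi> s) (\<psi> (s + h)) = 0" for s
      by (cases "s \<le> T") (simp_all add: kern_def \<Theta>_def)
    then have "(\<integral>s. kern (s - T) *\<^sub>R \<Theta> s (\<psi> s) (\<psi> (s + h)) \<partial>lebesgue) = 0"
      by (simp only: Bochner_Integration.integral_zero)
    then show ?thesis using \<psi>_eq[of T] \<open>T > 0\<close> True by simp
  qed (use that \<psi>_out[of t] in auto)

  \<comment> \<open>Comparison with one fixed control value\<close>
  have AE_v: "AE t in lebesgue. t \<in> {0..T} \<longrightarrow>
      \<psi> t \<bullet> f t (ystar t) (yh t) v - g t (ystar t) (yh t) v \<le>
      \<psi> t \<bullet> f t (ystar t) (yh t) (ustar t) - g t (ystar t) (yh t) (ustar t)" for v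
  proof -
    define \<phi>v where "\<phi>v = increment T f ystar yh ustar (\<lambda>_. v)"
    define \<gamma>v where "\<gamma>v = increment T g ystar yh ustar (\<lambda>_. v)"
    have vm: "(\<lambda>_. v) \<in> borel_measurable (lebesgue_on {0..T})" by simp
    have \<phi>vm: "(\<lambda>s. \<phi>v s (x s) (z s)) \<in> borel_measurable lebesgue"
      and \<gamma>vm: "(\<lambda>s. \<gamma>v s (x s) (z s)) \<in> borel_measurable lebesgue"
      if "x \<in> borel_measurable lebesgue" "z \<in> borel_measurable lebesgue" for x z
      unfolding \<phi>v_def \<gamma>v_def by (intro inc_f inc_g vm that)+
    have \<gamma>v0: "integrable lebesgue (\<lambda>s. \<gamma>v s 0 0)"
      using Bochner_Integration.integrable_diff[OF g_int[OF vm] g_int[OF um]]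
      by (simp add: \<gamma>v_def increment_def algebra_simps)
    interpret sv: spike_variation \<alpha> T r h Lbar \<Psi> l \<phi> \<phi>v \<gamma> \<gamma>v A B At Bt \<pi> k \<psi> G
    proof unfold_locales
      show "\<psi> \<tau> = (\<integral>s. kern (s - \<tau>) *\<^sub>R G s \<partial>lebesgue)" if "\<tau> \<in> {0..T}" for \<tau>
        unfolding G_def by (rule \<psi>_eq[OF that])
      show "0 \<le> Lbar" using Lbar_pos by simp
      show "\<phi> s 0 0 = 0" "\<gamma> s 0 0 = 0" for s by (simp_all add: \<phi>_def \<gamma>_def increment_self)
      show "\<phi>v s a b = 0" "\<gamma>v s a b = 0" if "s \<notin> {0..T}" for s a b
        unfolding \<phi>v_def \<gamma>v_def by (rule increment_outside[OF that])+
      show "norm (\<phi>v s a b - \<phi>v s a' b') \<le> l s * (norm (a - a') + norm (b - b'))" for s a b a' b'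
        unfolding \<phi>v_def by (rule incf_Lip)
      show "\<bar>\<gamma>v s a b - \<gamma>v s a' b'\<bar> \<le> Lbar * indicator {0..T} s * (norm (a - a') + norm (b - b'))" for s a b a' b'
        unfolding \<gamma>v_def by (rule incg_Lip)
    qed (fact \<open>h > 0\<close> \<Psi> l l_supp \<phi>m \<phi>vm \<gamma>m \<gamma>vm \<phi>_out \<phi>_Lip \<gamma>_Lip A_bound B_bound \<pi>_bound k_bound
        At Bt Am Bm \<pi>m km \<psi>m \<psi>_bound Gm G_out G_eq \<gamma>v0 | rule \<phi>_deriv \<gamma>_deriv)+
    have "AE s in lebesgue. 0 \<le> \<gamma>v s 0 0 - \<psi> s \<bullet> \<phi>v s 0 0"
    proof (rule sv.maximum_principle)
      fix E d
      assume E: "E \<in> sets lebesgue" "E \<subseteq> {0..T}" and d: "sv.variation E d"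
      \<comment> \<open>Every variation yields a competitor: splicing a constant into
        \<open>ustar\<close> stays in \<open>controls\<close>, and adding the two integral equations
        makes \<open>ystar + d\<close> its state.\<close>
      define w where "w = (\<lambda>s. if s \<in> E then v else ustar s)"
      define x where "x s = ystar s + d s" for s
      have spf: "spike E \<phi> \<phi>v = increment T f ystar yh ustar w"
        and spg: "spike E \<gamma> \<gamma>v = increment T g ystar yh ustar w"
        by (simp_all add: \<phi>_def \<phi>v_def \<gamma>_def \<gamma>v_def spike_increment w_def)
      have rhs: "indicator {0..T} s *\<^sub>R f s (x s) (x (s - h)) (w s) =
          indicator {0..T} s *\<^sub>R f s (ystar s) (ystar (s - h)) (ustar s) + spike E \<phi> \<phi>v s (d s) (d (s - h))" for s
        unfolding spf by (simp add: increment_def x_def yh_def scaleR_diff_right)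
      have "left_Caputo_solution \<alpha> T (\<lambda>s. f s (x s) (x (s - h)) (w s)) x"
        unfolding left_Caputo_solution_iff
      proof
        fix t assume t: "t \<in> {0..T}"
        have 1: "integrable lebesgue (\<lambda>s. kern (t - s) *\<^sub>R (indicator {0..T} s *\<^sub>R f s (ystar s) (ystar (s - h)) (ustar s)))"
          "ystar t = (\<integral>s. kern (t - s) *\<^sub>R (indicator {0..T} s *\<^sub>R f s (ystar s) (ystar (s - h)) (ustar s)) \<partial>lebesgue)"
          using state t unfolding left_Caputo_solution_iff by auto
        have 2: "integrable lebesgue (\<lambda>s. kern (t - s) *\<^sub>R spike E \<phi> \<phi>v s (d s) (d (s - h)))"
          "d t = (\<integral>s. kern (t - s) *\<^sub>R spike E \<phi> \<phi>v s (d s) (d (s - h)) \<partial>lebesgue)"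
          using d t unfolding sv.variation_def by auto
        show "integrable lebesgue (\<lambda>s. kern (t - s) *\<^sub>R (indicator {0..T} s *\<^sub>R f s (x s) (x (s - h)) (w s))) \<and>
            x t = (\<integral>s. kern (t - s) *\<^sub>R (indicator {0..T} s *\<^sub>R f s (x s) (x (s - h)) (w s)) \<partial>lebesgue)"
          unfolding rhs scaleR_add_right
          using Bochner_Integration.integrable_add[OF 1(1) 2(1)] Bochner_Integration.integral_add[OF 1(1) 2(1)] 1(2) 2(2)
          by (simp only: x_def)
      qed
      moreover have "x t = 0" if "t \<in> {-h..0}" for t
        using that y0[OF that] sv.variation_nonpos[OF d E, of t] by (simp add: x_def)
      ultimately have x_state: "is_state \<alpha> T h f w x" unfolding is_state_def by blast
      have wm: "w \<in> borel_measurable (lebesgue_on {0..T})"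
        unfolding w_def by (rule measurable_If_set[OF vm um]) (use E in \<open>auto simp: sets_restrict_space_iff\<close>)
      have w_control: "w \<in> controls p T u0"
      proof -
        have sub: "F \<in> borel_measurable (lebesgue_on {0..T}) \<Longrightarrow> F \<in> borel_measurable (lebesgue_on {0<..<T})" for F :: "real \<Rightarrow> real"
          by (rule measurable_restrict_mono[of F lebesgue "{0..T}"]) auto
        have dist_m: "(\<lambda>t. dist (w t) u0) \<in> borel_measurable (lebesgue_on {0<..<T})"
          by (rule sub, rule measurable_compose[OF wm]) (intro borel_measurable_continuous_onI continuous_intros)
        have "integrable (lebesgue_on {0<..<T}) (\<lambda>t. norm (dist (w t) u0) powr p)"
        proof (rule Bochner_Integration.integrable_bound)
          interpret finite_measure "lebesgue_on {0<..<T}" by (rule finite_measure_lebesgue_on) simp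
          show "integrable (lebesgue_on {0<..<T}) (\<lambda>t. norm (dist (ustar t) u0) powr p + dist v u0 powr p)"
            using up unfolding Lp_def by (intro Bochner_Integration.integrable_add integrable_const) auto
          show "(\<lambda>t. norm (dist (w t) u0) powr p) \<in> borel_measurable (lebesgue_on {0<..<T})"
            using dist_m by measurable
        qed (auto simp: w_def)
        then show ?thesis using wm dist_m by (simp add: controls_def Lp_def)
      qed
      have "ereal (cost T h g ustar ystar) \<le> ereal (cost T h g w x)"
        unfolding inf using w_control x_state by (intro Inf_lower) blast
      then have le: "cost T h g ustar ystar \<le> cost T h g w x" by simp
      show "0 \<le> (\<integral>s. spike E \<gamma> \<gamma>v s (d s) (d (s - h)) \<partial>lebesgue)"
      \<comment> \<open>A non-integrable function has integral 0 by convention, so the cost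
        comparison concerns the integrable case.\<close>
      proof (cases "integrable lebesgue (\<lambda>s. spike E \<gamma> \<gamma>v s (d s) (d (s - h)))")
        case True
        have "indicator {0..T} s *\<^sub>R g s (x s) (x (s - h)) (w s) =
            indicator {0..T} s *\<^sub>R g s (ystar s) (yh s) (ustar s) + spike E \<gamma> \<gamma>v s (d s) (d (s - h))" for s
          unfolding spg by (simp add: increment_def x_def yh_def right_diff_distrib)
        then have "cost T h g w x = cost T h g ustar ystar + (\<integral>s. spike E \<gamma> \<gamma>v s (d s) (d (s - h)) \<partial>lebesgue)"
          unfolding cost_def set_lebesgue_integral_def yh_def[symmetric]
          using Bochner_Integration.integral_add[OF g_int[OF um] True] by (simp add: yh_def)
        with le show ?thesis by simp
      qed (simp add: not_integrable_integral_eq)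
    qed
    then show ?thesis
    proof eventually_elim
      case (elim t)
      show ?case
      proof
        assume "t \<in> {0..T}"
        with elim show "\<psi> t \<bullet> f t (ystar t) (yh t) v - g t (ystar t) (yh t) v \<le>
            \<psi> t \<bullet> f t (ystar t) (yh t) (ustar t) - g t (ystar t) (yh t) (ustar t)"
          by (simp add: \<gamma>v_def \<phi>v_def increment_def inner_diff_right)
      qed
    qed
  qed

  \<comment> \<open>From a dense set of control values to the maximum\<close>
  obtain C :: "'u set" where C: "countable C" "closure C = UNIV"
    using assms(6) unfolding separable_space_def by auto
  have "AE t in lebesgue. \<forall>v\<in>C. t \<in> {0..T} \<longrightarrow>
      \<psi> t \<bullet> f t (ystar t) (yh t) v - g t (ystar t) (yh t) v \<le>
      \<psi> t \<bullet> f t (ystar t) (yh t) (ustar t) - g t (ystar t) (yh t) (ustar t)"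
    using AE_v by (intro AE_ball_countable'[OF _ C(1)])
  then have "AE t in lebesgue. t \<in> {0..T} \<longrightarrow> is_maximum
        (\<psi> t \<bullet> f t (ystar t) (ystar (t - h)) (ustar t) - g t (ystar t) (ystar (t - h)) (ustar t))
        (range (\<lambda>v. \<psi> t \<bullet> f t (ystar t) (ystar (t - h)) v - g t (ystar t) (ystar (t - h)) v))"
  proof eventually_elim
    case (elim t)
    show ?case
    proof
      assume t: "t \<in> {0..T}"
      let ?H = "\<lambda>v. \<psi> t \<bullet> f t (ystar t) (yh t) v - g t (ystar t) (yh t) v"
      have "continuous_on UNIV (\<lambda>v. f t (ystar t) (yh t) v)"
        using continuous_on_compose2[OF f_cont[OF t], of UNIV "\<lambda>u. (ystar t, yh t, u)"]
        by (simp add: continuous_on_Pair)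
      moreover have "continuous_on UNIV (\<lambda>v. g t (ystar t) (yh t) v)"
        using continuous_on_compose2[OF g_cont'[OF t], of UNIV "\<lambda>u. (ystar t, yh t, u)"]
        by (simp add: continuous_on_Pair)
      ultimately have "continuous_on UNIV ?H" by (intro continuous_intros)
      \<comment> \<open>The null set was fixed once for all values in \<open>C\<close>; outside it,
        a closed set containing the dense set \<open>C\<close> is the whole control space.\<close>
      then have "closed {v. ?H v \<le> ?H (ustar t)}"
        by (intro closed_Collect_le continuous_on_const)
      moreover have "C \<subseteq> {v. ?H v \<le> ?H (ustar t)}" using elim t by auto
      ultimately have "closure C \<subseteq> {v. ?H v \<le> ?H (ustar t)}" by (rule closure_minimal[rotated])
      then have "?H v \<le> ?H (ustar t)" for v using C(2) by auto
      then show "is_maximum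
        (\<psi> t \<bullet> f t (ystar t) (ystar (t - h)) (ustar t) - g t (ystar t) (ystar (t - h)) (ustar t))
        (range (\<lambda>v. \<psi> t \<bullet> f t (ystar t) (ystar (t - h)) v - g t (ystar t) (ystar (t - h)) v))"
        unfolding is_maximum_def yh_def by auto
    qed
  qed
  then have max: "AE t in lebesgue_on {0..T}. is_maximum
        (\<psi> t \<bullet> f t (ystar t) (ystar (t - h)) (ustar t) - g t (ystar t) (ystar (t - h)) (ustar t))
        (range (\<lambda>v. \<psi> t \<bullet> f t (ystar t) (ystar (t - h)) v - g t (ystar t) (ystar (t - h)) v))"
    by (subst AE_restrict_space_iff) auto
  \<comment> \<open>As \<psi> is bounded and the interval has finite length, any positive exponent
    is admissible.\<close>
  have "Lp (p / (p - 1)) T \<psi>"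
    unfolding Lp_def
  proof
    show \<psi>m': "\<psi> \<in> borel_measurable (lebesgue_on {0<..<T})" by (rule measurable_restrict_space1[OF \<psi>m])
    interpret finite_measure "lebesgue_on {0<..<T}" by (rule finite_measure_lebesgue_on) simp
    show "integrable (lebesgue_on {0<..<T}) (\<lambda>t. norm (\<psi> t) powr (p / (p - 1)))"
    proof (rule integrable_const_bound[where B="\<Psi> powr (p / (p - 1))"])
      show "AE t in lebesgue_on {0<..<T}. norm (norm (\<psi> t) powr (p / (p - 1))) \<le> \<Psi> powr (p / (p - 1))"
        using p1 \<psi>_bound by (intro AE_I2) (auto intro!: powr_mono2)
    qed (use \<psi>m' in measurable)
  qed
  with adjoint \<psi>_T max show ?thesis by blast
qed

end
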